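(* Let $\varphi\colon G\times M\to M$ be a left action of a Lie group $G$ on an analytic manifold $M$ (continuous in $G$) that is sated and separately analytic. Let $\gamma\colon D\to M$ be a non-constant analytic curve that is exponential w.r.t. $(x,\vec g)$, where $x\in M$, $\vec g\in\mathfrak g$. Then, for $y\in M$ and $\vec q\in\mathfrak g$, the curve $\gamma$ is exponential w.r.t. $(y,\vec q)$ if and only if $$y\in \exp(\mathbb{R}\cdot\vec g)\cdot x\qquad\text{and}\qquad \vec q\in \mathbb{R}_{\neq 0}\cdot \vec g+\mathfrak g_\gamma,$$ where $\mathfrak g_\gamma$ is the Lie algebra of the stabilizer $G_\gamma=\{g\in G: g\cdot\gamma=\gamma\}$.
   Context: Intervals are connected subsets of $\mathbb{R}$ with non-empty interior. $M$ is a finite-dimensional Hausdorff real-analytic manifold without boundary (second countability is not assumed); $G$ is a Lie group (same conventions) with Lie algebra $\mathfrak g$ and exponential map $\exp$; $\varphi\colon G\times M\to M$, $(g,x)\mapsto g\cdot x$, is a left action such that $g\mapsto g\cdot x$ is continuous for each fixed $x\in M$. $\varphi$ is separately analytic if $g\mapsto g\cdot x$ is analytic for each $x\in M$ and $x\mapsto g\cdot x$ is analytic for each $g\in G$. $\varphi$ is sated if for mutually different $x,y,z\in M$ there is no sequence $\{g_n\}\subseteq G$ with $\lim_n g_n\cdot y=x=\lim_n g_n\cdot z$. A curve $\gamma\colon D\to M$ on an interval $D$ (or a map $\rho\colon D\to\mathbb{R}$) is analytic if it extends to an analytic map on an open interval containing $D$. $(g\cdot\gamma)(t):=g\cdot\gamma(t)$;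 $G_\gamma$ is a closed subgroup of $G$. An analytic curve $\gamma\colon D\to M$ is exponential w.r.t. $(x,\vec g)\in M\times\mathfrak g$ if there is an analytic map $\rho\colon D\to\mathbb{R}$ with $\gamma(t)=\exp(\rho(t)\cdot\vec g)\cdot x$ for all $t\in D$. *)

theory Defs
  imports "HOL-Analysis.Analysis"
begin

section \<open>Real-analytic maps\<close>

text \<open>Local expansion into an unconditionally convergent power series in several variables;
  a multi-index assigns an exponent to each basis vector.\<close>

definition real_analytic_at ::
  "('a::euclidean_space \<Rightarrow> 'b::real_normed_vector) \<Rightarrow> 'a \<Rightarrow> bool" where
  "real_analytic_at f a \<longleftrightarrow>
     (\<exists>r>0. \<exists>coef :: ('a \<Rightarrow> nat) \<Rightarrow> 'b. \<forall>x\<in>ball a r.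
        ((\<lambda>\<alpha>. (\<Prod>b\<in>Basis. ((x - a) \<bullet> b) ^ \<alpha> b) *\<^sub>R coef \<alpha>) has_sum f x)
          (Basis \<rightarrow>\<^sub>E UNIV))"


section \<open>Analytic manifolds\<close>

text \<open>The underlying Hausdorff space is a type; the analytic structure is given by a (not
  necessarily maximal) atlas. A chart \<open>(U, \<phi>)\<close> consists of its domain and a map that is only
  relevant on that domain.\<close>

type_synonym ('m, 'e) chart = "'m set \<times> ('m \<Rightarrow> 'e)"
type_synonym ('m, 'e) atlas = "('m, 'e) chart set"

definition chart_rep ::
  "('m, 'e) chart \<Rightarrow> ('n, 'f) chart \<Rightarrow> ('m \<Rightarrow> 'n) \<Rightarrow> 'e \<Rightarrow> 'f" where
  "chart_rep c d f = snd d \<circ> f \<circ> inv_into (fst c) (snd c)"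

locale analytic_manifold =
  fixes A :: "('m::t2_space, 'e::euclidean_space) atlas"
  assumes open_domain: "(U, \<phi>) \<in> A \<Longrightarrow> open U"
    and open_image: "(U, \<phi>) \<in> A \<Longrightarrow> open (\<phi> ` U)"
    and chart_homeomorphism: "(U, \<phi>) \<in> A \<Longrightarrow> homeomorphism U (\<phi> ` U) \<phi> (inv_into U \<phi>)"
    and covering: "(\<Union>c\<in>A. fst c) = UNIV"
    and transition_analytic:
      "\<lbrakk>c \<in> A; d \<in> A; p \<in> fst c \<inter> fst d\<rbrakk> \<Longrightarrow> real_analytic_at (chart_rep c d id) (snd c p)"

definition std_atlas :: "('e::euclidean_space, 'e) atlas" where
  "std_atlas = {(UNIV, id)}"

definition prod_atlas ::
  "('m, 'e) atlas \<Rightarrow> ('n, 'f) atlas \<Rightarrow> ('m \<times> 'n, 'e \<times> 'f) atlas" where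
  "prod_atlas A B = {(U \<times> V, map_prod \<phi> \<psi>) | U \<phi> V \<psi>. (U, \<phi>) \<in> A \<and> (V, \<psi>) \<in> B}"

text \<open>To be used for open \<open>W\<close> only; continuity ensures that the chart representations are
  meaningful in a neighbourhood of the point of expansion.\<close>

definition analytic_map_on ::
  "('m::t2_space, 'e::euclidean_space) atlas \<Rightarrow> ('n::t2_space, 'f::euclidean_space) atlas \<Rightarrow>
   'm set \<Rightarrow> ('m \<Rightarrow> 'n) \<Rightarrow> bool" where
  "analytic_map_on A B W f \<longleftrightarrow>
     continuous_on W f \<and>
     (\<forall>c\<in>A. \<forall>d\<in>B. \<forall>p\<in>W. p \<in> fst c \<longrightarrow> f p \<in> fst d \<longrightarrow>
        real_analytic_at (chart_rep c d f) (snd c p))"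

definition real_interval :: "real set \<Rightarrow> bool" where
  "real_interval D \<longleftrightarrow> connected D \<and> interior D \<noteq> {}"

definition analytic_curve_on ::
  "('m::t2_space, 'e::euclidean_space) atlas \<Rightarrow> real set \<Rightarrow> (real \<Rightarrow> 'm) \<Rightarrow> bool" where
  "analytic_curve_on A D \<gamma> \<longleftrightarrow>
     (\<exists>I \<gamma>'. open I \<and> real_interval I \<and> D \<subseteq> I \<and> analytic_map_on std_atlas A I \<gamma>' \<and>
        (\<forall>t\<in>D. \<gamma>' t = \<gamma> t))"


section \<open>Tangent vectors\<close>

text \<open>A tangent vector at \<open>p\<close> is the family of its coordinate vectors in all charts around \<open>p\<close>,
  related by the derivatives of the transition maps, and set to \<open>0\<close> at all other arguments.\<close>

type_synonym ('m, 'e) tangent = "('m, 'e) chart \<Rightarrow> 'e"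

definition tangent_space ::
  "('m::t2_space, 'e::euclidean_space) atlas \<Rightarrow> 'm \<Rightarrow> ('m, 'e) tangent set" where
  "tangent_space A p =
     {v. (\<forall>c. \<not> (c \<in> A \<and> p \<in> fst c) \<longrightarrow> v c = 0) \<and>
         (\<forall>c\<in>A. \<forall>d\<in>A. p \<in> fst c \<inter> fst d \<longrightarrow>
            v d = frechet_derivative (chart_rep c d id) (at (snd c p)) (v c))}"

definition tangent_add ::
  "('m, 'e::real_vector) tangent \<Rightarrow> ('m, 'e) tangent \<Rightarrow> ('m, 'e) tangent" where
  "tangent_add v w = (\<lambda>c. v c + w c)"

definition tangent_scale :: "real \<Rightarrow> ('m, 'e::real_vector) tangent \<Rightarrow> ('m, 'e) tangent" where
  "tangent_scale r v = (\<lambda>c. r *\<^sub>R v c)"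

definition has_velocity ::
  "('m::t2_space, 'e::euclidean_space) atlas \<Rightarrow> (real \<Rightarrow> 'm) \<Rightarrow> ('m, 'e) tangent \<Rightarrow> real \<Rightarrow> bool" where
  "has_velocity A \<gamma> v t \<longleftrightarrow>
     v \<in> tangent_space A (\<gamma> t) \<and>
     (\<forall>c\<in>A. \<gamma> t \<in> fst c \<longrightarrow> ((snd c \<circ> \<gamma>) has_vector_derivative v c) (at t))"


section \<open>Lie groups\<close>

locale lie_group = analytic_manifold A + group mul e invg
  for A :: "('g::t2_space, 'e::euclidean_space) atlas"
    and mul :: "'g \<Rightarrow> 'g \<Rightarrow> 'g" and e :: 'g and invg :: "'g \<Rightarrow> 'g" +
  assumes mult_analytic: "analytic_map_on (prod_atlas A A) A UNIV (\<lambda>(g, h). mul g h)"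
    and inverse_analytic: "analytic_map_on A A UNIV invg"

text \<open>The Lie algebra as the tangent space at the neutral element (only its vector space
  structure is needed here).\<close>

definition lie_algebra ::
  "('g::t2_space, 'e::euclidean_space) atlas \<Rightarrow> 'g \<Rightarrow> ('g, 'e) tangent set" where
  "lie_algebra A e = tangent_space A e"

definition one_param_subgroup ::
  "('g::t2_space, 'e::euclidean_space) atlas \<Rightarrow> ('g \<Rightarrow> 'g \<Rightarrow> 'g) \<Rightarrow> (real \<Rightarrow> 'g) \<Rightarrow> bool" where
  "one_param_subgroup A mul c \<longleftrightarrow>
     analytic_map_on std_atlas A UNIV c \<and> (\<forall>s t. c (s + t) = mul (c s) (c t))"

definition lie_exp ::
  "('g::t2_space, 'e::euclidean_space) atlas \<Rightarrow> ('g \<Rightarrow> 'g \<Rightarrow> 'g) \<Rightarrow> ('g, 'e) tangent \<Rightarrow> 'g" where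
  "lie_exp A mul v = (THE c. one_param_subgroup A mul c \<and> has_velocity A c v 0) 1"

text \<open>The Lie algebra of a closed subgroup \<open>H\<close>, as a subset of the ambient Lie algebra.\<close>

definition subgroup_lie_algebra ::
  "('g::t2_space, 'e::euclidean_space) atlas \<Rightarrow> ('g \<Rightarrow> 'g \<Rightarrow> 'g) \<Rightarrow> 'g \<Rightarrow> 'g set \<Rightarrow>
   ('g, 'e) tangent set" where
  "subgroup_lie_algebra A mul e H =
     {v \<in> lie_algebra A e. \<forall>t. lie_exp A mul (tangent_scale t v) \<in> H}"


section \<open>Actions\<close>

definition left_action ::
  "('g \<Rightarrow> 'g \<Rightarrow> 'g) \<Rightarrow> 'g \<Rightarrow> ('g \<Rightarrow> 'm \<Rightarrow> 'm) \<Rightarrow> bool" where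
  "left_action mul e act \<longleftrightarrow>
     (\<forall>x. act e x = x) \<and> (\<forall>g h x. act (mul g h) x = act g (act h x))"

definition separately_analytic ::
  "('g::t2_space, 'k::euclidean_space) atlas \<Rightarrow> ('m::t2_space, 'e::euclidean_space) atlas \<Rightarrow>
   ('g \<Rightarrow> 'm \<Rightarrow> 'm) \<Rightarrow> bool" where
  "separately_analytic G M act \<longleftrightarrow>
     (\<forall>x. analytic_map_on G M UNIV (\<lambda>g. act g x)) \<and> (\<forall>g. analytic_map_on M M UNIV (act g))"

definition sated :: "('g \<Rightarrow> 'm::t2_space \<Rightarrow> 'm) \<Rightarrow> bool" where
  "sated act \<longleftrightarrow>
     (\<forall>x y z. x \<noteq> y \<longrightarrow> y \<noteq> z \<longrightarrow> x \<noteq> z \<longrightarrow>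
        \<not> (\<exists>g :: nat \<Rightarrow> 'g. (\<lambda>n. act (g n) y) \<longlonglongrightarrow> x \<and> (\<lambda>n. act (g n) z) \<longlonglongrightarrow> x))"

definition curve_stabilizer ::
  "('g \<Rightarrow> 'm \<Rightarrow> 'm) \<Rightarrow> real set \<Rightarrow> (real \<Rightarrow> 'm) \<Rightarrow> 'g set" where
  "curve_stabilizer act D \<gamma> = {g. \<forall>t\<in>D. act g (\<gamma> t) = \<gamma> t}"

definition exponential_curve ::
  "('g::t2_space, 'k::euclidean_space) atlas \<Rightarrow> ('g \<Rightarrow> 'g \<Rightarrow> 'g) \<Rightarrow>
   ('m::t2_space, 'e::euclidean_space) atlas \<Rightarrow> ('g \<Rightarrow> 'm \<Rightarrow> 'm) \<Rightarrow>
   real set \<Rightarrow> (real \<Rightarrow> 'm) \<Rightarrow> 'm \<Rightarrow> ('g, 'k) tangent \<Rightarrow> bool" where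
  "exponential_curve G mul M act D \<gamma> x v \<longleftrightarrow>
     analytic_curve_on M D \<gamma> \<and>
     (\<exists>\<rho>. analytic_curve_on std_atlas D \<rho> \<and>
        (\<forall>t\<in>D. \<gamma> t = act (lie_exp G mul (tangent_scale (\<rho> t) v)) x))"

end

theory Submission
  imports Defs "HOL-Complex_Analysis.Conformal_Mappings"
begin

text \<open>
  Put \<open>\<alpha>(s) = exp(s v) x\<close> and \<open>\<beta>(s) = exp(s q) y\<close>. The group translates along both curves:
  \<open>exp(h v)\<close> maps \<open>\<alpha>(s)\<close> to \<open>\<alpha>(s + h)\<close>, and \<open>exp(h q)\<close> maps \<open>\<beta>(s)\<close> to \<open>\<beta>(s + h)\<close>.

  Suppose that \<open>\<gamma>\<close> is exponential with respect to both pairs. Near a parameter at which both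
  parameter functions are regular, \<open>\<alpha>(s) = \<beta>(\<tau>(s))\<close> with a local diffeomorphism \<open>\<tau>\<close>. For \<open>s0\<close>
  and \<open>s1\<close> in its domain the element \<open>g = exp((s0 - s1) v) exp((\<tau>(s1) - \<tau>(s0)) q)\<close> fixes
  \<open>\<alpha>(s0)\<close> and maps \<open>\<alpha>(s0 + a)\<close> to \<open>\<alpha>(s0 + P(a))\<close>, where \<open>P(0) = 0\<close> and
  \<open>P'(0) = \<tau>'(s0) / \<tau>'(s1)\<close>. If this quotient were smaller than 1 in absolute value, the powers of
  \<open>g\<close> would draw all points of \<open>\<alpha>\<close> near \<open>\<alpha>(s0)\<close> into \<open>\<alpha>(s0)\<close>, which satedness forbids as soon as
  two of them are different. Hence \<open>\<tau>\<close> is affine (\<open>sated_reparametrization_affine\<close>), and by the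
  identity theorem \<open>\<alpha>(s) = \<beta>(a s + b)\<close> for all real \<open>s\<close> (\<open>exponential_affine_relation\<close>).
  So \<open>y = \<alpha>(- b / a)\<close>, and \<open>exp(u q) exp(- (u / a) v)\<close> fixes every point of \<open>\<alpha>\<close>. By the product
  formula so does \<open>exp(t (q - v / a))\<close>, which says that \<open>q - v / a\<close> belongs to the Lie algebra of
  the stabilizer (\<open>stabilizer_difference\<close>).

  Conversely let \<open>q = r v + w\<close> with \<open>w\<close> in that Lie algebra. By the identity theorem an element that
  fixes \<open>\<gamma>\<close> pointwise fixes all of \<open>\<alpha>\<close>. The product formula then shows that \<open>exp(t q)\<close> acts on
  \<open>\<alpha>\<close> like \<open>exp(t r v)\<close> (\<open>orbit_add_stabilizer\<close>), and an affine change of the parameter function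
  exhibits \<open>\<gamma>\<close> as an exponential curve for \<open>(y, q)\<close>.

  Two pieces of theory support this. First, a real-analytic map is the restriction of a complex
  power series; along a curve, complex analysis in one variable applies and yields the
  compositions and the identity theorem that are needed. Secondly, in a chart around the neutral
  element, squaring is \<open>X \<mapsto> 2 X + O(|X|\<^sup>2)\<close>. Therefore the limit of \<open>h(t / 2^n)\<close> raised to the
  power \<open>2^n\<close> depends only on the initial velocity of the curve \<open>h\<close>. For a straight line \<open>h\<close> the
  limit is the one-parameter subgroup with the given velocity; it is analytic since the
  convergence is uniform for complex \<open>t\<close>. For a one-parameter subgroup \<open>h\<close> one obtains uniqueness,
  and for a product of two one-parameter subgroups the product formula (\<open>exp_product_formula\<close>).
\<close>

section \<open>Complex extension of real-analytic maps\<close>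

text \<open>Vectors of the complexification of \<open>'a\<close> are represented by their coordinates with respect to
  \<open>Basis\<close>; values at other arguments are immaterial.\<close>

definition cnorm :: "('a::euclidean_space \<Rightarrow> complex) \<Rightarrow> real" where
  "cnorm X = (\<Sum>b\<in>Basis. cmod (X b))"

text \<open>Real vectors as complex coordinate families. The value \<open>0\<close> outside \<open>Basis\<close> makes identities such as
  \<open>F (cvec x) = cvec (f x)\<close> available as equations of functions.\<close>

definition cvec :: "'a::euclidean_space \<Rightarrow> 'a \<Rightarrow> complex" where
  "cvec x b = (if b \<in> Basis then complex_of_real (x \<bullet> b) else 0)"

definition monomial :: "('a::euclidean_space \<Rightarrow> complex) \<Rightarrow> ('a \<Rightarrow> nat) \<Rightarrow> complex" where
  "monomial X \<alpha> = (\<Prod>b\<in>Basis. X b ^ \<alpha> b)"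

definition degree_of :: "('a::euclidean_space \<Rightarrow> nat) \<Rightarrow> nat" where
  "degree_of \<alpha> = (\<Sum>b\<in>Basis. \<alpha> b)"

lemma cnorm_nonneg [simp]: "0 \<le> cnorm X"
  by (simp add: cnorm_def sum_nonneg)

lemma cnorm_component_le: "b \<in> Basis \<Longrightarrow> cmod (X b) \<le> cnorm X"
  unfolding cnorm_def by (rule member_le_sum) auto

lemma cnorm_triangle: "cnorm (\<lambda>b. X b + Y b) \<le> cnorm X + cnorm Y"
  unfolding cnorm_def sum.distrib[symmetric] by (intro sum_mono norm_triangle_ineq)

lemma cnorm_scale: "cnorm (\<lambda>b. c * X b) = cmod c * cnorm X"
  unfolding cnorm_def by (simp add: norm_mult sum_distrib_left)

lemma cnorm_diff_triangle:
  "cnorm (\<lambda>b. X b - Z b) \<le> cnorm (\<lambda>b. X b - Y b) + cnorm (\<lambda>b. Y b - Z b)"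
  using cnorm_triangle[of "\<lambda>b. X b - Y b" "\<lambda>b. Y b - Z b"] by simp

lemma norm_le_cnorm_cvec: "norm x \<le> cnorm (cvec x)"
  using norm_le_l1[of x] by (simp add: cnorm_def cvec_def)

lemma cnorm_cvec_le: "cnorm (cvec (x::'a::euclidean_space)) \<le> DIM('a) * norm x"
proof -
  have "cnorm (cvec x) \<le> (\<Sum>b\<in>(Basis::'a set). norm x)"
    unfolding cnorm_def cvec_def by (intro sum_mono) (simp add: Basis_le_norm)
  then show ?thesis by simp
qed

lemma cvec_diff: "cvec (x - y) = (\<lambda>b. cvec x b - cvec y b)"
  by (auto simp: cvec_def inner_diff_left)

lemma cvec_zero [simp]: "cvec 0 = (\<lambda>b. 0)"
  by (auto simp: cvec_def)

lemma monomial_bound: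
  assumes "\<And>b. b \<in> Basis \<Longrightarrow> cmod (X b) \<le> M"
  shows "cmod (monomial X \<alpha>) \<le> M ^ degree_of \<alpha>"
proof -
  have "cmod (monomial X \<alpha>) \<le> (\<Prod>b\<in>Basis. M ^ \<alpha> b)"
    unfolding monomial_def prod_norm[symmetric] norm_power
    by (intro prod_mono) (use assms in \<open>auto intro: power_mono\<close>)
  then show ?thesis by (simp add: degree_of_def power_sum)
qed

lemma monomial_scale: "monomial (\<lambda>b. c * X b) \<alpha> = c ^ degree_of \<alpha> * monomial X \<alpha>"
  by (simp add: monomial_def degree_of_def power_sum power_mult_distrib prod.distrib)

text \<open>Rescaling by \<open>M\<close> reduces this to factors of norm at most \<open>1\<close>, for which a product changes by at
  most the sum of the changes of its factors. The factor \<open>M\<close> stands on the left to avoid the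
  truncated exponent \<open>degree_of \<alpha> - 1\<close>.\<close>

lemma monomial_diff_le:
  fixes M :: real
  assumes M: "M > 0" and X: "\<And>b. b \<in> Basis \<Longrightarrow> cmod (X b) \<le> M" and Y: "\<And>b. b \<in> Basis \<Longrightarrow> cmod (Y b) \<le> M"
  shows "M * cmod (monomial X \<alpha> - monomial Y \<alpha>) \<le> degree_of \<alpha> * M ^ degree_of \<alpha> * cnorm (\<lambda>b. X b - Y b)"
proof -
  define X' Y' where "X' = (\<lambda>b. X b / of_real M)" and "Y' = (\<lambda>b. Y b / of_real M)"
  have b: "cmod (X' b) \<le> 1" "cmod (Y' b) \<le> 1" if "b \<in> Basis" for b
    using X[OF that] Y[OF that] M by (auto simp: X'_def Y'_def norm_divide)
  have "cmod (monomial X' \<alpha> - monomial Y' \<alpha>) \<le> (\<Sum>b\<in>Basis. cmod (X' b ^ \<alpha> b - Y' b ^ \<alpha> b))"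
    unfolding monomial_def
    by (rule norm_prod_diff) (use b in \<open>auto simp: norm_power power_le_one\<close>)
  also have "\<dots> \<le> (\<Sum>b\<in>Basis. degree_of \<alpha> * cmod (X' b - Y' b))"
  proof (intro sum_mono)
    fix b :: 'a assume "b \<in> Basis"
    have "cmod (X' b ^ \<alpha> b - Y' b ^ \<alpha> b) \<le> \<alpha> b * cmod (X' b - Y' b)"
      using b[OF \<open>b \<in> Basis\<close>] by (intro norm_power_diff)
    also have "\<alpha> b \<le> degree_of \<alpha>"
      unfolding degree_of_def by (rule member_le_sum) (use \<open>b \<in> Basis\<close> in auto)
    finally show "cmod (X' b ^ \<alpha> b - Y' b ^ \<alpha> b) \<le> degree_of \<alpha> * cmod (X' b - Y' b)"
      by (simp add: mult_right_mono)
  qed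
  also have "\<dots> = degree_of \<alpha> * (cnorm (\<lambda>b. X b - Y b) / M)"
    using M by (simp add: X'_def Y'_def cnorm_def diff_divide_distrib[symmetric] norm_divide
        sum_distrib_left sum_divide_distrib)
  finally have 1: "cmod (monomial X' \<alpha> - monomial Y' \<alpha>) \<le> degree_of \<alpha> * (cnorm (\<lambda>b. X b - Y b) / M)" .
  have "monomial X \<alpha> = of_real M ^ degree_of \<alpha> * monomial X' \<alpha>"
    "monomial Y \<alpha> = of_real M ^ degree_of \<alpha> * monomial Y' \<alpha>"
    unfolding monomial_scale[symmetric] using M by (simp_all add: X'_def Y'_def)
  then have "cmod (monomial X \<alpha> - monomial Y \<alpha>) = M ^ degree_of \<alpha> * cmod (monomial X' \<alpha> - monomial Y' \<alpha>)"
    using M by (simp add: right_diff_distrib[symmetric] norm_mult norm_power)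
  also have "\<dots> \<le> M ^ degree_of \<alpha> * (degree_of \<alpha> * (cnorm (\<lambda>b. X b - Y b) / M))"
    using 1 M by (intro mult_left_mono) auto
  finally show ?thesis using M by (simp add: field_simps)
qed

definition unit_index :: "'a::euclidean_space \<Rightarrow> 'a \<Rightarrow> nat" where
  "unit_index b = restrict (\<lambda>b'. if b' = b then 1 else 0) Basis"

lemma unit_index_in: "unit_index b \<in> Basis \<rightarrow>\<^sub>E UNIV"
  by (auto simp: unit_index_def)

lemma unit_index_eq_iff: "b \<in> Basis \<Longrightarrow> b' \<in> Basis \<Longrightarrow> unit_index b = unit_index b' \<longleftrightarrow> b = b'"
  by (auto simp: unit_index_def restrict_def fun_eq_iff split: if_splits)

lemma degree_of_unit_index: "b \<in> Basis \<Longrightarrow> degree_of (unit_index b) = 1"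
  by (simp add: degree_of_def unit_index_def)

lemma monomial_unit_index:
  assumes "b \<in> Basis" shows "monomial X (unit_index b) = X b"
proof -
  have "monomial X (unit_index b) = (\<Prod>b'\<in>Basis. if b' = b then X b' else 1)"
    unfolding monomial_def by (intro prod.cong) (auto simp: unit_index_def)
  then show ?thesis using assms by simp
qed

lemma degree_of_eq_1:
  assumes \<alpha>: "\<alpha> \<in> Basis \<rightarrow>\<^sub>E UNIV" and "degree_of \<alpha> = 1"
  shows "\<exists>b\<in>Basis. \<alpha> = unit_index b"
proof -
  have "\<exists>b\<in>Basis. \<alpha> b = 1 \<and> (\<forall>b'\<in>Basis. b' \<noteq> b \<longrightarrow> \<alpha> b' = 0)"
    using assms(2) sum_eq_1_iff[of Basis \<alpha>] by (auto simp: degree_of_def)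
  then obtain b where b: "b \<in> Basis" "\<alpha> b = 1" "\<And>b'. b' \<in> Basis \<Longrightarrow> b' \<noteq> b \<Longrightarrow> \<alpha> b' = 0" by blast
  have "\<alpha> = unit_index b"
    using \<alpha> b by (auto simp: unit_index_def fun_eq_iff PiE_def extensional_def)
  with b show ?thesis by blast
qed

definition linear_term :: "('a::euclidean_space \<Rightarrow> complex) \<Rightarrow> ('a \<Rightarrow> nat) \<Rightarrow> complex" where
  "linear_term Z \<alpha> = (\<Sum>b\<in>Basis. if \<alpha> = unit_index b then Z b else 0)"

lemma linear_term_unit_index: "b \<in> Basis \<Longrightarrow> linear_term Z (unit_index b) = Z b"
proof -
  assume b: "b \<in> Basis"
  have "linear_term Z (unit_index b) = (\<Sum>b'\<in>Basis. if b' = b then Z b' else 0)"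
    unfolding linear_term_def by (intro sum.cong) (use b unit_index_eq_iff in auto)
  then show ?thesis using b by simp
qed

lemma linear_term_eq_0: "degree_of \<alpha> \<noteq> 1 \<Longrightarrow> linear_term Z \<alpha> = 0"
  unfolding linear_term_def by (intro sum.neutral) (auto simp: degree_of_unit_index)

text \<open>Degrees \<open>0\<close> and \<open>1\<close> contribute nothing. In degree \<open>d \<ge> 2\<close>, \<open>monomial_diff_le\<close> leaves one
  factor \<open>max (cnorm X) (cnorm Y)\<close> to spare, and staying within half the radius \<open>R\<close> compensates
  the factor \<open>d\<close> because \<open>d \<le> 2 ^ d\<close>. The bound can thus be summed against the coefficients of any
  series that converges absolutely at radius \<open>R\<close>.\<close>

lemma monomial_remainder:
  assumes \<alpha>: "\<alpha> \<in> Basis \<rightarrow>\<^sub>E UNIV" and R: "R > 0" and X: "cnorm X \<le> R/2" and Y: "cnorm Y \<le> R/2"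
  shows "cmod (monomial X \<alpha> - monomial Y \<alpha> - linear_term (\<lambda>b. X b - Y b) \<alpha>)
     \<le> 4 / R\<^sup>2 * R ^ degree_of \<alpha> * max (cnorm X) (cnorm Y) * cnorm (\<lambda>b. X b - Y b)"
proof -
  define d where "d = degree_of \<alpha>"
  define m where "m = max (cnorm X) (cnorm Y)"
  define \<delta> where "\<delta> = cnorm (\<lambda>b. X b - Y b)"
  have nn: "0 \<le> 4 / R\<^sup>2 * R ^ d * m * \<delta>" using R by (auto simp: m_def \<delta>_def le_max_iff_disj)
  consider "d = 0" | "d = 1" | "d \<ge> 2" by linarith
  then show ?thesis
  proof cases
    case 1
    then have z: "\<forall>b\<in>Basis. \<alpha> b = 0" by (simp add: d_def degree_of_def)
    then have "monomial X \<alpha> = monomial Y \<alpha>" by (simp add: monomial_def)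
    with 1 nn show ?thesis by (simp add: d_def linear_term_eq_0 m_def \<delta>_def)
  next
    case 2
    then obtain b where "b \<in> Basis" "\<alpha> = unit_index b" using degree_of_eq_1[OF \<alpha>] d_def by auto
    then have "monomial X \<alpha> - monomial Y \<alpha> - linear_term (\<lambda>b. X b - Y b) \<alpha> = 0"
      by (simp add: monomial_unit_index linear_term_unit_index)
    with nn show ?thesis by (simp add: d_def m_def \<delta>_def)
  next
    case 3
    then have l: "linear_term (\<lambda>b. X b - Y b) \<alpha> = 0" by (simp add: d_def linear_term_eq_0)
    show ?thesis
    proof (cases "m = 0")
      case True
      then have "cnorm X = 0" "cnorm Y = 0" using cnorm_nonneg[of X] cnorm_nonneg[of Y]
        unfolding m_def by linarith+
      then have "\<forall>b\<in>Basis. X b = Y b" by (simp add: cnorm_def sum_nonneg_eq_0_iff)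
      then have "monomial X \<alpha> = monomial Y \<alpha>" by (simp add: monomial_def)
      with l nn show ?thesis by (simp add: d_def m_def \<delta>_def)
    next
      case False
      then have m: "m > 0" "m \<le> R/2"
        using X Y cnorm_nonneg[of X] cnorm_nonneg[of Y] unfolding m_def by linarith+
      have "m * cmod (monomial X \<alpha> - monomial Y \<alpha>) \<le> d * m ^ d * \<delta>"
        unfolding d_def \<delta>_def
        by (rule monomial_diff_le[OF m(1)])
          (auto simp: m_def le_max_iff_disj intro: cnorm_component_le)
      also have "\<dots> = m\<^sup>2 * (d * m ^ (d - 2)) * \<delta>"
        using 3 by (metis (no_types) le_add_diff_inverse mult.assoc mult.commute power_add)
      also have "\<dots> \<le> m\<^sup>2 * (4 / R\<^sup>2 * R ^ d) * \<delta>"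
      proof -
        have "real d * m ^ (d - 2) \<le> 2 ^ d * (R/2) ^ (d - 2)"
          using m by (intro mult_mono power_mono) (auto simp: of_nat_less_two_power less_imp_le)
        also have "\<dots> = 4 / R\<^sup>2 * R ^ d"
        proof -
          have "2 + (d - 2) = d" using 3 by simp
          then have "2 ^ d = (2::real)\<^sup>2 * 2 ^ (d - 2)" "R ^ d = R\<^sup>2 * R ^ (d - 2)"
            by (metis power_add)+
          then show ?thesis using R by (simp only:) (simp add: power_divide)
        qed
        finally show ?thesis by (intro mult_right_mono mult_left_mono) (auto simp: \<delta>_def)
      qed
      also have "\<dots> = m * (4 / R\<^sup>2 * R ^ d * m * \<delta>)" by (simp add: power2_eq_square)
      finally have "cmod (monomial X \<alpha> - monomial Y \<alpha>) \<le> 4 / R\<^sup>2 * R ^ d * m * \<delta>"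
        using m(1) by (simp only: mult_le_cancel_left_pos)
      then show ?thesis using l by (simp add: d_def m_def \<delta>_def)
    qed
  qed
qed

lemma has_sum_minus:
  fixes f g :: "_ \<Rightarrow> 'b::real_normed_vector"
  assumes "(f has_sum a) A" "(g has_sum b) A"
  shows "((\<lambda>x. f x - g x) has_sum (a - b)) A"
  using has_sum_add[OF assms(1), of "\<lambda>x. - g x" "- b"] assms(2) by (simp add: has_sum_uminus)

text \<open>A complex map \<open>F\<close> extending \<open>f\<close> around \<open>a\<close>, with arguments centred at \<open>a\<close>. Holomorphy is required
  only along holomorphic curves, so that one complex variable suffices throughout. The remainder
  estimate says that \<open>F\<close> differs from its linear part by a map with Lipschitz constant
  \<open>C \<rho>\<close> on the ball of radius \<open>\<rho>\<close>.\<close>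

locale complex_extension =
  fixes f :: "'a::euclidean_space \<Rightarrow> 'b::euclidean_space" and a :: 'a and r C :: real
    and F :: "('a \<Rightarrow> complex) \<Rightarrow> 'b \<Rightarrow> complex" and D :: "'a \<Rightarrow> 'b"
  assumes radius: "r > 0" and const: "C \<ge> 0"
    and extends: "\<And>x. cnorm (cvec (x - a)) \<le> r \<Longrightarrow> F (cvec (x - a)) = cvec (f x)"
    and holomorphic: "\<And>X U i. open U \<Longrightarrow> (\<And>b. b \<in> Basis \<Longrightarrow> (\<lambda>z. X z b) holomorphic_on U) \<Longrightarrow>
           (\<And>z. z \<in> U \<Longrightarrow> cnorm (X z) \<le> r) \<Longrightarrow> (\<lambda>z. F (X z) i) holomorphic_on U"
    and derivative: "(f has_derivative D) (at a)"
    and remainder: "\<And>X Y. cnorm X \<le> r \<Longrightarrow> cnorm Y \<le> r \<Longrightarrow>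
           cnorm (\<lambda>i. F X i - F Y i - (\<Sum>b\<in>Basis. (X b - Y b) * of_real (D b \<bullet> i)))
             \<le> C * max (cnorm X) (cnorm Y) * cnorm (\<lambda>b. X b - Y b)"

text \<open>Evaluating the real series at a point all of whose coordinates relative to \<open>a\<close> equal
  some \<open>R > 0\<close> shows that the
  coefficients are absolutely summable against \<open>R ^ degree\<close>. Hence the complex series converges
  uniformly, and it inherits the remainder estimate term by term.\<close>

theorem real_analytic_complex_extension:
  fixes f :: "'a::euclidean_space \<Rightarrow> 'b::euclidean_space"
  assumes "real_analytic_at f a"
  shows "\<exists>r C F D. complex_extension f a r C F D"
proof -
  let ?I = "(Basis::'a set) \<rightarrow>\<^sub>E (UNIV::nat set)"
  obtain r0 and coef :: "('a \<Rightarrow> nat) \<Rightarrow> 'b" where r0: "r0 > 0"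
    and sum: "\<And>x. x \<in> ball a r0 \<Longrightarrow>
      ((\<lambda>\<alpha>. (\<Prod>b\<in>Basis. ((x - a) \<bullet> b) ^ \<alpha> b) *\<^sub>R coef \<alpha>) has_sum f x) ?I"
    using assms unfolding real_analytic_at_def by blast
  define R where "R = r0 / (2 * DIM('a))"
  have R: "R > 0" using r0 by (simp add: R_def)
  \<comment> \<open>The point of the ball at which every monomial takes the value \<open>R ^ degree_of \<alpha>\<close>.\<close>
  define x1 where "x1 = a + (\<Sum>b\<in>Basis. R *\<^sub>R b)"
  have "norm (x1 - a) \<le> (\<Sum>b\<in>(Basis::'a set). R)"
    unfolding x1_def add_diff_cancel_left' by (rule sum_norm_le) (use R in auto)
  also have "\<dots> = r0 / 2" by (simp add: R_def)
  finally have "x1 \<in> ball a r0" using r0 by (simp add: dist_norm norm_minus_commute)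
  have x1b: "(x1 - a) \<bullet> b = R" if "b \<in> Basis" for b
  proof -
    have "(x1 - a) \<bullet> b = (\<Sum>c\<in>Basis. if c = b then R else 0)"
      unfolding x1_def by (simp add: inner_sum_left inner_Basis that if_distrib cong: if_cong)
    then show ?thesis using that by simp
  qed
  have summ: "(\<lambda>\<alpha>. \<bar>coef \<alpha> \<bullet> i\<bar> * R ^ degree_of \<alpha>) summable_on ?I" for i
  proof -
    have "((\<lambda>\<alpha>. ((\<Prod>b\<in>Basis. ((x1 - a) \<bullet> b) ^ \<alpha> b) *\<^sub>R coef \<alpha>) \<bullet> i) has_sum f x1 \<bullet> i) ?I"
      by (rule has_sum_bounded_linear[OF bounded_linear_inner_left sum[OF \<open>x1 \<in> ball a r0\<close>]])
    from iffD1[OF summable_on_iff_abs_summable_on_real has_sum_imp_summable[OF this]]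
    have "(\<lambda>\<alpha>. norm (((\<Prod>b\<in>Basis. ((x1 - a) \<bullet> b) ^ \<alpha> b) *\<^sub>R coef \<alpha>) \<bullet> i)) summable_on ?I" .
    then show ?thesis
      using R by (simp add: x1b degree_of_def power_sum abs_mult mult.commute abs_of_pos prod_pos)
  qed
  define B where "B i = (\<Sum>\<^sub>\<infinity>\<alpha>\<in>?I. \<bar>coef \<alpha> \<bullet> i\<bar> * R ^ degree_of \<alpha>)" for i
  have hsB: "((\<lambda>\<alpha>. \<bar>coef \<alpha> \<bullet> i\<bar> * R ^ degree_of \<alpha>) has_sum B i) ?I" for i
    unfolding B_def using summ by simp
  have B0: "B i \<ge> 0" for i
    unfolding B_def by (intro infsum_nonneg) (use R in auto)
  define r where "r = R / 2"
  have r: "r > 0" using R by (simp add: r_def)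
  define F where "F X i = (if i \<in> Basis then \<Sum>\<^sub>\<infinity>\<alpha>\<in>?I. of_real (coef \<alpha> \<bullet> i) * monomial X \<alpha> else 0)" for X and i :: 'b
  have termb: "cmod (of_real (coef \<alpha> \<bullet> i) * monomial X \<alpha>) \<le> \<bar>coef \<alpha> \<bullet> i\<bar> * R ^ degree_of \<alpha>"
    if "cnorm X \<le> r" for X \<alpha> i
  proof -
    have "cmod (monomial X \<alpha>) \<le> R ^ degree_of \<alpha>"
      using that R by (intro monomial_bound) (auto simp: r_def intro: order.trans[OF cnorm_component_le])
    then show ?thesis by (simp add: norm_mult mult_left_mono)
  qed
  have hsF: "((\<lambda>\<alpha>. of_real (coef \<alpha> \<bullet> i) * monomial X \<alpha>) has_sum F X i) ?I"
    if "cnorm X \<le> r" "i \<in> Basis" for X i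
  proof -
    have "(\<lambda>\<alpha>. norm (of_real (coef \<alpha> \<bullet> i) * monomial X \<alpha>)) summable_on ?I"
      by (rule Infinite_Sum.abs_summable_on_comparison_test'[OF summ[of i]]) (rule termb[OF that(1)])
    then show ?thesis using that(2) by (simp add: F_def abs_summable_summable)
  qed
  have ext: "F (cvec (x - a)) = cvec (f x)" if "cnorm (cvec (x - a)) \<le> r" for x
  proof
    fix i
    show "F (cvec (x - a)) i = cvec (f x) i"
    proof (cases "i \<in> Basis")
      case True
      have "R \<le> r0 / 2" using r0 DIM_positive[where 'a='a] by (simp add: R_def field_simps)
      with that r0 have "x \<in> ball a r0" using norm_le_cnorm_cvec[of "x - a"]
        by (simp add: r_def dist_norm norm_minus_commute)
      have "((\<lambda>\<alpha>. ((\<Prod>b\<in>Basis. ((x - a) \<bullet> b) ^ \<alpha> b) *\<^sub>R coef \<alpha>) \<bullet> i) has_sum f x \<bullet> i) ?I"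
        by (rule has_sum_bounded_linear[OF bounded_linear_inner_left sum[OF \<open>x \<in> ball a r0\<close>]])
      from has_sum_bounded_linear[OF bounded_linear_of_real[where 'a = complex] this]
      have "((\<lambda>\<alpha>. of_real (coef \<alpha> \<bullet> i) * monomial (cvec (x - a)) \<alpha>) has_sum of_real (f x \<bullet> i)) ?I"
        by (simp add: monomial_def cvec_def mult.commute)
      with hsF[OF that True] have "F (cvec (x - a)) i = of_real (f x \<bullet> i)"
        using has_sum_unique by blast
      with True show ?thesis by (simp add: cvec_def)
    qed (simp add: F_def cvec_def)
  qed
  have hol: "(\<lambda>z. F (X z) i) holomorphic_on U" if "open U"
    "\<And>b. b \<in> Basis \<Longrightarrow> (\<lambda>z. X z b) holomorphic_on U" "\<And>z. z \<in> U \<Longrightarrow> cnorm (X z) \<le> r" for X U i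
  proof (cases "i \<in> Basis")
    case True
    have ul: "uniform_limit U (\<lambda>S z. \<Sum>\<alpha>\<in>S. of_real (coef \<alpha> \<bullet> i) * monomial (X z) \<alpha>)
        (\<lambda>z. F (X z) i) (finite_subsets_at_top ?I)"
      by (rule Weierstrass_m_test_general'[where M = "\<lambda>\<alpha>. \<bar>coef \<alpha> \<bullet> i\<bar> * R ^ degree_of \<alpha>"])
        (use termb hsF that True summ in auto)
    have hs: "(\<lambda>z. \<Sum>\<alpha>\<in>S. of_real (coef \<alpha> \<bullet> i) * monomial (X z) \<alpha>) holomorphic_on U" for S
      unfolding monomial_def by (intro holomorphic_intros that(2))
    have "(\<lambda>z. F (X z) i) holomorphic_on ball z e" if "cball z e \<subseteq> U" for z e
    proof -
      have "(\<lambda>z. F (X z) i) holomorphic_on ball z e"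
      proof (rule holomorphic_uniform_limit[THEN conjunct2])
        show "\<forall>\<^sub>F S in finite_subsets_at_top ?I.
          continuous_on (cball z e) (\<lambda>z. \<Sum>\<alpha>\<in>S. of_real (coef \<alpha> \<bullet> i) * monomial (X z) \<alpha>) \<and>
          (\<lambda>z. \<Sum>\<alpha>\<in>S. of_real (coef \<alpha> \<bullet> i) * monomial (X z) \<alpha>) holomorphic_on ball z e"
          using that ball_subset_cball[of z e]
          by (intro always_eventually allI conjI holomorphic_on_imp_continuous_on
              holomorphic_on_subset[OF hs]) auto
      qed (use uniform_limit_on_subset[OF ul that] in auto)
      then show ?thesis .
    qed
    note balls = this
    show ?thesis
    proof (rule holomorphic_onI)
      fix z assume "z \<in> U"
      then obtain e where e: "e > 0" "cball z e \<subseteq> U" using \<open>open U\<close> open_contains_cball by blast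
      have "(\<lambda>z. F (X z) i) field_differentiable at z"
        by (rule holomorphic_on_imp_differentiable_at[OF balls[OF e(2)] open_ball]) (use e(1) in simp)
      then show "(\<lambda>z. F (X z) i) field_differentiable at z within U"
        by (rule field_differentiable_at_within)
    qed
  qed (simp add: F_def)
  define L where "L Z i = (\<Sum>b\<in>Basis. Z b * of_real (coef (unit_index b) \<bullet> i))" for Z :: "'a \<Rightarrow> complex" and i :: 'b
  have hsL: "((\<lambda>\<alpha>. of_real (coef \<alpha> \<bullet> i) * linear_term Z \<alpha>) has_sum L Z i) ?I" for Z i
  proof (rule has_sum_finite_neutralI[where B = "unit_index ` Basis"])
    have "(\<Sum>\<alpha>\<in>unit_index ` Basis. of_real (coef \<alpha> \<bullet> i) * linear_term Z \<alpha>)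
        = (\<Sum>b\<in>Basis. of_real (coef (unit_index b) \<bullet> i) * linear_term Z (unit_index b))"
      by (subst sum.reindex) (auto simp: inj_on_def unit_index_eq_iff)
    then show "L Z i = (\<Sum>\<alpha>\<in>unit_index ` Basis. of_real (coef \<alpha> \<bullet> i) * linear_term Z \<alpha>)"
      by (simp add: L_def linear_term_unit_index mult.commute)
  next
    fix \<alpha> assume \<alpha>: "\<alpha> \<in> ?I - unit_index ` Basis"
    then have "degree_of \<alpha> \<noteq> 1" using degree_of_eq_1[of \<alpha>] by auto
    then show "of_real (coef \<alpha> \<bullet> i) * linear_term Z \<alpha> = 0" by (simp add: linear_term_eq_0)
  qed (simp, use unit_index_in in blast)
  define C where "C = 4 / R\<^sup>2 * (\<Sum>i\<in>Basis. B i)"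
  have C: "C \<ge> 0" unfolding C_def by (intro mult_nonneg_nonneg sum_nonneg B0) auto
  have lip: "cnorm (\<lambda>i. F X i - F Y i - L (\<lambda>b. X b - Y b) i)
      \<le> C * max (cnorm X) (cnorm Y) * cnorm (\<lambda>b. X b - Y b)"
    if X: "cnorm X \<le> r" and Y: "cnorm Y \<le> r" for X Y
  proof -
    let ?t = "\<lambda>i \<alpha>. of_real (coef \<alpha> \<bullet> i) * monomial X \<alpha> - of_real (coef \<alpha> \<bullet> i) * monomial Y \<alpha>
      - of_real (coef \<alpha> \<bullet> i) * linear_term (\<lambda>b. X b - Y b) \<alpha>"
    let ?m = "max (cnorm X) (cnorm Y)" and ?d = "cnorm (\<lambda>b. X b - Y b)"
    have "cmod (F X i - F Y i - L (\<lambda>b. X b - Y b) i) \<le> 4 / R\<^sup>2 * ?m * ?d * B i" if i: "i \<in> Basis" for i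
    proof (rule norm_infsum_le)
      show "((\<lambda>\<alpha>. ?t i \<alpha>) has_sum
          (F X i - F Y i - L (\<lambda>b. X b - Y b) i)) ?I"
        by (intro has_sum_minus hsF X Y hsL i)
      show "((\<lambda>\<alpha>. 4 / R\<^sup>2 * ?m * ?d * (\<bar>coef \<alpha> \<bullet> i\<bar> * R ^ degree_of \<alpha>)) has_sum 4 / R\<^sup>2 * ?m * ?d * B i) ?I"
        by (intro has_sum_cmult_right hsB)
      fix \<alpha> assume \<alpha>: "\<alpha> \<in> ?I"
      have "cmod (?t i \<alpha>)
          = \<bar>coef \<alpha> \<bullet> i\<bar> * cmod (monomial X \<alpha> - monomial Y \<alpha> - linear_term (\<lambda>b. X b - Y b) \<alpha>)"
        by (simp add: right_diff_distrib[symmetric] norm_mult)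
      also have "\<dots> \<le> \<bar>coef \<alpha> \<bullet> i\<bar> * (4 / R\<^sup>2 * R ^ degree_of \<alpha> * ?m * ?d)"
        using X Y by (intro mult_left_mono monomial_remainder[OF \<alpha> R]) (auto simp: r_def)
      finally show "cmod (?t i \<alpha>)
          \<le> 4 / R\<^sup>2 * ?m * ?d * (\<bar>coef \<alpha> \<bullet> i\<bar> * R ^ degree_of \<alpha>)"
        by (simp add: ac_simps)
    qed
    then have "cnorm (\<lambda>i. F X i - F Y i - L (\<lambda>b. X b - Y b) i) \<le> (\<Sum>i\<in>Basis. 4 / R\<^sup>2 * ?m * ?d * B i)"
      unfolding cnorm_def by (rule sum_mono)
    then show ?thesis by (simp add: C_def sum_distrib_left sum_distrib_right sum_divide_distrib ac_simps)
  qed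
  define D where "D x = (\<Sum>b\<in>Basis. (x \<bullet> b) *\<^sub>R coef (unit_index b))" for x
  have DL: "cvec (D x) i = L (cvec x) i" if "i \<in> Basis" for x i
    using that by (simp add: cvec_def D_def L_def inner_sum_left)
  have Db: "D b = coef (unit_index b)" if "b \<in> Basis" for b
    using that by (simp add: D_def inner_Basis if_distrib[of "\<lambda>c. c *\<^sub>R _"] cong: if_cong)
  have der: "(f has_derivative D) (at a)"
  proof -
    define K where "K = C * DIM('a)\<^sup>2"
    have K: "K \<ge> 0" using C by (simp add: K_def)
    have est: "norm (f x - f a - D (x - a)) \<le> K * (norm (x - a))\<^sup>2" if "norm (x - a) \<le> r / DIM('a)" for x
    proof -
      have c: "cnorm (cvec (x - a)) \<le> DIM('a) * norm (x - a)" by (rule cnorm_cvec_le)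
      also have "\<dots> \<le> r" using that by (simp add: field_simps)
      finally have cr: "cnorm (cvec (x - a)) \<le> r" .
      have z: "cnorm (\<lambda>b::'a. 0) = 0" by (simp add: cnorm_def)
      have e0: "F (\<lambda>b. 0) = cvec (f a)" using ext[of a] r z by simp
      have "norm (f x - f a - D (x - a)) \<le> cnorm (cvec (f x - f a - D (x - a)))"
        by (rule norm_le_cnorm_cvec)
      also have "\<dots> = cnorm (\<lambda>i. F (cvec (x - a)) i - F (\<lambda>b. 0) i - L (\<lambda>b. cvec (x - a) b - 0) i)"
        unfolding cnorm_def by (intro sum.cong) (auto simp: cvec_diff[of "f x - f a"] cvec_diff[of "f x"]
              DL[symmetric] ext[OF cr] e0)
      also have "\<dots> \<le> C * max (cnorm (cvec (x - a))) (cnorm (\<lambda>b::'a. 0)) * cnorm (\<lambda>b. cvec (x - a) b - 0)"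
        by (rule lip) (use cr r z in auto)
      also have "\<dots> = C * (cnorm (cvec (x - a)))\<^sup>2" by (simp add: z power2_eq_square)
      also have "\<dots> \<le> C * (DIM('a) * norm (x - a))\<^sup>2"
        by (intro mult_left_mono power_mono c C) auto
      finally show ?thesis by (simp add: K_def power_mult_distrib)
    qed
    have bl: "bounded_linear D"
      unfolding D_def by (intro bounded_linear_sum bounded_linear_scaleR_const bounded_linear_inner_left_comp bounded_linear_ident) 
    show ?thesis
      unfolding has_derivative_at_alt
    proof (intro conjI allI impI bl)
      fix \<epsilon> :: real assume \<epsilon>: "\<epsilon> > 0"
      define d where "d = min (r / DIM('a)) (\<epsilon> / (K + 1))"
      have "d > 0" using r \<epsilon> K by (simp add: d_def)
      moreover have "norm (f y - f a - D (y - a)) \<le> \<epsilon> * norm (y - a)" if "norm (y - a) < d" for y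
      proof -
        have "norm (f y - f a - D (y - a)) \<le> K * (norm (y - a))\<^sup>2"
          using that by (intro est) (simp add: d_def)
        also have "\<dots> = (K * norm (y - a)) * norm (y - a)" by (simp add: power2_eq_square)
        also have "\<dots> \<le> \<epsilon> * norm (y - a)"
        proof (rule mult_right_mono)
          have "K * norm (y - a) \<le> (K + 1) * (\<epsilon> / (K + 1))"
            using that K by (intro mult_mono) (auto simp: d_def)
          then show "K * norm (y - a) \<le> \<epsilon>" using K by simp
        qed simp
        finally show ?thesis .
      qed
      ultimately show "\<exists>d>0. \<forall>y. norm (y - a) < d \<longrightarrow> norm (f y - f a - D (y - a)) \<le> \<epsilon> * norm (y - a)"
        by blast
    qed
  qed
  have "complex_extension f a r C F D"
  proof (rule complex_extension.intro[OF r C ext hol der])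
    fix X Y :: "'a \<Rightarrow> complex" assume "cnorm X \<le> r" "cnorm Y \<le> r"
    then show "cnorm (\<lambda>i. F X i - F Y i - (\<Sum>b\<in>Basis. (X b - Y b) * of_real (D b \<bullet> i)))
        \<le> C * max (cnorm X) (cnorm Y) * cnorm (\<lambda>b. X b - Y b)"
      using lip[of X Y] by (simp add: L_def Db)
  qed
  then show ?thesis by blast
qed

section \<open>Real-analytic curves in Euclidean spaces\<close>

lemma real_analytic_at_cong:
  assumes "real_analytic_at f a" and "\<forall>\<^sub>F x in nhds a. f x = g x"
  shows "real_analytic_at g a"
proof -
  let ?series = "\<lambda>coef x y.
    ((\<lambda>\<alpha>. (\<Prod>b\<in>Basis. ((x - a) \<bullet> b) ^ \<alpha> b) *\<^sub>R coef \<alpha>) has_sum y) (Basis \<rightarrow>\<^sub>E UNIV)"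
  obtain r1 coef where 1: "r1 > 0" "\<forall>x\<in>ball a r1. ?series coef x (f x)"
    using assms(1) unfolding real_analytic_at_def by blast
  obtain r2 where 2: "r2 > 0" "\<forall>x\<in>ball a r2. f x = g x"
    using assms(2) unfolding eventually_nhds_metric by (metis dist_commute mem_ball)
  have "?series coef x (g x)" if "x \<in> ball a (min r1 r2)" for x
  proof -
    have "x \<in> ball a r1" "x \<in> ball a r2" using that by simp_all
    then show ?thesis
      using 1(2)[rule_format, of x] 2(2)[rule_format, of x] by simp
  qed
  then show ?thesis unfolding real_analytic_at_def using 1(1) 2(1)
    by (intro exI[of _ "min r1 r2"] conjI exI[of _ coef]) auto
qed

lemma real_analytic_at_imp_differentiable:
  fixes f :: "'a::euclidean_space \<Rightarrow> 'b::euclidean_space"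
  assumes "real_analytic_at f a" shows "f differentiable (at a)"
  using real_analytic_complex_extension[OF assms] complex_extension.derivative differentiable_def by blast

text \<open>The domain is fixed to a ball around \<open>t\<close> so that extensions of several curves can be restricted to
  a common one.\<close>

definition holomorphic_extension ::
  "(real \<Rightarrow> 'b::euclidean_space) \<Rightarrow> real \<Rightarrow> real \<Rightarrow> ('b \<Rightarrow> complex \<Rightarrow> complex) \<Rightarrow> bool" where
  "holomorphic_extension u t r H \<longleftrightarrow>
     (\<forall>i\<in>Basis. H i holomorphic_on ball (of_real t) r) \<and>
     (\<forall>s\<in>ball t r. \<forall>i\<in>Basis. H i (of_real s) = of_real (u s \<bullet> i))"

lemma holomorphic_extension_subset:
  assumes "holomorphic_extension u t r H" "ball t' r' \<subseteq> ball t r"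
  shows "holomorphic_extension u t' r' H"
proof (cases "r' > 0")
  case True
  have "dist t' t + r' \<le> r"
    using assms(2) True by (subst (asm) ball_subset_ball_iff) (auto simp: dist_commute)
  then have "ball (complex_of_real t') r' \<subseteq> ball (of_real t) r"
    by (subst ball_subset_ball_iff) (simp add: dist_of_real)
  with assms show ?thesis
    unfolding holomorphic_extension_def by (blast intro: holomorphic_on_subset)
next
  case False
  then have e: "ball (complex_of_real t') r' = {}" "ball t' r' = {}" by simp_all
  show ?thesis unfolding holomorphic_extension_def e using holomorphic_on_empty by blast
qed

text \<open>The real parts of the Taylor coefficients of the extension are the coefficients of the curve.\<close>

lemma holomorphic_extension_imp_real_analytic:
  fixes u :: "real \<Rightarrow> 'b::euclidean_space"
  assumes H: "holomorphic_extension u t r H" and r: "r > 0"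
  shows "real_analytic_at u t"
proof -
  define a where "a i n = (deriv ^^ n) (H i) (of_real t) / fact n" for i and n
  define c where "c n = (\<Sum>i\<in>Basis. Re (a i n) *\<^sub>R i)" for n
  have 1: "((\<lambda>n. Re (a i n) * (s - t) ^ n) has_sum (u s \<bullet> i)) UNIV"
    if s: "s \<in> ball t r" and i: "i \<in> Basis" for s i
  proof -
    have hol: "H i holomorphic_on ball (of_real t) r" using H i by (simp add: holomorphic_extension_def)
    define q where "q = (\<bar>s - t\<bar> + r) / 2"
    have q: "\<bar>s - t\<bar> < q" "q < r" "q > 0" using s by (auto simp: q_def dist_real_def)
    have "(\<lambda>n. a i n * (of_real (t + q) - of_real t) ^ n) sums H i (of_real (t + q))"
      unfolding a_def by (rule holomorphic_power_series[OF hol]) (use q in \<open>simp add: dist_norm\<close>)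
    then have "summable (\<lambda>n. a i n * of_real q ^ n)" by (simp add: sums_iff)
    then have "summable (\<lambda>n. norm (a i n * of_real (s - t) ^ n))"
      by (rule powser_insidea) (use q in \<open>simp del: of_real_diff\<close>)
    moreover have "(\<lambda>n. a i n * of_real (s - t) ^ n) sums H i (of_real s)"
      using holomorphic_power_series[OF hol, of "of_real s"] s by (simp add: a_def dist_of_real)
    ultimately have "((\<lambda>n. a i n * of_real (s - t) ^ n) has_sum H i (of_real s)) UNIV"
      by (rule norm_summable_imp_has_sum)
    then have "((\<lambda>n. Re (a i n * of_real (s - t) ^ n)) has_sum Re (H i (of_real s))) UNIV"
      by (rule has_sum_Re)
    moreover have "H i (of_real s) = of_real (u s \<bullet> i)"
      using H s i by (simp add: holomorphic_extension_def)
    ultimately show ?thesis by (simp flip: of_real_power of_real_diff)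
  qed
  have 2: "((\<lambda>n. (s - t) ^ n *\<^sub>R c n) has_sum u s) UNIV" if s: "s \<in> ball t r" for s
  proof -
    have *: "((\<lambda>n. \<Sum>i\<in>B. (Re (a i n) * (s - t) ^ n) *\<^sub>R i) has_sum (\<Sum>i\<in>B. (u s \<bullet> i) *\<^sub>R i)) UNIV"
      if "finite B" "B \<subseteq> Basis" for B
      using that
    proof (induction B rule: finite_induct)
      case (insert i B)
      then have "((\<lambda>n. (Re (a i n) * (s - t) ^ n) *\<^sub>R i) has_sum (u s \<bullet> i) *\<^sub>R i) UNIV"
        by (intro has_sum_bounded_linear[OF bounded_linear_scaleR_left] 1[OF s]) auto
      with insert show ?case by (auto intro: has_sum_add)
    qed simp
    show ?thesis
      using *[OF finite_Basis] by (simp add: euclidean_representation c_def scaleR_sum_right mult.commute)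
  qed
  have bij: "bij_betw (\<lambda>n. restrict (\<lambda>_. n) {1::real}) (UNIV::nat set) ({1} \<rightarrow>\<^sub>E UNIV)"
  proof (rule bij_betwI[where g = "\<lambda>\<alpha>. \<alpha> 1"])
    show "restrict (\<lambda>_. \<alpha> 1) {1::real} = \<alpha>" if "\<alpha> \<in> {1} \<rightarrow>\<^sub>E UNIV" for \<alpha> :: "real \<Rightarrow> nat"
      using that by (auto simp: fun_eq_iff PiE_def extensional_def)
  qed auto
  have 3: "((\<lambda>\<alpha>. (\<Prod>b\<in>Basis. ((s - t) \<bullet> b) ^ \<alpha> b) *\<^sub>R c (\<alpha> 1)) has_sum u s) (Basis \<rightarrow>\<^sub>E UNIV)"
    if s: "s \<in> ball t r" for s
  proof -
    have "((\<lambda>n. (\<lambda>\<alpha>. (s - t) ^ \<alpha> (1::real) *\<^sub>R c (\<alpha> 1)) (restrict (\<lambda>_. n) {1::real})) has_sum u s) UNIV"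
      using 2[OF s] by simp
    then have "((\<lambda>\<alpha>. (s - t) ^ \<alpha> 1 *\<^sub>R c (\<alpha> 1)) has_sum u s) ({1::real} \<rightarrow>\<^sub>E UNIV)"
      by (subst (asm) has_sum_reindex_bij_betw[OF bij])
    then show ?thesis by (simp add: Basis_real_def)
  qed
  then show ?thesis
    unfolding real_analytic_at_def using r
    by (intro exI[of _ r] conjI exI[of _ "\<lambda>\<alpha>. c (\<alpha> 1)"] ballI) auto
qed

text \<open>Insert the extension of \<open>g\<close> into the complex extension of \<open>f\<close>; near \<open>t\<close> its values stay inside the
  region where the latter is holomorphic along curves.\<close>

theorem real_analytic_compose_curve:
  fixes g :: "real \<Rightarrow> 'a::euclidean_space" and f :: "'a \<Rightarrow> 'b::euclidean_space"
  assumes H: "holomorphic_extension g t r H" and r: "r > 0" and f: "real_analytic_at f (g t)"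
  shows "\<exists>r>0. \<exists>K. holomorphic_extension (\<lambda>s. f (g s)) t r K"
proof -
  obtain e C F D where "complex_extension f (g t) e C F D"
    using real_analytic_complex_extension[OF f] by blast
  then interpret E: complex_extension f "g t" e C F D .
  define X where "X z b = (if b \<in> Basis then H b z - of_real (g t \<bullet> b) else 0)" for z and b :: 'a
  have holX: "(\<lambda>z. X z b) holomorphic_on ball (of_real t) r" for b
    using H by (cases "b \<in> Basis") (auto simp: X_def holomorphic_extension_def intro!: holomorphic_intros)
  have Xt: "X (of_real s) = cvec (g s - g t)" if "s \<in> ball t r" for s
    using H that by (auto simp: X_def cvec_def fun_eq_iff holomorphic_extension_def inner_diff_left)
  have "continuous_on (ball (of_real t) r) (\<lambda>z. cnorm (X z))"
    unfolding cnorm_def by (intro continuous_intros holomorphic_on_imp_continuous_on holX)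
  then have "isCont (\<lambda>z. cnorm (X z)) (of_real t)"
    using r by (simp add: continuous_on_eq_continuous_at)
  moreover have "cnorm (X (of_real t)) < e"
    using Xt[of t] r E.radius by (simp add: cnorm_def)
  ultimately have "\<forall>\<^sub>F z in at (of_real t). cnorm (X z) < e"
    unfolding isCont_def by (rule order_tendstoD)
  then obtain d where d: "d > 0" "\<And>z. z \<noteq> of_real t \<Longrightarrow> dist z (of_real t) < d \<Longrightarrow> cnorm (X z) < e"
    by (auto simp: eventually_at)
  define q where "q = min r d"
  have q: "q > 0" using r d by (simp add: q_def)
  have small: "cnorm (X z) \<le> e" if "z \<in> ball (of_real t) q" for z
    using that d(2)[of z] \<open>cnorm (X (of_real t)) < e\<close>
    by (cases "z = of_real t") (auto simp: q_def dist_commute less_imp_le)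
  have "(\<lambda>z. F (X z) i) holomorphic_on ball (of_real t) q" for i
    by (rule E.holomorphic) (use small q_def in \<open>auto intro: holomorphic_on_subset[OF holX]\<close>)
  moreover have "F (X (of_real s)) i = of_real (f (g s) \<bullet> i)" if "s \<in> ball t q" "i \<in> Basis" for s i
  proof -
    have s: "s \<in> ball t r" "complex_of_real s \<in> ball (of_real t) q"
      using that by (auto simp: q_def dist_of_real)
    then show ?thesis using E.extends[of "g s"] small[OF s(2)] Xt[OF s(1)] that(2) by (simp add: cvec_def)
  qed
  ultimately have "holomorphic_extension (\<lambda>s. f (g s)) t q (\<lambda>i z. F (X z) i)"
    by (simp add: holomorphic_extension_def)
  with q show ?thesis by blast
qed

lemma real_analytic_curve_iff:
  fixes u :: "real \<Rightarrow> 'b::euclidean_space"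
  shows "real_analytic_at u t \<longleftrightarrow> (\<exists>r>0. \<exists>H. holomorphic_extension u t r H)"
proof
  have "holomorphic_extension (\<lambda>s::real. s) t 1 (\<lambda>i z. z)"
    by (simp add: holomorphic_extension_def Basis_real_def)
  then show "\<exists>r>0. \<exists>H. holomorphic_extension u t r H" if "real_analytic_at u t"
    using real_analytic_compose_curve[of "\<lambda>s. s" t 1 "\<lambda>i z. z" u] that by auto
qed (auto intro: holomorphic_extension_imp_real_analytic)

lemma real_analytic_curve_compose:
  fixes g :: "real \<Rightarrow> 'a::euclidean_space" and f :: "'a \<Rightarrow> 'b::euclidean_space"
  assumes "real_analytic_at g t" and "real_analytic_at f (g t)"
  shows "real_analytic_at (\<lambda>s. f (g s)) t"
proof -
  obtain r H where "r > 0" "holomorphic_extension g t r H"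
    using assms(1) unfolding real_analytic_curve_iff by blast
  from real_analytic_compose_curve[OF this(2,1) assms(2)] show ?thesis
    unfolding real_analytic_curve_iff .
qed

lemma real_analytic_curve_pair:
  fixes u :: "real \<Rightarrow> 'a::euclidean_space" and w :: "real \<Rightarrow> 'b::euclidean_space"
  assumes "real_analytic_at u t" and "real_analytic_at w t"
  shows "real_analytic_at (\<lambda>s. (u s, w s)) t"
proof -
  obtain r1 H1 r2 H2 where H: "r1 > 0" "holomorphic_extension u t r1 H1"
    "r2 > 0" "holomorphic_extension w t r2 H2"
    using assms unfolding real_analytic_curve_iff by metis
  define r where "r = min r1 r2"
  have r: "holomorphic_extension u t r H1" "holomorphic_extension w t r H2"
    using H by (auto intro!: holomorphic_extension_subset[OF H(2)] holomorphic_extension_subset[OF H(4)]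
        simp: r_def)
  have "holomorphic_extension (\<lambda>s. (u s, w s)) t r (\<lambda>i z. if snd i = 0 then H1 (fst i) z else H2 (snd i) z)"
    using r by (auto simp: holomorphic_extension_def Basis_prod_def nonzero_Basis)
  moreover have "r > 0" using H by (simp add: r_def)
  ultimately show ?thesis unfolding real_analytic_curve_iff by blast
qed

lemma real_analytic_at_affine: "real_analytic_at (\<lambda>s::real. a * s + b) t"
proof -
  have "holomorphic_extension (\<lambda>s. a * s + b) t 1 (\<lambda>i z. of_real a * z + of_real b)"
    by (auto simp: holomorphic_extension_def Basis_real_def intro!: holomorphic_intros)
  then show ?thesis unfolding real_analytic_curve_iff by (meson zero_less_one)
qed

lemma real_analytic_curve_const: "real_analytic_at (\<lambda>s::real. c :: 'b::euclidean_space) t"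
proof -
  have "holomorphic_extension (\<lambda>s. c) t 1 (\<lambda>i z. of_real (c \<bullet> i))"
    by (auto simp: holomorphic_extension_def)
  then show ?thesis unfolding real_analytic_curve_iff by (meson zero_less_one)
qed

text \<open>The holomorphic extensions agree on a set with a limit point, hence on a ball.\<close>

lemma real_analytic_curves_eventually_eq:
  fixes u w :: "real \<Rightarrow> 'b::euclidean_space"
  assumes "real_analytic_at u t" "real_analytic_at w t" and lim: "t islimpt {s. u s = w s}"
  shows "\<forall>\<^sub>F s in nhds t. u s = w s"
proof -
  obtain r1 H1 r2 H2 where H: "r1 > 0" "holomorphic_extension u t r1 H1"
    "r2 > 0" "holomorphic_extension w t r2 H2"
    using assms unfolding real_analytic_curve_iff by metis
  define r where "r = min r1 r2"
  have r: "holomorphic_extension u t r H1" "holomorphic_extension w t r H2" "r > 0"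
    using H by (auto intro!: holomorphic_extension_subset[OF H(2)] holomorphic_extension_subset[OF H(4)]
        simp: r_def)
  let ?B = "ball (complex_of_real t) r"
  have lim': "t islimpt ({s. u s = w s} \<inter> ball t r)"
    unfolding islimpt_def
  proof (intro allI impI)
    fix T assume "t \<in> T" "open T"
    then have "t \<in> T \<inter> ball t r" "open (T \<inter> ball t r)" using r(3) by auto
    then show "\<exists>y\<in>{s. u s = w s} \<inter> ball t r. y \<in> T \<and> y \<noteq> t"
      using lim unfolding islimpt_def by blast
  qed
  have limc: "complex_of_real t islimpt (of_real ` ({s. u s = w s} \<inter> ball t r))"
    using lim' unfolding islimpt_approachable by (auto simp: dist_of_real)
  have "u s = w s" if s: "s \<in> ball t r" for s
  proof (rule euclidean_eqI)
    fix i :: 'b assume i: "i \<in> Basis"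
    have "H1 i (of_real s) - H2 i (of_real s) = 0"
    proof (rule analytic_continuation[where S = ?B and f = "\<lambda>z. H1 i z - H2 i z"])
      show "(\<lambda>z. H1 i z - H2 i z) holomorphic_on ?B"
        using r i by (auto simp: holomorphic_extension_def intro!: holomorphic_intros)
      show "of_real ` ({s. u s = w s} \<inter> ball t r) \<subseteq> ?B" by (auto simp: dist_of_real)
      show "H1 i z - H2 i z = 0" if "z \<in> of_real ` ({s. u s = w s} \<inter> ball t r)" for z
        using that r i by (auto simp: holomorphic_extension_def)
    qed (use limc r(3) s in \<open>auto simp: dist_of_real\<close>)
    with r i s show "u s \<bullet> i = w s \<bullet> i" by (auto simp: holomorphic_extension_def)
  qed
  with r(3) show ?thesis by (auto simp: eventually_nhds_metric dist_commute)
qed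

lemma real_analytic_has_continuous_derivative:
  fixes u :: "real \<Rightarrow> real"
  assumes "real_analytic_at u t"
  obtains r u' where "r > 0" "\<And>s. s \<in> ball t r \<Longrightarrow> (u has_field_derivative u' s) (at s)"
    "continuous_on (ball t r) u'"
proof -
  obtain r H where r: "r > 0" and H: "holomorphic_extension u t r H"
    using assms unfolding real_analytic_curve_iff by metis
  let ?h = "H 1"
  have hol: "?h holomorphic_on ball (of_real t) r" and eq: "\<And>s. s \<in> ball t r \<Longrightarrow> ?h (of_real s) = of_real (u s)"
    using H by (auto simp: holomorphic_extension_def)
  define u' where "u' s = Re (deriv ?h (of_real s))" for s
  have "(u has_field_derivative u' s) (at s)" if s: "s \<in> ball t r" for s
  proof -
    have "(?h has_field_derivative deriv ?h (of_real s)) (at (of_real s))"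
      by (rule holomorphic_derivI[OF hol]) (use s in \<open>auto simp: dist_of_real\<close>)
    then have "(?h has_derivative (\<lambda>z. deriv ?h (of_real s) * z)) (at (of_real s))"
      by (simp add: has_field_derivative_def)
    moreover have "((\<lambda>x. complex_of_real x) has_derivative of_real) (at s)"
      by (rule bounded_linear_imp_has_derivative[OF bounded_linear_of_real])
    ultimately have "((\<lambda>x. ?h (of_real x)) has_derivative (\<lambda>x. deriv ?h (of_real s) * of_real x)) (at s)"
      using has_derivative_compose by blast
    then have "((\<lambda>x. Re (?h (of_real x))) has_derivative (\<lambda>x. Re (deriv ?h (of_real s) * of_real x))) (at s)"
      by (rule has_derivative_Re)
    moreover have "(\<lambda>x. Re (deriv ?h (of_real s) * of_real x)) = (*) (u' s)"
      by (auto simp: u'_def)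
    ultimately have "((\<lambda>x. Re (?h (of_real x))) has_field_derivative u' s) (at s)"
      by (simp add: has_field_derivative_def)
    then show ?thesis
      by (rule DERIV_cong_ev[THEN iffD1, rotated 3])
        (use s in \<open>auto intro!: eventually_mono[OF eventually_nhds_in_open[of "ball t r"]] simp: eq\<close>)
  qed
  moreover have "continuous_on (ball t r) u'"
  proof -
    have "continuous_on (ball (of_real t) r) (deriv ?h)"
      by (intro holomorphic_on_imp_continuous_on holomorphic_deriv hol open_ball)
    then have "continuous_on (ball t r) (\<lambda>s. deriv ?h (of_real s))"
      by (rule continuous_on_compose2) (auto intro!: continuous_intros simp: dist_of_real)
    then show ?thesis unfolding u'_def by (intro continuous_intros)
  qed
  ultimately show ?thesis using r that by blast
qed

section \<open>Analytic curves in manifolds\<close>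

lemma analytic_map_on_curve_iff:
  "analytic_map_on std_atlas A I \<alpha> \<longleftrightarrow>
     continuous_on I \<alpha> \<and> (\<forall>d\<in>A. \<forall>t\<in>I. \<alpha> t \<in> fst d \<longrightarrow> real_analytic_at (snd d \<circ> \<alpha>) t)"
  by (auto simp: analytic_map_on_def std_atlas_def chart_rep_def)

lemma analytic_curveD_cont:
  assumes "analytic_map_on std_atlas A I \<alpha>" "open I" "t \<in> I"
  shows "isCont \<alpha> t"
  using assms by (simp add: analytic_map_on_def continuous_on_eq_continuous_at)

lemma isCont_eventually_in:
  fixes \<alpha> :: "real \<Rightarrow> 'm::topological_space"
  assumes "isCont \<alpha> t" "open U" "\<alpha> t \<in> U"
  shows "\<forall>\<^sub>F s in nhds t. \<alpha> s \<in> U"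
proof -
  have "(\<alpha> \<longlongrightarrow> \<alpha> t) (nhds t)"
    using assms(1) by (simp add: continuous_at tendsto_at_iff_tendsto_nhds)
  then show ?thesis using assms(2,3) by (rule topological_tendstoD)
qed

context analytic_manifold
begin

lemma chart_open: "c \<in> A \<Longrightarrow> open (fst c)"
  using open_domain[of "fst c" "snd c"] by simp

lemma chart_inverse: "c \<in> A \<Longrightarrow> p \<in> fst c \<Longrightarrow> inv_into (fst c) (snd c) (snd c p) = p"
  using chart_homeomorphism[of "fst c" "snd c"] by (simp add: homeomorphism_def)

lemma chart_inj: "c \<in> A \<Longrightarrow> p \<in> fst c \<Longrightarrow> q \<in> fst c \<Longrightarrow> snd c p = snd c q \<Longrightarrow> p = q"
  by (metis chart_inverse)

lemma chart_at: "\<exists>c\<in>A. p \<in> fst c"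
  using covering by blast

lemma chart_rep_curve:
  fixes d :: "('n, 'f::euclidean_space) chart" and \<alpha> :: "real \<Rightarrow> 'm"
  assumes c: "c \<in> A" and \<alpha>: "isCont \<alpha> t" "\<alpha> t \<in> fst c" "real_analytic_at (snd c \<circ> \<alpha>) t"
    and f: "real_analytic_at (chart_rep c d f) (snd c (\<alpha> t))"
  shows "real_analytic_at (snd d \<circ> (\<lambda>s. f (\<alpha> s))) t"
proof -
  have "real_analytic_at (\<lambda>s. chart_rep c d f ((snd c \<circ> \<alpha>) s)) t"
    by (rule real_analytic_curve_compose[OF \<alpha>(3)]) (use f in simp)
  moreover have "\<forall>\<^sub>F s in nhds t. chart_rep c d f ((snd c \<circ> \<alpha>) s) = (snd d \<circ> (\<lambda>s. f (\<alpha> s))) s"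
    using isCont_eventually_in[OF \<alpha>(1) chart_open[OF c] \<alpha>(2)]
    by eventually_elim (simp add: chart_rep_def chart_inverse[OF c])
  ultimately show ?thesis by (rule real_analytic_at_cong)
qed

text \<open>One chart at each point is enough: any other one differs by an analytic transition map.\<close>

lemma analytic_curveI:
  fixes \<alpha> :: "real \<Rightarrow> 'm"
  assumes "\<And>t. t \<in> I \<Longrightarrow> isCont \<alpha> t"
    and "\<And>t. t \<in> I \<Longrightarrow> \<exists>c\<in>A. \<alpha> t \<in> fst c \<and> real_analytic_at (snd c \<circ> \<alpha>) t"
  shows "analytic_map_on std_atlas A I \<alpha>"
  unfolding analytic_map_on_curve_iff
proof (intro conjI ballI impI)
  show "continuous_on I \<alpha>" using assms(1) by (simp add: continuous_at_imp_continuous_on)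
  fix d t assume d: "d \<in> A" "\<alpha> t \<in> fst d" and t: "t \<in> I"
  obtain c where c: "c \<in> A" "\<alpha> t \<in> fst c" "real_analytic_at (snd c \<circ> \<alpha>) t" using assms(2)[OF t] by blast
  have "real_analytic_at (chart_rep c d id) (snd c (\<alpha> t))"
    using transition_analytic[OF c(1) d(1)] c(2) d(2) by simp
  from chart_rep_curve[OF c(1) assms(1)[OF t] c(2,3) this]
  show "real_analytic_at (snd d \<circ> \<alpha>) t" by (simp add: comp_def)
qed

lemma analytic_curve_compose:
  fixes B :: "('n::t2_space, 'f::euclidean_space) atlas" and \<alpha> :: "real \<Rightarrow> 'm"
  assumes B: "analytic_manifold B" and I: "open I"
    and \<alpha>: "analytic_map_on std_atlas A I \<alpha>" and f: "analytic_map_on A B UNIV f"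
  shows "analytic_map_on std_atlas B I (\<lambda>s. f (\<alpha> s))"
proof (rule analytic_manifold.analytic_curveI[OF B])
  fix t assume t: "t \<in> I"
  have ct: "isCont \<alpha> t" by (rule analytic_curveD_cont[OF \<alpha> I t])
  have "isCont f (\<alpha> t)"
    using f by (simp add: analytic_map_on_def continuous_on_eq_continuous_at)
  with ct show "isCont (\<lambda>s. f (\<alpha> s)) t" by (rule isCont_o2)
  obtain c where c: "c \<in> A" "\<alpha> t \<in> fst c" using chart_at by blast
  obtain d where d: "d \<in> B" "f (\<alpha> t) \<in> fst d" using analytic_manifold.chart_at[OF B] by blast
  have fa: "real_analytic_at (chart_rep c d f) (snd c (\<alpha> t))"
    using f c d unfolding analytic_map_on_def by blast
  have "real_analytic_at (snd c \<circ> \<alpha>) t"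
    using \<alpha> c t unfolding analytic_map_on_curve_iff by blast
  from chart_rep_curve[OF c(1) ct c(2) this fa]
  have "real_analytic_at (snd d \<circ> (\<lambda>s. f (\<alpha> s))) t" .
  with d show "\<exists>d\<in>B. f (\<alpha> t) \<in> fst d \<and> real_analytic_at (snd d \<circ> (\<lambda>s. f (\<alpha> s))) t"
    by (intro bexI[of _ d] conjI)
qed

lemma analytic_curve_affine:
  fixes \<alpha> :: "real \<Rightarrow> 'm"
  assumes \<alpha>: "analytic_map_on std_atlas A I \<alpha>" and J: "\<And>s. s \<in> J \<Longrightarrow> a * s + b \<in> I"
  shows "analytic_map_on std_atlas A J (\<lambda>s. \<alpha> (a * s + b))"
  unfolding analytic_map_on_curve_iff
proof (intro conjI ballI impI)
  have "continuous_on I \<alpha>" using \<alpha> by (simp add: analytic_map_on_def)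
  then show "continuous_on J (\<lambda>s. \<alpha> (a * s + b))"
    by (rule continuous_on_compose2[OF _ continuous_on_add[OF continuous_on_mult_left continuous_on_const]])
      (use J in \<open>auto intro: continuous_on_id\<close>)
  fix d t assume "d \<in> A" "\<alpha> (a * t + b) \<in> fst d" "t \<in> J"
  then have "real_analytic_at (snd d \<circ> \<alpha>) (a * t + b)"
    using \<alpha> J by (simp add: analytic_map_on_curve_iff)
  with real_analytic_curve_compose[OF real_analytic_at_affine[of a b t], of "snd d \<circ> \<alpha>"]
  show "real_analytic_at (snd d \<circ> (\<lambda>s. \<alpha> (a * s + b))) t" by (simp add: comp_def)
qed

lemma analytic_curve_local:
  fixes \<alpha> :: "real \<Rightarrow> 'm"
  assumes "\<And>t. t \<in> I \<Longrightarrow> \<exists>J \<beta>. open J \<and> t \<in> J \<and> analytic_map_on std_atlas A J \<beta> \<and> (\<forall>s\<in>J. \<beta> s = \<alpha> s)"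
  shows "analytic_map_on std_atlas A I \<alpha>"
proof (rule analytic_curveI)
  fix t assume "t \<in> I"
  then obtain J \<beta> where J: "open J" "t \<in> J" "analytic_map_on std_atlas A J \<beta>" "\<forall>s\<in>J. \<beta> s = \<alpha> s"
    using assms by blast
  have ev: "\<forall>\<^sub>F s in nhds t. \<beta> s = \<alpha> s"
    using J by (auto intro!: eventually_mono[OF eventually_nhds_in_open[of J t]])
  have "isCont \<beta> t" by (rule analytic_curveD_cont[OF J(3,1,2)])
  then show "isCont \<alpha> t" using isCont_cong[OF ev] by simp
  obtain c where c: "c \<in> A" "\<alpha> t \<in> fst c" using chart_at by blast
  then have "real_analytic_at (snd c \<circ> \<beta>) t"
    using J unfolding analytic_map_on_curve_iff by metis
  then have "real_analytic_at (snd c \<circ> \<alpha>) t"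
    by (rule real_analytic_at_cong) (use ev in \<open>auto elim!: eventually_mono\<close>)
  with c show "\<exists>c\<in>A. \<alpha> t \<in> fst c \<and> real_analytic_at (snd c \<circ> \<alpha>) t" by blast
qed

lemma analytic_curves_agree_nearby:
  fixes \<alpha> \<beta> :: "real \<Rightarrow> 'm"
  assumes \<alpha>: "analytic_map_on std_atlas A I \<alpha>" and \<beta>: "analytic_map_on std_atlas A I \<beta>"
    and I: "open I" "t \<in> I" and lim: "t islimpt {s. \<alpha> s = \<beta> s}"
  shows "\<forall>\<^sub>F s in nhds t. \<alpha> s = \<beta> s"
proof -
  have c: "isCont \<alpha> t" "isCont \<beta> t"
    using analytic_curveD_cont[OF \<alpha> I] analytic_curveD_cont[OF \<beta> I] by auto
  have eq: "\<alpha> t = \<beta> t"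
  proof (rule ccontr)
    assume "\<alpha> t \<noteq> \<beta> t"
    then obtain U V where UV: "open U" "open V" "\<alpha> t \<in> U" "\<beta> t \<in> V" "U \<inter> V = {}"
      using hausdorff[OF \<open>\<alpha> t \<noteq> \<beta> t\<close>] by blast
    have "\<forall>\<^sub>F s in nhds t. \<alpha> s \<in> U \<and> \<beta> s \<in> V"
      using isCont_eventually_in[OF c(1) UV(1,3)] isCont_eventually_in[OF c(2) UV(2,4)]
      by (rule eventually_conj)
    then obtain T where T: "open T" "t \<in> T" "\<forall>s\<in>T. \<alpha> s \<in> U \<and> \<beta> s \<in> V"
      unfolding eventually_nhds by blast
    then obtain s where "s \<in> T" "\<alpha> s = \<beta> s" using lim unfolding islimpt_def by blast
    with T(3) UV(5) show False by (metis IntI empty_iff)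
  qed
  obtain d where d: "d \<in> A" "\<alpha> t \<in> fst d" using chart_at by blast
  have an: "real_analytic_at (snd d \<circ> \<alpha>) t" "real_analytic_at (snd d \<circ> \<beta>) t"
    using \<alpha> \<beta> d I eq unfolding analytic_map_on_curve_iff by metis+
  have "\<forall>\<^sub>F s in nhds t. (snd d \<circ> \<alpha>) s = (snd d \<circ> \<beta>) s"
  proof (rule real_analytic_curves_eventually_eq[OF an])
    show "t islimpt {s. (snd d \<circ> \<alpha>) s = (snd d \<circ> \<beta>) s}"
      by (rule islimpt_subset[OF lim]) auto
  qed
  moreover have "\<forall>\<^sub>F s in nhds t. \<alpha> s \<in> fst d" "\<forall>\<^sub>F s in nhds t. \<beta> s \<in> fst d"
    using isCont_eventually_in[OF c(1) chart_open[OF d(1)]] isCont_eventually_in[OF c(2) chart_open[OF d(1)]]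
      d eq by auto
  ultimately show ?thesis
    by eventually_elim (auto intro: chart_inj[OF d(1)])
qed

text \<open>The limit points of the coincidence set are closed in \<open>I\<close> for topological reasons and open by the
  local identity theorem in a chart; \<open>I\<close> is connected.\<close>

theorem analytic_curves_identity:
  fixes \<alpha> \<beta> :: "real \<Rightarrow> 'm"
  assumes \<alpha>: "analytic_map_on std_atlas A I \<alpha>" and \<beta>: "analytic_map_on std_atlas A I \<beta>"
    and I: "open I" "connected I" and t0: "t0 \<in> I" "t0 islimpt {s. \<alpha> s = \<beta> s}" and t: "t \<in> I"
  shows "\<alpha> t = \<beta> t"
proof -
  let ?E = "{s. \<alpha> s = \<beta> s}"
  define Z where "Z = {t \<in> I. t islimpt ?E}"
  have nb: "\<exists>N. open N \<and> t \<in> N \<and> N \<subseteq> I \<and> N \<subseteq> ?E" if "t \<in> Z" for t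
  proof -
    have "t \<in> I" "t islimpt ?E" using that by (auto simp: Z_def)
    from analytic_curves_agree_nearby[OF \<alpha> \<beta> I(1) this]
    obtain N where "open N" "t \<in> N" "\<forall>s\<in>N. \<alpha> s = \<beta> s" unfolding eventually_nhds by blast
    then show ?thesis using I(1) \<open>t \<in> I\<close> by (intro exI[of _ "N \<inter> I"]) auto
  qed
  have "open Z"
  proof (subst open_subopen, intro ballI)
    fix t assume "t \<in> Z"
    then obtain N where N: "open N" "t \<in> N" "N \<subseteq> I" "N \<subseteq> ?E" using nb by blast
    then have "N \<subseteq> Z"
      unfolding Z_def using interior_limit_point[of _ N] interior_open[OF N(1)] islimpt_subset[of _ N ?E]
      by auto
    with N show "\<exists>T. open T \<and> t \<in> T \<and> T \<subseteq> Z" by blast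
  qed
  moreover have "open (I - {t. t islimpt ?E})"
    using I(1) closed_limpts by (rule open_Diff)
  ultimately have "Z \<inter> I = {} \<or> (I - {t. t islimpt ?E}) \<inter> I = {}"
    by (intro connectedD[OF I(2)]) (auto simp: Z_def)
  then have "t \<in> Z" using t0 t by (auto simp: Z_def)
  then show ?thesis using nb by blast
qed

end

section \<open>Iteration of maps close to doubling\<close>

text \<open>The shape of squaring in a chart of a Lie group that sends the neutral element to \<open>0\<close>.\<close>

locale near_doubling =
  fixes S :: "('a::euclidean_space \<Rightarrow> complex) \<Rightarrow> 'a \<Rightarrow> complex" and r C :: real
  assumes radius: "r > 0" and const: "C \<ge> 0"
    and zero: "S (\<lambda>b. 0) = (\<lambda>b. 0)"
    and almost_doubles: "\<And>X Y. cnorm X \<le> r \<Longrightarrow> cnorm Y \<le> r \<Longrightarrow>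
      cnorm (\<lambda>i. S X i - S Y i - 2 * (X i - Y i)) \<le> C * max (cnorm X) (cnorm Y) * cnorm (\<lambda>b. X b - Y b)"
begin

text \<open>Starting vectors are admitted if \<open>2 ^ n\<close> times their norm is at most \<open>\<epsilon>\<close>. Then the first \<open>n\<close>
  iterates stay within radius \<open>2 \<epsilon>\<close>, where the relative error of a single step is small enough.\<close>

definition \<epsilon> :: real where "\<epsilon> = min (r / 2) (1 / (2 * (C + 1)))"

lemma eps_bounds: "\<epsilon> > 0" "2 * \<epsilon> \<le> r" "C * \<epsilon> \<le> 1 / 2"
proof -
  show "\<epsilon> > 0" "2 * \<epsilon> \<le> r" using radius const by (auto simp: \<epsilon>_def)
  have "C * \<epsilon> \<le> C * (1 / (2 * (C + 1)))" using const by (intro mult_left_mono) (auto simp: \<epsilon>_def)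
  also have "\<dots> \<le> 1 / 2" using const by (simp add: field_simps)
  finally show "C * \<epsilon> \<le> 1 / 2" .
qed

lemma step_diff:
  assumes "cnorm X \<le> r" "cnorm Y \<le> r"
  shows "cnorm (\<lambda>i. S X i - S Y i) \<le> (2 + C * max (cnorm X) (cnorm Y)) * cnorm (\<lambda>b. X b - Y b)"
proof -
  have "cnorm (\<lambda>i. S X i - S Y i) \<le> cnorm (\<lambda>i. S X i - S Y i - 2 * (X i - Y i)) + cnorm (\<lambda>i. 2 * (X i - Y i))"
    using cnorm_triangle[of "\<lambda>i. S X i - S Y i - 2 * (X i - Y i)" "\<lambda>i. 2 * (X i - Y i)"] by simp
  also have "cnorm (\<lambda>i. 2 * (X i - Y i)) = 2 * cnorm (\<lambda>i. X i - Y i)"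
    unfolding cnorm_scale by simp
  finally show ?thesis using almost_doubles[OF assms] by (simp add: algebra_simps)
qed

text \<open>The induction step of the next estimates, with \<open>\<theta> = 2 ^ k / 2 ^ n\<close>. The relative errors of the
  steps form a geometric series whose last term has size at most \<open>1\<close>; the factor \<open>1 + \<theta>\<close> bounds
  the accumulated error and passes to \<open>1 + 2 \<theta>\<close> when \<open>k\<close> is increased.\<close>

lemma step_growth:
  assumes m: "0 \<le> m" "m \<le> 2 * (\<theta> * \<epsilon>)" and d: "0 \<le> d" "d \<le> a * (1 + \<theta>)" and \<theta>: "0 \<le> \<theta>" "\<theta> \<le> 1"
    and a: "0 \<le> a"
  shows "(2 + C * m) * d \<le> (2 * a) * (1 + 2 * \<theta>)"
proof -
  have "C * m \<le> C * (2 * (\<theta> * \<epsilon>))" using m const by (intro mult_left_mono)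
  also have "\<dots> = 2 * \<theta> * (C * \<epsilon>)" by simp
  also have "\<dots> \<le> 2 * \<theta> * (1 / 2)" using eps_bounds \<theta> by (intro mult_left_mono) auto
  finally have "2 + C * m \<le> 2 + \<theta>" by simp
  then have "(2 + C * m) * d \<le> (2 + \<theta>) * (a * (1 + \<theta>))"
    using d m const \<theta> by (intro mult_mono) auto
  also have "\<dots> = a * (2 + 3 * \<theta> + \<theta> * \<theta>)" by (simp add: algebra_simps)
  also have "\<dots> \<le> a * (2 + 3 * \<theta> + \<theta> * 1)" using a \<theta> by (intro mult_left_mono add_left_mono) auto
  finally show ?thesis by (simp add: algebra_simps)
qed

lemma iterate_bound:
  assumes X: "cnorm X \<le> \<delta>" and \<delta>: "2 ^ n * \<delta> \<le> \<epsilon>" and "k \<le> n"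
  shows "cnorm ((S ^^ k) X) \<le> (2 ^ k * \<delta>) * (1 + 2 ^ k / 2 ^ n)"
  using \<open>k \<le> n\<close>
proof (induction k)
  case 0
  have "0 \<le> \<delta>" using X cnorm_nonneg[of X] by linarith
  then show ?case using X by (simp add: algebra_simps add_increasing2)
next
  case (Suc k)
  define \<theta> :: real where "\<theta> = 2 ^ k / 2 ^ n"
  have d0: "0 \<le> \<delta>" using X cnorm_nonneg[of X] by linarith
  have "(2::real) ^ k \<le> 2 ^ n" using Suc.prems by (intro power_increasing) auto
  then have \<theta>: "0 \<le> \<theta>" "\<theta> \<le> 1" by (auto simp: \<theta>_def)
  let ?Y = "(S ^^ k) X"
  have IH: "cnorm ?Y \<le> (2 ^ k * \<delta>) * (1 + \<theta>)" using Suc by (simp add: \<theta>_def)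
  also have "\<dots> \<le> (2 ^ k * \<delta>) * 2" using \<theta> d0 by (intro mult_left_mono) auto
  also have "2 ^ k * \<delta> = \<theta> * (2 ^ n * \<delta>)" by (simp add: \<theta>_def)
  also have "\<dots> \<le> \<theta> * \<epsilon>" using \<delta> \<theta> by (intro mult_left_mono)
  finally have Y: "cnorm ?Y \<le> 2 * (\<theta> * \<epsilon>)" by simp
  also have "\<dots> \<le> 2 * (1 * \<epsilon>)" using \<theta> eps_bounds by (intro mult_left_mono mult_right_mono) auto
  finally have Yr: "cnorm ?Y \<le> r" using eps_bounds by simp
  have z: "cnorm (\<lambda>b::'a. 0) = 0" by (simp add: cnorm_def)
  have "cnorm (S ?Y) \<le> (2 + C * cnorm ?Y) * cnorm ?Y"
    using step_diff[OF Yr, of "\<lambda>b. 0"] radius z by (simp add: zero max_absorb1)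
  also have "\<dots> \<le> (2 * (2 ^ k * \<delta>)) * (1 + 2 * \<theta>)"
    by (rule step_growth) (use Y IH \<theta> d0 in auto)
  finally show ?case by (simp add: \<theta>_def)
qed

lemma iterate_small:
  assumes X: "cnorm X \<le> \<delta>" and \<delta>: "2 ^ n * \<delta> \<le> \<epsilon>" and "k \<le> n"
  shows "cnorm ((S ^^ k) X) \<le> 2 * (2 ^ k * \<delta>)" "cnorm ((S ^^ k) X) \<le> 2 * (2 ^ k / 2 ^ n * \<epsilon>)"
    "cnorm ((S ^^ k) X) \<le> r"
proof -
  define \<theta> :: real where "\<theta> = 2 ^ k / 2 ^ n"
  have d0: "0 \<le> \<delta>" using X cnorm_nonneg[of X] by linarith
  have "(2::real) ^ k \<le> 2 ^ n" using assms(3) by (intro power_increasing) auto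
  then have \<theta>: "0 \<le> \<theta>" "\<theta> \<le> 1" by (auto simp: \<theta>_def)
  have "cnorm ((S ^^ k) X) \<le> (2 ^ k * \<delta>) * (1 + \<theta>)" using iterate_bound[OF assms] by (simp add: \<theta>_def)
  also have "\<dots> \<le> (2 ^ k * \<delta>) * 2" using \<theta> d0 by (intro mult_left_mono) auto
  finally show 1: "cnorm ((S ^^ k) X) \<le> 2 * (2 ^ k * \<delta>)" by simp
  have "2 ^ k * \<delta> = \<theta> * (2 ^ n * \<delta>)" by (simp add: \<theta>_def)
  also have "\<dots> \<le> \<theta> * \<epsilon>" using \<delta> \<theta> by (intro mult_left_mono)
  finally show 2: "cnorm ((S ^^ k) X) \<le> 2 * (2 ^ k / 2 ^ n * \<epsilon>)" using 1 by (simp add: \<theta>_def)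
  also have "\<dots> \<le> 2 * (1 * \<epsilon>)" using \<theta> eps_bounds unfolding \<theta>_def[symmetric] by (intro mult_left_mono mult_right_mono) auto
  finally show "cnorm ((S ^^ k) X) \<le> r" using eps_bounds by simp
qed

text \<open>After \<open>k\<close> steps a difference has grown by at most twice the factor \<open>2 ^ k\<close> of exact doubling. A
  difference that is small compared with the time step therefore remains small after \<open>n\<close>
  doublings.\<close>

lemma iterate_diff:
  assumes X: "cnorm X \<le> \<delta>" and Y: "cnorm Y \<le> \<delta>" and \<delta>: "2 ^ n * \<delta> \<le> \<epsilon>" and "k \<le> n"
  shows "cnorm (\<lambda>i. (S ^^ k) X i - (S ^^ k) Y i) \<le> 2 * (2 ^ k * cnorm (\<lambda>i. X i - Y i))"
proof -
  let ?d = "cnorm (\<lambda>i. X i - Y i)"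
  have "cnorm (\<lambda>i. (S ^^ k) X i - (S ^^ k) Y i) \<le> (2 ^ k * ?d) * (1 + 2 ^ k / 2 ^ n)"
    using \<open>k \<le> n\<close>
  proof (induction k)
    case (Suc k)
    define \<theta> :: real where "\<theta> = 2 ^ k / 2 ^ n"
    have "(2::real) ^ k \<le> 2 ^ n" using Suc.prems by (intro power_increasing) auto
    then have \<theta>: "0 \<le> \<theta>" "\<theta> \<le> 1" by (auto simp: \<theta>_def)
    have k: "k \<le> n" using Suc.prems by simp
    have "cnorm (\<lambda>i. S ((S ^^ k) X) i - S ((S ^^ k) Y) i)
        \<le> (2 + C * max (cnorm ((S ^^ k) X)) (cnorm ((S ^^ k) Y))) * cnorm (\<lambda>i. (S ^^ k) X i - (S ^^ k) Y i)"
      by (intro step_diff iterate_small[OF X \<delta> k] iterate_small[OF Y \<delta> k])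
    also have "\<dots> \<le> (2 * (2 ^ k * ?d)) * (1 + 2 * \<theta>)"
      by (rule step_growth)
        (use iterate_small(2)[OF X \<delta> k] iterate_small(2)[OF Y \<delta> k] Suc.IH k \<theta> in \<open>auto simp: \<theta>_def le_max_iff_disj\<close>)
    finally show ?case by (simp add: \<theta>_def)
  qed (simp add: algebra_simps)
  also have "\<dots> \<le> (2 ^ k * ?d) * 2"
  proof (rule mult_left_mono)
    have "(2::real) ^ k \<le> 2 ^ n" using assms(4) by (intro power_increasing) auto
    then show "1 + 2 ^ k / 2 ^ n \<le> (2::real)" by simp
  qed simp
  finally show ?thesis by simp
qed

end

section \<open>Squaring in a chart of a Lie group\<close>

lemma sum_over_Basis_prod:
  fixes f :: "'a::euclidean_space \<times> 'b::euclidean_space \<Rightarrow> 'c::comm_monoid_add"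
  shows "(\<Sum>b\<in>Basis. f b) = (\<Sum>b\<in>Basis. f (b, 0)) + (\<Sum>b\<in>Basis. f (0, b))"
proof -
  have "inj_on (\<lambda>u. (u::'a, 0::'b)) Basis" "inj_on (\<lambda>u. (0::'a, u::'b)) Basis"
    by (auto intro!: inj_onI)
  then show ?thesis
    unfolding Basis_prod_def by (subst sum.union_disjoint) (auto simp: sum.reindex nonzero_Basis)
qed

context lie_group
begin

lemma tendsto_mul:
  assumes "(f \<longlongrightarrow> a) F" "(g \<longlongrightarrow> b) F"
  shows "((\<lambda>x. mul (f x) (g x)) \<longlongrightarrow> mul a b) F"
proof -
  have "isCont (\<lambda>(g, h). mul g h) (a, b)"
    using mult_analytic by (simp add: analytic_map_on_def continuous_on_eq_continuous_at)
  from isCont_tendsto_compose[OF this tendsto_Pair[OF assms]] show ?thesis by simp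
qed

lemma tendsto_invg:
  assumes "(f \<longlongrightarrow> a) F" shows "((\<lambda>x. invg (f x)) \<longlongrightarrow> invg a) F"
proof -
  have "isCont invg a"
    using inverse_analytic by (simp add: analytic_map_on_def continuous_on_eq_continuous_at)
  from isCont_tendsto_compose[OF this assms] show ?thesis .
qed

definition prod_chart :: "('g, 'e) chart \<Rightarrow> ('g, 'e) chart \<Rightarrow> ('g \<times> 'g, 'e \<times> 'e) chart" where
  "prod_chart c d = (fst c \<times> fst d, map_prod (snd c) (snd d))"

lemma prod_chart_in: "c \<in> A \<Longrightarrow> d \<in> A \<Longrightarrow> prod_chart c d \<in> prod_atlas A A"
  unfolding prod_chart_def prod_atlas_def by (cases c; cases d) auto

lemma chart_rep_prod:
  assumes "c \<in> A" "d \<in> A" "p \<in> fst c" "q \<in> fst d"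
  shows "chart_rep (prod_chart c d) c' (\<lambda>(g, h). mul g h) (snd c p, snd d q) = snd c' (mul p q)"
proof -
  have "inj_on (map_prod (snd c) (snd d)) (fst c \<times> fst d)"
    using assms(1,2) chart_inj by (auto simp: inj_on_def)
  from inv_into_f_f[OF this, of "(p, q)"] assms(3,4)
  show ?thesis by (simp add: chart_rep_def prod_chart_def)
qed

lemma chart_rep_mul_analytic:
  assumes "c \<in> A" "d \<in> A" "p \<in> fst c" "q \<in> fst d" "c' \<in> A" "mul p q \<in> fst c'"
  shows "real_analytic_at (chart_rep (prod_chart c d) c' (\<lambda>(g, h). mul g h)) (snd c p, snd d q)"
proof -
  have "real_analytic_at (chart_rep (prod_chart c d) c' (\<lambda>(g, h). mul g h)) (snd (prod_chart c d) (p, q))"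
    using mult_analytic assms prod_chart_in[OF assms(1,2)]
    unfolding analytic_map_on_def by (auto simp: prod_chart_def)
  then show ?thesis by (simp add: prod_chart_def)
qed

text \<open>In charts this is the composition of the pair of curves with the analytic multiplication.\<close>

lemma analytic_curve_mul:
  fixes \<alpha> \<beta> :: "real \<Rightarrow> 'g"
  assumes \<alpha>: "analytic_map_on std_atlas A I \<alpha>" and \<beta>: "analytic_map_on std_atlas A I \<beta>" and I: "open I"
  shows "analytic_map_on std_atlas A I (\<lambda>s. mul (\<alpha> s) (\<beta> s))"
proof (rule analytic_curveI)
  fix t assume t: "t \<in> I"
  have ct: "isCont \<alpha> t" "isCont \<beta> t"
    using analytic_curveD_cont[OF \<alpha> I t] analytic_curveD_cont[OF \<beta> I t] .
  then show "isCont (\<lambda>s. mul (\<alpha> s) (\<beta> s)) t"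
    unfolding isCont_def by (rule tendsto_mul)
  obtain c where c: "c \<in> A" "\<alpha> t \<in> fst c" using chart_at by blast
  obtain d where d: "d \<in> A" "\<beta> t \<in> fst d" using chart_at by blast
  obtain c' where c': "c' \<in> A" "mul (\<alpha> t) (\<beta> t) \<in> fst c'" using chart_at by blast
  have "real_analytic_at (\<lambda>s. ((snd c \<circ> \<alpha>) s, (snd d \<circ> \<beta>) s)) t"
    using \<alpha> \<beta> c d t unfolding analytic_map_on_curve_iff by (intro real_analytic_curve_pair) blast+
  from real_analytic_curve_compose[OF this, of "chart_rep (prod_chart c d) c' (\<lambda>(g, h). mul g h)"]
  have "real_analytic_at (\<lambda>s. chart_rep (prod_chart c d) c' (\<lambda>(g, h). mul g h) ((snd c \<circ> \<alpha>) s, (snd d \<circ> \<beta>) s)) t"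
    using chart_rep_mul_analytic[OF c(1) d(1) c(2) d(2) c'] by simp
  moreover have "\<forall>\<^sub>F s in nhds t. chart_rep (prod_chart c d) c' (\<lambda>(g, h). mul g h) ((snd c \<circ> \<alpha>) s, (snd d \<circ> \<beta>) s)
      = (snd c' \<circ> (\<lambda>s. mul (\<alpha> s) (\<beta> s))) s"
    using isCont_eventually_in[OF ct(1) chart_open[OF c(1)] c(2)] isCont_eventually_in[OF ct(2) chart_open[OF d(1)] d(2)]
    by eventually_elim (simp add: chart_rep_prod[OF c(1) d(1)])
  ultimately have "real_analytic_at (snd c' \<circ> (\<lambda>s. mul (\<alpha> s) (\<beta> s))) t" by (rule real_analytic_at_cong)
  with c' show "\<exists>c\<in>A. mul (\<alpha> t) (\<beta> t) \<in> fst c \<and> real_analytic_at (snd c \<circ> (\<lambda>s. mul (\<alpha> s) (\<beta> s))) t"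
    by (intro bexI[of _ c'] conjI)
qed

definition sqr :: "'g \<Rightarrow> 'g" where "sqr g = mul g g"

lemma sqr_e [simp]: "sqr e = e" by (simp add: sqr_def)

lemma tendsto_sqr_pow:
  assumes "(f \<longlongrightarrow> a) F" shows "((\<lambda>x. (sqr ^^ n) (f x)) \<longlongrightarrow> (sqr ^^ n) a) F"
  by (induction n) (auto simp: sqr_def intro: tendsto_mul assms)

lemma analytic_curve_sqr_pow:
  assumes "analytic_map_on std_atlas A I \<alpha>" "open (I :: real set)"
  shows "analytic_map_on std_atlas A I (\<lambda>s. (sqr ^^ n) (\<alpha> s))"
  by (induction n) (auto simp: sqr_def intro: analytic_curve_mul assms)

end

locale lie_group_chart = lie_group A mul e invg
  for A :: "('g::t2_space, 'e::euclidean_space) atlas"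
    and mul :: "'g \<Rightarrow> 'g \<Rightarrow> 'g" and e :: 'g and invg :: "'g \<Rightarrow> 'g" +
  fixes c0 :: "('g, 'e) chart"
  assumes c0: "c0 \<in> A" and e_in: "e \<in> fst c0"
begin

text \<open>Coordinates in the chart \<open>c0\<close>, translated so that the neutral element has coordinates \<open>0\<close>.\<close>

definition coord :: "'g \<Rightarrow> 'e" where "coord g = snd c0 g - snd c0 e"

definition from_coord :: "'e \<Rightarrow> 'g" where "from_coord x = inv_into (fst c0) (snd c0) (snd c0 e + x)"

lemma coord_e [simp]: "coord e = 0" by (simp add: coord_def)

lemma from_coord_coord: "g \<in> fst c0 \<Longrightarrow> from_coord (coord g) = g"
  by (simp add: coord_def from_coord_def chart_inverse[OF c0])

lemma from_coord_0 [simp]: "from_coord 0 = e"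
  using from_coord_coord[OF e_in] by simp

lemma chart_image_open: "open (snd c0 ` fst c0)"
  using open_image[of "fst c0" "snd c0"] c0 by simp

lemma chart_homeo: "homeomorphism (fst c0) (snd c0 ` fst c0) (snd c0) (inv_into (fst c0) (snd c0))"
  using chart_homeomorphism[of "fst c0" "snd c0"] c0 by simp

lemma coord_ball: "\<exists>\<kappa>>0. \<forall>x. norm x < \<kappa> \<longrightarrow> snd c0 e + x \<in> snd c0 ` fst c0"
proof -
  obtain \<kappa> where "\<kappa> > 0" "ball (snd c0 e) \<kappa> \<subseteq> snd c0 ` fst c0"
    using chart_image_open e_in open_contains_ball by blast
  then show ?thesis by (intro exI[of _ \<kappa>]) (auto simp: subset_iff dist_norm)
qed

lemma from_coord_in_chart:
  assumes "snd c0 e + x \<in> snd c0 ` fst c0"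
  shows "from_coord x \<in> fst c0" "coord (from_coord x) = x" "isCont from_coord x"
proof -
  show "from_coord x \<in> fst c0" using assms unfolding from_coord_def by (rule inv_into_into)
  show "coord (from_coord x) = x" using assms by (simp add: from_coord_def coord_def f_inv_into_f)
  have "continuous_on (snd c0 ` fst c0) (inv_into (fst c0) (snd c0))" using chart_homeo by (simp add: homeomorphism_def)
  then have "isCont (inv_into (fst c0) (snd c0)) (snd c0 e + x)"
    using assms continuous_on_eq_continuous_at[OF chart_image_open] by blast
  then show "isCont from_coord x" unfolding from_coord_def
    by (rule isCont_o2[rotated]) (intro continuous_intros)
qed

lemma coord_in_image: "g \<in> fst c0 \<Longrightarrow> snd c0 e + coord g \<in> snd c0 ` fst c0"
  by (simp add: coord_def)

lemma small_coord:
  assumes "open N" "e \<in> N" shows "\<exists>\<delta>>0. \<forall>g\<in>fst c0. norm (coord g) < \<delta> \<longrightarrow> g \<in> N"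
proof -
  have "isCont from_coord 0" using from_coord_in_chart(3)[of 0] e_in by simp
  then have "(from_coord \<longlongrightarrow> from_coord 0) (nhds 0)"
    by (simp only: continuous_at tendsto_at_iff_tendsto_nhds)
  then have "\<forall>\<^sub>F x in nhds 0. from_coord x \<in> N"
    by (rule topological_tendstoD) (use assms in auto)
  then obtain \<delta> where "\<delta> > 0" "\<And>x. norm x < \<delta> \<Longrightarrow> from_coord x \<in> N"
    by (auto simp: eventually_nhds_metric)
  then show ?thesis using from_coord_coord by metis
qed

lemma tendsto_from_coordI:
  assumes lim: "((\<lambda>n. coord (f n)) \<longlongrightarrow> coord g) F" and f: "\<forall>\<^sub>F n in F. f n \<in> fst c0" and g: "g \<in> fst c0"
  shows "(f \<longlongrightarrow> g) F"
proof -
  have "((\<lambda>n. from_coord (coord (f n))) \<longlongrightarrow> from_coord (coord g)) F"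
    by (rule isCont_tendsto_compose[OF from_coord_in_chart(3)[OF coord_in_image[OF g]] lim])
  moreover have "\<forall>\<^sub>F n in F. from_coord (coord (f n)) = f n"
    using f by eventually_elim (rule from_coord_coord)
  ultimately show ?thesis using from_coord_coord[OF g] by (simp add: tendsto_cong)
qed

abbreviation "mul_rep \<equiv> chart_rep (prod_chart c0 c0) c0 (\<lambda>(g, h). mul g h)"

lemma mul_rep_analytic: "real_analytic_at mul_rep (snd c0 e, snd c0 e)"
  by (rule chart_rep_mul_analytic) (use c0 e_in in auto)

lemma mul_rep_chart:
  "g \<in> fst c0 \<Longrightarrow> h \<in> fst c0 \<Longrightarrow> mul_rep (snd c0 g, snd c0 h) = snd c0 (mul g h)"
  by (rule chart_rep_prod[OF c0 c0])

text \<open>Multiplication by the neutral element on either side is the identity, which determines both partial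
  derivatives.\<close>

lemma mul_rep_derivative:
  assumes "(mul_rep has_derivative D) (at (snd c0 e, snd c0 e))"
  shows "D (x, y) = x + y"
proof -
  let ?p = "snd c0 e"
  have ev: "\<forall>\<^sub>F z in nhds ?p. z \<in> snd c0 ` fst c0"
    using chart_image_open e_in by (intro eventually_nhds_in_open) auto
  have "((\<lambda>z. mul_rep (z, ?p)) has_derivative (\<lambda>x. D (x, 0))) (at ?p)"
    by (rule has_derivative_compose[of "\<lambda>z. (z, ?p)" "\<lambda>x. (x, 0)", OF _ assms]) (auto intro!: derivative_eq_intros)
  moreover have "((\<lambda>z. mul_rep (z, ?p)) has_derivative (\<lambda>x. x)) (at ?p)"
    using has_derivative_ident
    by (rule has_derivative_transform_eventually)
      (use ev e_in in \<open>auto simp: eventually_at_filter mul_rep_chart elim!: eventually_mono\<close>)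
  ultimately have 1: "(\<lambda>x. D (x, 0)) = (\<lambda>x. x)" by (rule has_derivative_unique)
  have "((\<lambda>z. mul_rep (?p, z)) has_derivative (\<lambda>x. D (0, x))) (at ?p)"
    by (rule has_derivative_compose[of "\<lambda>z. (?p, z)" "\<lambda>x. (0, x)", OF _ assms]) (auto intro!: derivative_eq_intros)
  moreover have "((\<lambda>z. mul_rep (?p, z)) has_derivative (\<lambda>x. x)) (at ?p)"
    using has_derivative_ident
    by (rule has_derivative_transform_eventually)
      (use ev e_in in \<open>auto simp: eventually_at_filter mul_rep_chart elim!: eventually_mono\<close>)
  ultimately have 2: "(\<lambda>x. D (0, x)) = (\<lambda>x. x)" by (rule has_derivative_unique)
  interpret D: bounded_linear D using assms by (rule has_derivative_bounded_linear)
  show ?thesis using D.add[of "(x, 0)" "(0, y)"] fun_cong[OF 1, of x] fun_cong[OF 2, of y] by simp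
qed

end

locale squaring_chart = lie_group_chart A mul e invg c0 + near_doubling S r C
  for A :: "('g::t2_space, 'e::euclidean_space) atlas"
    and mul :: "'g \<Rightarrow> 'g \<Rightarrow> 'g" and e :: 'g and invg :: "'g \<Rightarrow> 'g" and c0 :: "('g, 'e) chart"
    and S :: "('e \<Rightarrow> complex) \<Rightarrow> 'e \<Rightarrow> complex" and r C :: real +
  assumes sqr_coord: "\<And>g. g \<in> fst c0 \<Longrightarrow> cnorm (cvec (coord g)) \<le> r \<Longrightarrow>
      sqr g \<in> fst c0 \<and> cvec (coord (sqr g)) = S (cvec (coord g))"
    and holomorphic: "\<And>X U i. open U \<Longrightarrow> (\<And>b. b \<in> Basis \<Longrightarrow> (\<lambda>z. X z b) holomorphic_on U) \<Longrightarrow>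
      (\<And>z. z \<in> U \<Longrightarrow> cnorm (X z) \<le> r) \<Longrightarrow> (\<lambda>z. S (X z) i) holomorphic_on U"

context lie_group_chart
begin

text \<open>\<open>S\<close> is the complex extension of the multiplication, restricted to the diagonal. Its linear part is
  doubling because the derivative of the multiplication is addition.\<close>

theorem squaring_chart_exists: "\<exists>S r C. squaring_chart A mul e invg c0 S r C"
proof -
  let ?p = "snd c0 e"
  obtain r C F D where "complex_extension mul_rep (?p, ?p) r C F D"
    using real_analytic_complex_extension[OF mul_rep_analytic] by blast
  then interpret E: complex_extension mul_rep "(?p, ?p)" r C F D .
  \<comment> \<open>Squares of elements close to \<open>e\<close> must stay in the chart domain.\<close>
  define N where "N = {g. sqr g \<in> fst c0}"
  have "isCont sqr g" for g
    unfolding isCont_def sqr_def by (intro tendsto_mul tendsto_ident_at)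
  then have "continuous_on UNIV sqr" by (simp add: continuous_on_eq_continuous_at)
  then have "open N" unfolding N_def using chart_open[OF c0] by (simp add: continuous_on_open_vimage vimage_def)
  moreover have "e \<in> N" by (simp add: N_def e_in)
  ultimately obtain \<delta> where \<delta>: "\<delta> > 0" "\<And>g. g \<in> fst c0 \<Longrightarrow> norm (coord g) < \<delta> \<Longrightarrow> g \<in> N"
    using small_coord by blast
  \<comment> \<open>The diagonal embedding \<open>X \<mapsto> (X, X)\<close> in coordinates.\<close>
  define dbl where "dbl X b = (if b \<in> Basis then if snd b = 0 then X (fst b) else X (snd b) else 0)"
    for X :: "'e \<Rightarrow> complex" and b :: "'e \<times> 'e"
  have dbl0: "dbl X (b, 0) = X b" "dbl X (0, b) = X b" if "b \<in> Basis" for b X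
    using that by (auto simp: dbl_def Basis_prod_def nonzero_Basis)
  have dbl_norm: "cnorm (dbl X) = 2 * cnorm X" for X
    unfolding cnorm_def sum_over_Basis_prod by (simp add: dbl0)
  have dbl_diff: "(\<lambda>b. dbl X b - dbl Y b) = dbl (\<lambda>b. X b - Y b)" for X Y
    by (auto simp: dbl_def)
  have dbl_cvec: "dbl (cvec x) = cvec (x, x)" for x
    by (auto simp: dbl_def cvec_def fun_eq_iff Basis_prod_def nonzero_Basis)
  define S where "S X i = F (dbl X) i - cvec ?p i" for X i
  define r' where "r' = min (r / 2) (\<delta> / 2)"
  have r': "r' > 0" "r' \<le> r / 2" "r' < \<delta>" using E.radius \<delta> by (auto simp: r'_def)
  have sq: "sqr g \<in> fst c0 \<and> cvec (coord (sqr g)) = S (cvec (coord g))"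
    if g: "g \<in> fst c0" "cnorm (cvec (coord g)) \<le> r'" for g
  proof -
    have "norm (coord g) < \<delta>" using g r' norm_le_cnorm_cvec[of "coord g"] by linarith
    then have "sqr g \<in> fst c0" using \<delta>(2) g by (auto simp: N_def)
    moreover have "F (cvec ((snd c0 g, snd c0 g) - (?p, ?p))) = cvec (mul_rep (snd c0 g, snd c0 g))"
    proof (rule E.extends)
      have "cvec ((snd c0 g, snd c0 g) - (?p, ?p)) = dbl (cvec (coord g))"
        by (simp add: dbl_cvec coord_def)
      then show "cnorm (cvec ((snd c0 g, snd c0 g) - (?p, ?p))) \<le> r"
        using g(2) r' by (simp add: dbl_norm)
    qed
    then have "F (dbl (cvec (coord g))) = cvec (snd c0 (sqr g))"
      by (simp add: dbl_cvec coord_def mul_rep_chart[OF g(1) g(1)] sqr_def)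
    then have "cvec (coord (sqr g)) = S (cvec (coord g))"
      by (simp add: S_def coord_def cvec_diff fun_eq_iff)
    ultimately show ?thesis by simp
  qed
  have z: "cnorm (\<lambda>b::'e. 0) = 0" by (simp add: cnorm_def)
  have "near_doubling S r' (4 * C)"
  proof
    show "S (\<lambda>b. 0) = (\<lambda>b. 0)" using sq[of e] e_in r' z by simp
    fix X Y :: "'e \<Rightarrow> complex" assume X: "cnorm X \<le> r'" and Y: "cnorm Y \<le> r'"
    have "(\<Sum>b\<in>Basis. (dbl X b - dbl Y b) * of_real (D b \<bullet> i)) = 2 * (X i - Y i)" if i: "i \<in> Basis" for i
    proof -
      have "(\<Sum>b\<in>Basis. (dbl X b - dbl Y b) * of_real (D b \<bullet> i))
          = 2 * (\<Sum>b\<in>Basis. (X b - Y b) * of_real (b \<bullet> i))"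
        unfolding sum_over_Basis_prod by (simp add: dbl0 mul_rep_derivative[OF E.derivative])
      also have "(\<Sum>b\<in>Basis. (X b - Y b) * of_real (b \<bullet> i)) = (\<Sum>b\<in>Basis. if b = i then X b - Y b else 0)"
        using i by (intro sum.cong) (auto simp: inner_Basis)
      finally show ?thesis using i by simp
    qed
    then have "cnorm (\<lambda>i. S X i - S Y i - 2 * (X i - Y i))
        = cnorm (\<lambda>i. F (dbl X) i - F (dbl Y) i - (\<Sum>b\<in>Basis. (dbl X b - dbl Y b) * of_real (D b \<bullet> i)))"
      unfolding cnorm_def by (intro sum.cong) (auto simp: S_def)
    also have "\<dots> \<le> C * max (cnorm (dbl X)) (cnorm (dbl Y)) * cnorm (\<lambda>b. dbl X b - dbl Y b)"
      by (rule E.remainder) (use X Y r' in \<open>auto simp: dbl_norm\<close>)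
    also have "\<dots> = 4 * C * max (cnorm X) (cnorm Y) * cnorm (\<lambda>b. X b - Y b)"
      unfolding dbl_diff dbl_norm by (simp add: max_def)
    finally show "cnorm (\<lambda>i. S X i - S Y i - 2 * (X i - Y i))
        \<le> 4 * C * max (cnorm X) (cnorm Y) * cnorm (\<lambda>b. X b - Y b)" .
  qed (use r' E.const in auto)
  then interpret nd: near_doubling S r' "4 * C" .
  have hol:  "(\<lambda>z. S (X z) i) holomorphic_on U"
    if "open U" and X: "\<And>b. b \<in> Basis \<Longrightarrow> (\<lambda>z. X z b) holomorphic_on U" and n: "\<And>z. z \<in> U \<Longrightarrow> cnorm (X z) \<le> r'" for X U i
  proof -
    have "(\<lambda>z. F (dbl (X z)) i) holomorphic_on U"
    proof (rule E.holomorphic[OF \<open>open U\<close>])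
      show "(\<lambda>z. dbl (X z) b) holomorphic_on U" if "b \<in> Basis" for b
        using that X by (auto simp: dbl_def Basis_prod_def nonzero_Basis)
      show "cnorm (dbl (X z)) \<le> r" if "z \<in> U" for z
        using n[OF that] r' by (simp add: dbl_norm)
    qed
    then show ?thesis unfolding S_def by (intro holomorphic_intros)
  qed
  have "squaring_chart A mul e invg c0 S r' (4 * C)"
    by unfold_locales (fact sq, fact hol)
  then show ?thesis by blast
qed

end

section \<open>Limits of dyadic powers\<close>

context lie_group_chart
begin

text \<open>Continuity is demanded separately because \<open>coord\<close> has no meaning outside the chart domain.\<close>

definition starts_with_velocity :: "(real \<Rightarrow> 'g) \<Rightarrow> 'e \<Rightarrow> bool" where
  "starts_with_velocity h w \<longleftrightarrow>
     isCont h 0 \<and> h 0 = e \<and> ((\<lambda>t. coord (h t)) has_vector_derivative w) (at 0)"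

text \<open>The halving equation is much weaker than being a homomorphism, but together with the initial
  velocity it already determines the curve (\<open>halving_curve_unique\<close>).\<close>

definition halving_curve :: "(real \<Rightarrow> 'g) \<Rightarrow> 'e \<Rightarrow> bool" where
  "halving_curve f w \<longleftrightarrow> starts_with_velocity f w \<and> (\<forall>t. f t = sqr (f (t / 2)))"

lemma halving_curve_pow:
  assumes "halving_curve f w" shows "f t = (sqr ^^ n) (f (t / 2 ^ n))"
proof (induction n)
  case (Suc n)
  have "f (t / 2 ^ n) = sqr (f (t / 2 ^ n / 2))" using assms unfolding halving_curve_def by blast
  with Suc show ?case by (simp add: funpow_swap1 mult.commute)
qed simp

lemma starts_with_velocity_near:
  assumes h: "starts_with_velocity h w" and \<eta>: "\<eta> > 0"
  shows "\<exists>d>0. \<forall>s. \<bar>s\<bar> < d \<longrightarrow> h s \<in> fst c0 \<and> norm (coord (h s) - s *\<^sub>R w) \<le> \<eta> * \<bar>s\<bar>"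
proof -
  have "\<forall>\<^sub>F s in nhds 0. h s \<in> fst c0"
    by (rule isCont_eventually_in) (use h chart_open[OF c0] e_in in \<open>auto simp: starts_with_velocity_def\<close>)
  then obtain d1 where d1: "d1 > 0" "\<And>s. \<bar>s\<bar> < d1 \<Longrightarrow> h s \<in> fst c0"
    by (auto simp: eventually_nhds_metric)
  have "((\<lambda>t. coord (h t)) has_derivative (\<lambda>s. s *\<^sub>R w)) (at 0)"
    using h by (simp add: starts_with_velocity_def has_vector_derivative_def)
  then obtain d2 where d2: "d2 > 0"
    "\<And>s. \<bar>s\<bar> < d2 \<Longrightarrow> norm (coord (h s) - coord (h 0) - s *\<^sub>R w) \<le> \<eta> * \<bar>s\<bar>"
    unfolding has_derivative_at_alt using \<eta> by (metis diff_zero real_norm_def)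
  have "h 0 = e" using h by (simp add: starts_with_velocity_def)
  with d1 d2 show ?thesis by (intro exI[of _ "min d1 d2"]) auto
qed

end

context squaring_chart
begin

lemma iterate_coord:
  assumes g: "g \<in> fst c0" and \<delta>: "cnorm (cvec (coord g)) \<le> \<delta>" "2 ^ n * \<delta> \<le> \<epsilon>" and "k \<le> n"
  shows "(sqr ^^ k) g \<in> fst c0 \<and> cvec (coord ((sqr ^^ k) g)) = (S ^^ k) (cvec (coord g))"
  using \<open>k \<le> n\<close>
proof (induction k)
  case (Suc k)
  then have "cnorm (cvec (coord ((sqr ^^ k) g))) \<le> r"
    using iterate_small(3)[OF \<delta>, of k] by simp
  with Suc show ?case using sqr_coord[of "(sqr ^^ k) g"] by simp
qed (use g in simp)

text \<open>The curves \<open>f\<close> and \<open>h\<close> differ by \<open>o(t / 2 ^ n)\<close> at \<open>t / 2 ^ n\<close>, and \<open>n\<close> squarings enlarge the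
  difference at most by the factor \<open>2 * 2 ^ n\<close>, as long as everything stays near the neutral element.
  For large \<open>t\<close>, the last \<open>N\<close> squarings are split off and passed to the limit by continuity.\<close>

theorem dyadic_limit:
  assumes f: "halving_curve f w" and h: "starts_with_velocity h w"
  shows "(\<lambda>n. (sqr ^^ n) (h (t / 2 ^ n))) \<longlonglongrightarrow> f t"
proof -
  have f': "starts_with_velocity f w" using f by (simp add: halving_curve_def)
  obtain d1 where d1: "d1 > 0" "\<And>s. \<bar>s\<bar> < d1 \<Longrightarrow> h s \<in> fst c0 \<and> norm (coord (h s) - s *\<^sub>R w) \<le> 1 * \<bar>s\<bar>"
    using starts_with_velocity_near[OF h, of 1] by auto
  obtain d2 where d2: "d2 > 0" "\<And>s. \<bar>s\<bar> < d2 \<Longrightarrow> f s \<in> fst c0 \<and> norm (coord (f s) - s *\<^sub>R w) \<le> 1 * \<bar>s\<bar>"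
    using starts_with_velocity_near[OF f', of 1] by auto
  define K where "K = DIM('e) * (norm w + 1)"
  have bound: "cnorm (cvec x) \<le> K * \<bar>s\<bar>" if "norm (x - s *\<^sub>R w) \<le> 1 * \<bar>s\<bar>" for x s
  proof -
    have "norm x \<le> norm (x - s *\<^sub>R w) + norm (s *\<^sub>R w)" by (metis diff_add_cancel norm_triangle_ineq)
    also have "\<dots> \<le> (norm w + 1) * \<bar>s\<bar>" using that by (simp add: algebra_simps)
    finally have "norm x \<le> (norm w + 1) * \<bar>s\<bar>" .
    then have "DIM('e) * norm x \<le> K * \<bar>s\<bar>" by (simp add: K_def mult.assoc)
    then show ?thesis using cnorm_cvec_le[of x] by linarith
  qed
  have lim0: "(\<lambda>n. a * \<bar>t\<bar> / 2 ^ n) \<longlonglongrightarrow> 0" for a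
    using LIMSEQ_divide_realpow_zero[of 2 "a * \<bar>t\<bar>"] by simp
  have "\<forall>\<^sub>F n in sequentially. 1 * \<bar>t\<bar> / 2 ^ n < min d1 d2 \<and> K * \<bar>t\<bar> / 2 ^ n < \<epsilon>"
    using d1(1) d2(1) eps_bounds(1) by (intro eventually_conj order_tendstoD(2)[OF lim0]) auto
  then obtain N where N: "\<bar>t\<bar> / 2 ^ N < min d1 d2" "K * \<bar>t\<bar> / 2 ^ N < \<epsilon>"
    unfolding eventually_sequentially by auto
  let ?s = "\<lambda>n. t / 2 ^ N / 2 ^ n"
  let ?fN = "f (t / 2 ^ N)"
  let ?a = "\<lambda>n. (sqr ^^ n) (h (?s n))"
  have small: "\<bar>?s n\<bar> < min d1 d2" for n
  proof -
    have "\<bar>?s n\<bar> = \<bar>t\<bar> / 2 ^ N / 2 ^ n" by (simp add: abs_divide)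
    also have "\<dots> \<le> \<bar>t\<bar> / 2 ^ N / 1" by (intro divide_left_mono) auto
    finally show ?thesis using N(1) by simp
  qed
  have step: "?a n \<in> fst c0 \<and> norm (coord (?a n) - coord ?fN) \<le> 4 * DIM('e) * \<eta> * \<bar>t\<bar>"
    if \<eta>: "norm (coord (h (?s n)) - (?s n) *\<^sub>R w) \<le> \<eta> * \<bar>?s n\<bar>"
      "norm (coord (f (?s n)) - (?s n) *\<^sub>R w) \<le> \<eta> * \<bar>?s n\<bar>"
      "\<eta> > 0" for n and \<eta> :: real
  proof -
    define s where "s = ?s n"
    have s: "\<bar>s\<bar> < d1" "\<bar>s\<bar> < d2" using small[of n] by (auto simp: s_def)
    have hs: "h s \<in> fst c0" "cnorm (cvec (coord (h s))) \<le> K * \<bar>s\<bar>" using d1(2)[OF s(1)] bound by auto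
    have fs: "f s \<in> fst c0" "cnorm (cvec (coord (f s))) \<le> K * \<bar>s\<bar>" using d2(2)[OF s(2)] bound by auto
    have \<epsilon>: "2 ^ n * (K * \<bar>s\<bar>) \<le> \<epsilon>" using N(2) by (simp add: s_def abs_divide)
    have 1: "(sqr ^^ n) (h s) \<in> fst c0" "cvec (coord ((sqr ^^ n) (h s))) = (S ^^ n) (cvec (coord (h s)))"
      using iterate_coord[OF hs \<epsilon>, of n] by auto
    have fN: "?fN = (sqr ^^ n) (f s)" unfolding s_def by (rule halving_curve_pow[OF f])
    have 2: "cvec (coord ?fN) = (S ^^ n) (cvec (coord (f s)))"
      using iterate_coord[OF fs \<epsilon>, of n] fN by auto
    have "norm (coord (h s) - coord (f s)) \<le> 2 * \<eta> * \<bar>s\<bar>"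
      using \<eta>(1,2)[folded s_def] norm_triangle_ineq4[of "coord (h s) - s *\<^sub>R w" "coord (f s) - s *\<^sub>R w"]
      by simp
    then have "DIM('e) * norm (coord (h s) - coord (f s)) \<le> DIM('e) * (2 * \<eta> * \<bar>s\<bar>)"
      by (intro mult_left_mono) auto
    then have 3: "cnorm (\<lambda>i. cvec (coord (h s)) i - cvec (coord (f s)) i) \<le> DIM('e) * (2 * \<eta> * \<bar>s\<bar>)"
      using cnorm_cvec_le[of "coord (h s) - coord (f s)"] unfolding cvec_diff by linarith
    have "norm (coord (?a n) - coord ?fN) \<le> cnorm (cvec (coord ((sqr ^^ n) (h s)) - coord ?fN))"
      unfolding s_def by (rule norm_le_cnorm_cvec)
    also have "\<dots> = cnorm (\<lambda>i. (S ^^ n) (cvec (coord (h s))) i - (S ^^ n) (cvec (coord (f s))) i)"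
      by (simp add: cvec_diff 1 2)
    also have "\<dots> \<le> 2 * (2 ^ n * cnorm (\<lambda>i. cvec (coord (h s)) i - cvec (coord (f s)) i))"
      by (rule iterate_diff[OF hs(2) fs(2) \<epsilon> order_refl])
    also have "\<dots> \<le> 2 * (2 ^ n * (DIM('e) * (2 * \<eta> * \<bar>s\<bar>)))"
      using 3 by (intro mult_left_mono) auto
    also have "\<dots> = 4 * DIM('e) * \<eta> * (\<bar>t\<bar> / 2 ^ N)" by (simp add: s_def abs_divide)
    also have "\<dots> \<le> 4 * DIM('e) * \<eta> * (\<bar>t\<bar> / 1)"
      using \<eta>(3) by (intro mult_left_mono divide_left_mono) auto
    finally show ?thesis using 1(1) by (simp add: s_def)
  qed
  have "(\<lambda>n. coord (?a n)) \<longlonglongrightarrow> coord ?fN"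
  proof (rule LIMSEQ_I)
    fix q :: real assume q: "q > 0"
    define den where "den = 4 * DIM('e) * (\<bar>t\<bar> + 1)"
    have den: "den > 0" by (simp add: den_def)
    define \<eta> where "\<eta> = q / den"
    have \<eta>: "\<eta> > 0" using q den by (simp add: \<eta>_def)
    obtain d3 where d3: "d3 > 0" "\<And>s. \<bar>s\<bar> < d3 \<Longrightarrow> h s \<in> fst c0 \<and> norm (coord (h s) - s *\<^sub>R w) \<le> \<eta> * \<bar>s\<bar>"
      using starts_with_velocity_near[OF h \<eta>] by auto
    obtain d4 where d4: "d4 > 0" "\<And>s. \<bar>s\<bar> < d4 \<Longrightarrow> f s \<in> fst c0 \<and> norm (coord (f s) - s *\<^sub>R w) \<le> \<eta> * \<bar>s\<bar>"
      using starts_with_velocity_near[OF f' \<eta>] by auto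
    have "(\<lambda>n. \<bar>?s n\<bar>) \<longlonglongrightarrow> 0"
      using LIMSEQ_divide_realpow_zero[of 2 "\<bar>t\<bar> / 2 ^ N"] by (simp add: abs_divide)
    then have "\<forall>\<^sub>F n in sequentially. \<bar>?s n\<bar> < min d3 d4"
      using d3(1) d4(1) by (intro order_tendstoD(2)[of _ 0]) auto
    then obtain n0 where n0: "\<And>n. n \<ge> n0 \<Longrightarrow> \<bar>?s n\<bar> < min d3 d4"
      unfolding eventually_sequentially by auto
    have "4 * DIM('e) * \<eta> * \<bar>t\<bar> < 4 * DIM('e) * \<eta> * (\<bar>t\<bar> + 1)"
      using \<eta> by (intro mult_strict_left_mono) auto
    also have "\<dots> = \<eta> * den" by (simp add: den_def)
    also have "\<dots> = q" using den by (simp add: \<eta>_def)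
    finally have less: "4 * DIM('e) * \<eta> * \<bar>t\<bar> < q" .
    have "norm (coord (?a n) - coord ?fN) < q" if "n \<ge> n0" for n
    proof -
      have "\<bar>?s n\<bar> < d3" "\<bar>?s n\<bar> < d4" using n0[OF that] by auto
      from step[OF conjunct2[OF d3(2)[OF this(1)]] conjunct2[OF d4(2)[OF this(2)]] \<eta>] less
      show ?thesis by linarith
    qed
    then show "\<exists>n0. \<forall>n\<ge>n0. norm (coord (?a n) - coord ?fN) < q" by blast
  qed
  moreover have "?a n \<in> fst c0" for n
  proof -
    have "\<bar>?s n\<bar> < d1" "\<bar>?s n\<bar> < d2" using small[of n] by auto
    from step[OF conjunct2[OF d1(2)[OF this(1)]] conjunct2[OF d2(2)[OF this(2)]]]
    show ?thesis by simp
  qed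
  moreover have "?fN \<in> fst c0" using d2(2)[of "t / 2 ^ N"] N(1) by (simp add: abs_divide)
  ultimately have "?a \<longlonglongrightarrow> ?fN" by (intro tendsto_from_coordI) auto
  from tendsto_sqr_pow[OF this, of N]
  have "(\<lambda>n. (sqr ^^ (n + N)) (h (t / 2 ^ (n + N)))) \<longlonglongrightarrow> f t"
    by (simp add: halving_curve_pow[OF f, of t N] funpow_add add.commute[of _ N] power_add)
  then show ?thesis by (rule LIMSEQ_offset)
qed

text \<open>The iterates \<open>cc n z\<close> of \<open>S\<close> on the points \<open>z w / 2 ^ n\<close> of a complex line differ from \<open>cc (n + 1) z\<close>
  by at most a constant times \<open>|z|\<^sup>2 / 2 ^ n\<close>. So they converge uniformly to a holomorphic map \<open>g\<close>
  that differs from \<open>z w\<close> by a multiple of \<open>|z|\<^sup>2\<close>. For real \<open>z\<close> the iterates are the coordinates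
  of repeated squares in the group.\<close>

lemma dyadic_limit_of_line:
  fixes w :: 'e
  obtains \<rho> x where "\<rho> > 0"
    and "\<And>t. \<bar>t\<bar> < \<rho> \<Longrightarrow> (\<lambda>n. (sqr ^^ n) (from_coord ((t / 2 ^ n) *\<^sub>R w))) \<longlonglongrightarrow> from_coord (x t)"
    and "\<And>t. \<bar>t\<bar> < \<rho> \<Longrightarrow> snd c0 e + x t \<in> snd c0 ` fst c0"
    and "\<And>t. \<bar>t\<bar> < \<rho> \<Longrightarrow> real_analytic_at x t"
    and "x 0 = 0" and "(x has_vector_derivative w) (at 0)"
proof -
  define W where "W = cnorm (cvec w)"
  have W0: "W \<ge> 0" by (simp add: W_def)
  obtain \<kappa> where \<kappa>: "\<kappa> > 0" "\<And>x. norm x < \<kappa> \<Longrightarrow> snd c0 e + x \<in> snd c0 ` fst c0"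
    using coord_ball by blast
  define den where "den = 2 * (W + 1)"
  have den: "den > 0" using W0 by (simp add: den_def)
  define \<rho> where "\<rho> = min \<epsilon> \<kappa> / den"
  have \<rho>: "\<rho> > 0" using eps_bounds(1) \<kappa>(1) den by (simp add: \<rho>_def)
  have zW: "2 * (a * W) \<le> \<epsilon>" "2 * (a * W) < \<kappa>" if "0 \<le> a" "a < \<rho>" for a
  proof -
    have "2 * (a * W) \<le> 2 * (a * (W + 1))" using that by (simp add: algebra_simps)
    also have "\<dots> < 2 * (\<rho> * (W + 1))" using that W0 by simp
    also have "\<dots> = \<rho> * den" by (simp add: den_def)
    also have "\<dots> = min \<epsilon> \<kappa>" using den by (simp add: \<rho>_def)
    finally show "2 * (a * W) \<le> \<epsilon>" "2 * (a * W) < \<kappa>" by auto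
  qed
  define hh where "hh n z = (\<lambda>b. z / 2 ^ n * cvec w b)" for n z
  define cc where "cc n z = (S ^^ n) (hh n z)" for n z
  have hh_norm: "cnorm (hh n z) = cmod z * W / 2 ^ n" for n z
    unfolding hh_def cnorm_scale W_def by (simp add: norm_divide norm_power)
  have hh_eps: "2 ^ n * (cmod z * W / 2 ^ n) \<le> \<epsilon>" if "cmod z < \<rho>" for n z
  proof -
    have "cmod z * W \<ge> 0" using W0 by simp
    then show ?thesis using zW(1)[of "cmod z"] that by simp
  qed
  have cc_small: "cnorm (cc n z) \<le> 2 * (cmod z * W)" if "cmod z < \<rho>" for n z
    using iterate_small(1)[OF _ hh_eps[OF that], of "hh n z" n n] by (simp add: hh_norm cc_def)
  have cc_hol: "(\<lambda>z. cc n z i) holomorphic_on ball 0 \<rho>" for n i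
  proof -
    have "\<forall>i. (\<lambda>z. (S ^^ k) (hh n z) i) holomorphic_on ball 0 \<rho>" if "k \<le> n" for k
      using that
    proof (induction k)
      case 0
      show ?case by (auto simp: hh_def intro!: holomorphic_intros)
    next
      case (Suc k)
      have "(\<lambda>z. S ((S ^^ k) (hh n z)) i) holomorphic_on ball 0 \<rho>" for i
      proof (rule holomorphic)
        show "cnorm ((S ^^ k) (hh n z)) \<le> r" if "z \<in> ball 0 \<rho>" for z
          using iterate_small(3)[OF _ hh_eps[of z n], of "hh n z" k] that Suc.prems by (simp add: hh_norm)
      qed (use Suc in auto)
      then show ?case by simp
    qed
    then show ?thesis by (simp add: cc_def)
  qed
  define B where "B a = C * (a * W)\<^sup>2 / 2" for a
  have B_mono: "B a \<le> B b" if "0 \<le> a" "a \<le> b" for a b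
    unfolding B_def using that const W0 by (intro divide_right_mono mult_left_mono power_mono mult_right_mono) auto
  have cc_diff: "cnorm (\<lambda>i. cc (Suc n) z i - cc n z i) \<le> B (cmod z) / 2 ^ n" if z: "cmod z < \<rho>" for n z
  proof -
    define Y where "Y = hh (Suc n) z"
    have Yn: "cnorm Y = cmod z * W / 2 ^ Suc n" by (simp add: Y_def hh_norm)
    have Yr: "cnorm Y \<le> r"
      using iterate_small(3)[OF eq_refl[OF Yn] hh_eps[OF z], of 0] by simp
    have SY: "cnorm (S Y) \<le> 2 * (cmod z * W) / 2 ^ n"
      using iterate_small(1)[OF eq_refl[OF Yn] hh_eps[OF z], of 1] by simp
    have hn: "cnorm (hh n z) \<le> 2 * (cmod z * W) / 2 ^ n"
      unfolding hh_norm using W0 by (intro divide_right_mono) auto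
    have dbl: "hh n z b = 2 * Y b" for b by (simp add: Y_def hh_def)
    have z0: "cnorm (\<lambda>b::'e. 0) = 0" by (simp add: cnorm_def)
    have "cnorm (\<lambda>i. S Y i - hh n z i) \<le> C * cnorm Y * cnorm Y"
      using almost_doubles[OF Yr, of "\<lambda>b. 0"] radius z0 by (simp add: zero dbl max_absorb1)
    also have "\<dots> = C * (cmod z * W)\<^sup>2 / 4 / (2 ^ n * 2 ^ n)"
      by (simp add: Yn power2_eq_square)
    finally have d: "cnorm (\<lambda>i. S Y i - hh n z i) \<le> C * (cmod z * W)\<^sup>2 / 4 / (2 ^ n * 2 ^ n)" .
    have e2: "2 ^ n * (2 * (cmod z * W) / 2 ^ n) \<le> \<epsilon>" using zW(1)[of "cmod z"] z by simp
    have "cc (Suc n) z = (S ^^ n) (S Y)" by (simp add: cc_def Y_def funpow_swap1)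
    then have "cnorm (\<lambda>i. cc (Suc n) z i - cc n z i) = cnorm (\<lambda>i. (S ^^ n) (S Y) i - (S ^^ n) (hh n z) i)"
      by (simp add: cc_def)
    also have "\<dots> \<le> 2 * (2 ^ n * cnorm (\<lambda>i. S Y i - hh n z i))"
      by (rule iterate_diff[OF SY hn e2 order_refl])
    also have "\<dots> \<le> 2 * (2 ^ n * (C * (cmod z * W)\<^sup>2 / 4 / (2 ^ n * 2 ^ n)))"
      using d by (intro mult_left_mono) auto
    also have "\<dots> = B (cmod z) / 2 ^ n" by (simp add: B_def)
    finally show ?thesis .
  qed
  have cc_total: "cnorm (\<lambda>i. cc n z i - cc 0 z i) \<le> 2 * B (cmod z)" if z: "cmod z < \<rho>" for n z
  proof -
    have "cnorm (\<lambda>i. cc n z i - cc 0 z i) \<le> B (cmod z) * (2 - 2 / 2 ^ n)"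
    proof (induction n)
      case (Suc n)
      have "cnorm (\<lambda>i. cc (Suc n) z i - cc 0 z i)
          \<le> B (cmod z) / 2 ^ n + B (cmod z) * (2 - 2 / 2 ^ n)"
        using cnorm_diff_triangle[of "cc (Suc n) z" "cc 0 z" "cc n z"] cc_diff[OF z, of n] Suc by linarith
      also have "\<dots> = B (cmod z) * (2 - 2 / 2 ^ Suc n)" by (simp add: field_simps)
      finally show ?case .
    qed (simp add: cnorm_def)
    also have "\<dots> \<le> B (cmod z) * 2"
      using const by (intro mult_left_mono) (auto simp: B_def)
    finally show ?thesis by simp
  qed
  define g where "g i z = cc 0 z i + (\<Sum>n. cc (Suc n) z i - cc n z i)" for i z
  have ul: "uniform_limit (ball 0 \<rho>) (\<lambda>n z. cc n z i) (g i) sequentially" if i: "i \<in> Basis" for i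
  proof -
    have "uniform_limit (ball 0 \<rho>) (\<lambda>n z. \<Sum>k<n. cc (Suc k) z i - cc k z i)
        (\<lambda>z. \<Sum>n. cc (Suc n) z i - cc n z i) sequentially"
    proof (rule Weierstrass_m_test)
      show "norm (cc (Suc n) z i - cc n z i) \<le> B \<rho> * (1 / 2) ^ n" if "z \<in> ball 0 \<rho>" for n z
      proof -
        have z: "cmod z < \<rho>" using that by simp
        have "norm (cc (Suc n) z i - cc n z i) \<le> B (cmod z) / 2 ^ n"
          using cnorm_component_le[OF i, of "\<lambda>i. cc (Suc n) z i - cc n z i"] cc_diff[OF z, of n] by linarith
        also have "\<dots> \<le> B \<rho> / 2 ^ n" using z by (intro divide_right_mono B_mono) auto
        finally show ?thesis by (simp add: power_divide)
      qed
      show "summable (\<lambda>n. B \<rho> * (1 / 2) ^ n)" by (intro summable_mult summable_geometric) simp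
    qed
    then have "uniform_limit (ball 0 \<rho>) (\<lambda>n z. cc 0 z i + (\<Sum>k<n. cc (Suc k) z i - cc k z i)) (g i) sequentially"
      unfolding g_def by (intro uniform_limit_add uniform_limit_const)
    moreover have "cc 0 z i + (\<Sum>k<n. cc (Suc k) z i - cc k z i) = cc n z i" for n z
      using sum_lessThan_telescope[of "\<lambda>k. cc k z i" n] by simp
    ultimately show ?thesis by (simp only:)
  qed
  have lim: "(\<lambda>n. cc n z i) \<longlonglongrightarrow> g i z" if "i \<in> Basis" "cmod z < \<rho>" for i z
    by (rule tendsto_uniform_limitI[OF ul[OF that(1)]]) (use that in simp)
  have g_hol: "g i holomorphic_on ball 0 \<rho>" if i: "i \<in> Basis" for i
  proof (rule holomorphic_uniform_sequence[of _ "\<lambda>n z. cc n z i"])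
    fix z :: complex assume "z \<in> ball 0 \<rho>"
    then obtain d where "d > 0" "cball z d \<subseteq> ball 0 \<rho>" using open_contains_cball open_ball by metis
    then show "\<exists>d>0. cball z d \<subseteq> ball 0 \<rho> \<and> uniform_limit (cball z d) (\<lambda>n z. cc n z i) (g i) sequentially"
      using uniform_limit_on_subset[OF ul[OF i]] by blast
  qed (use cc_hol in auto)
  define h where "h t = from_coord (t *\<^sub>R w)" for t
  have h: "h t \<in> fst c0" "coord (h t) = t *\<^sub>R w" if "\<bar>t\<bar> < \<rho>" for t
  proof -
    have "norm (t *\<^sub>R w) \<le> \<bar>t\<bar> * W" unfolding W_def by (simp add: mult_left_mono norm_le_cnorm_cvec)
    also have "\<dots> \<le> 2 * (\<bar>t\<bar> * W)" using W0 by simp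
    also have "\<dots> < \<kappa>" using zW(2)[of "\<bar>t\<bar>"] that by simp
    finally show "h t \<in> fst c0" "coord (h t) = t *\<^sub>R w"
      using from_coord_in_chart(1,2)[OF \<kappa>(2)] by (auto simp: h_def)
  qed
  define p where "p n t = (sqr ^^ n) (h (t / 2 ^ n))" for n t
  have p: "p n t \<in> fst c0" "cvec (coord (p n t)) = cc n (of_real t)" if t: "\<bar>t\<bar> < \<rho>" for n t
  proof -
    have "\<bar>t / 2 ^ n\<bar> \<le> \<bar>t\<bar> / 1" unfolding abs_divide by (intro divide_left_mono) auto
    then have t': "\<bar>t / 2 ^ n\<bar> < \<rho>" using t by simp
    have eq: "cvec (coord (h (t / 2 ^ n))) = hh n (of_real t)"
      unfolding h(2)[OF t'] by (auto simp: hh_def cvec_def)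
    have "p n t \<in> fst c0 \<and> cvec (coord (p n t)) = (S ^^ n) (cvec (coord (h (t / 2 ^ n))))"
      unfolding p_def
      by (rule iterate_coord[OF h(1)[OF t'] _ hh_eps[of "of_real t" n]]) (use t in \<open>auto simp: eq hh_norm\<close>)
    then show "p n t \<in> fst c0" "cvec (coord (p n t)) = cc n (of_real t)" by (auto simp: eq cc_def)
  qed
  have ccp: "cc n (of_real t) i = of_real (coord (p n t) \<bullet> i)" if "\<bar>t\<bar> < \<rho>" "i \<in> Basis" for n t i
    using p(2)[OF that(1), of n] that(2) by (metis cvec_def)
  define x where "x t = (\<Sum>b\<in>Basis. Re (g b (of_real t)) *\<^sub>R b)" for t
  have xb: "x t \<bullet> i = Re (g i (of_real t))" if "i \<in> Basis" for t i
    using that by (simp add: x_def inner_sum_left inner_Basis if_distrib cong: if_cong)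
  have xlim: "(\<lambda>n. coord (p n t)) \<longlonglongrightarrow> x t" if t: "\<bar>t\<bar> < \<rho>" for t
    unfolding tendsto_componentwise_iff[of _ "x t"]
  proof
    fix i :: 'e assume i: "i \<in> Basis"
    have "(\<lambda>n. Re (cc n (of_real t) i)) \<longlonglongrightarrow> Re (g i (of_real t))"
      by (intro tendsto_Re lim i) (use t in simp)
    then show "(\<lambda>n. coord (p n t) \<bullet> i) \<longlonglongrightarrow> x t \<bullet> i" by (simp add: ccp[OF t i] xb[OF i])
  qed
  have gx: "g i (of_real t) = of_real (x t \<bullet> i)" if t: "\<bar>t\<bar> < \<rho>" and i: "i \<in> Basis" for t i
  proof (rule LIMSEQ_unique)
    show "(\<lambda>n. cc n (of_real t) i) \<longlonglongrightarrow> g i (of_real t)" by (intro lim i) (use t in simp)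
    show "(\<lambda>n. cc n (of_real t) i) \<longlonglongrightarrow> of_real (x t \<bullet> i)"
      unfolding ccp[OF t i] by (intro tendsto_of_real tendsto_inner xlim t tendsto_const)
  qed
  have x_in: "snd c0 e + x t \<in> snd c0 ` fst c0" if t: "\<bar>t\<bar> < \<rho>" for t
  proof (rule \<kappa>(2))
    have "norm (coord (p n t)) \<le> 2 * (\<bar>t\<bar> * W)" for n
      using norm_le_cnorm_cvec[of "coord (p n t)"] cc_small[of "of_real t" n] t p(2)[OF t, of n] by simp
    then have "norm (x t) \<le> 2 * (\<bar>t\<bar> * W)"
      using LIMSEQ_le_const2[OF tendsto_norm[OF xlim[OF t]]] by blast
    then show "norm (x t) < \<kappa>" using zW(2)[of "\<bar>t\<bar>"] t by simp
  qed
  have lim_p: "(\<lambda>n. p n t) \<longlonglongrightarrow> from_coord (x t)" if t: "\<bar>t\<bar> < \<rho>" for t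
    by (rule tendsto_from_coordI) (use xlim[OF t] from_coord_in_chart[OF x_in[OF t]] p(1)[OF t] in auto)
  have ext: "holomorphic_extension x 0 \<rho> g"
    using g_hol gx by (simp add: holomorphic_extension_def)
  have an: "real_analytic_at x t" if t: "\<bar>t\<bar> < \<rho>" for t
  proof (rule holomorphic_extension_imp_real_analytic)
    show "holomorphic_extension x t (\<rho> - \<bar>t\<bar>) g"
      by (rule holomorphic_extension_subset[OF ext]) (auto simp: dist_real_def)
  qed (use t in simp)
  have near: "norm (x t - t *\<^sub>R w) \<le> C * (\<bar>t\<bar> * W)\<^sup>2" if t: "\<bar>t\<bar> < \<rho>" for t
  proof -
    have "norm (coord (p n t) - t *\<^sub>R w) \<le> C * (\<bar>t\<bar> * W)\<^sup>2" for n
    proof -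
      have "t *\<^sub>R w = coord (p 0 t)" by (simp add: p_def h(2)[OF t])
      then have "norm (coord (p n t) - t *\<^sub>R w) \<le> cnorm (\<lambda>i. cc n (of_real t) i - cc 0 (of_real t) i)"
        using norm_le_cnorm_cvec[of "coord (p n t) - coord (p 0 t)"] by (simp add: cvec_diff p(2)[OF t])
      also have "\<dots> \<le> 2 * B \<bar>t\<bar>" using cc_total[of "of_real t" n] t by simp
      finally show ?thesis by (simp add: B_def)
    qed
    then show ?thesis
      using LIMSEQ_le_const2[OF tendsto_norm[OF tendsto_diff[OF xlim[OF t] tendsto_const]]] by blast
  qed
  have x0: "x 0 = 0" using near[of 0] \<rho> by simp
  have "(x has_vector_derivative w) (at 0)"
    unfolding has_vector_derivative_def has_derivative_at_alt
  proof (intro conjI allI impI bounded_linear_scaleR_left)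
    fix \<eta> :: real assume \<eta>: "\<eta> > 0"
    define K where "K = C * W\<^sup>2"
    have K: "K \<ge> 0" using const by (simp add: K_def)
    define d where "d = min \<rho> (\<eta> / (K + 1))"
    have "norm (x t - x 0 - (t - 0) *\<^sub>R w) \<le> \<eta> * norm (t - 0)" if "norm (t - 0) < d" for t
    proof -
      have t: "\<bar>t\<bar> < \<rho>" "\<bar>t\<bar> < \<eta> / (K + 1)" using that by (auto simp: d_def)
      have "norm (x t - t *\<^sub>R w) \<le> (K * \<bar>t\<bar>) * \<bar>t\<bar>"
        using near[OF t(1)] by (simp add: K_def power2_eq_square ac_simps del: abs_mult_self_eq)
      also have "K * \<bar>t\<bar> \<le> (K + 1) * (\<eta> / (K + 1))"
        using t K by (intro mult_mono) auto
      also have "\<dots> = \<eta>" using K by simp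
      finally show ?thesis by (simp add: x0 mult_right_mono)
    qed
    moreover have "d > 0" using \<rho> \<eta> K by (simp add: d_def)
    ultimately show "\<exists>d>0. \<forall>t. norm (t - 0) < d \<longrightarrow> norm (x t - x 0 - (t - 0) *\<^sub>R w) \<le> \<eta> * norm (t - 0)"
      by blast
  qed
  then show ?thesis using that[OF \<rho> _ x_in an x0] lim_p unfolding p_def h_def by blast
qed

text \<open>The dyadic limit of a straight line is analytic near \<open>0\<close>; continuity of squaring extends it to all
  times, where it is a repeated square of the local part.\<close>

theorem halving_curve_exists: "\<exists>c. analytic_map_on std_atlas A UNIV c \<and> halving_curve c w"
proof -
  define h where "h t = from_coord (t *\<^sub>R w)" for t
  obtain \<rho> x where \<rho>: "\<rho> > 0"
    and lim: "\<And>t. \<bar>t\<bar> < \<rho> \<Longrightarrow> (\<lambda>n. (sqr ^^ n) (h (t / 2 ^ n))) \<longlonglongrightarrow> from_coord (x t)"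
    and x_in: "\<And>t. \<bar>t\<bar> < \<rho> \<Longrightarrow> snd c0 e + x t \<in> snd c0 ` fst c0"
    and x_an: "\<And>t. \<bar>t\<bar> < \<rho> \<Longrightarrow> real_analytic_at x t"
    and x0: "x 0 = 0" and x': "(x has_vector_derivative w) (at 0)"
    unfolding h_def using dyadic_limit_of_line[of w] by blast
  define l where "l t = from_coord (x t)" for t
  have l_an: "analytic_map_on std_atlas A (ball 0 \<rho>) l"
  proof (rule analytic_curveI)
    fix t :: real assume "t \<in> ball 0 \<rho>"
    then have t: "\<bar>t\<bar> < \<rho>" by simp
    have "isCont x t"
      using real_analytic_at_imp_differentiable[OF x_an[OF t]] differentiable_imp_continuous_within by blast
    then show "isCont l t"
      unfolding l_def by (rule isCont_o2) (rule from_coord_in_chart(3)[OF x_in[OF t]])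
    obtain q H where q: "q > 0" and H: "holomorphic_extension x t q H"
      using x_an[OF t] unfolding real_analytic_curve_iff by blast
    have "holomorphic_extension (\<lambda>s. snd c0 e + x s) t q (\<lambda>i z. of_real (snd c0 e \<bullet> i) + H i z)"
      using H unfolding holomorphic_extension_def by (auto intro!: holomorphic_intros simp: inner_add_left)
    then have "real_analytic_at (\<lambda>s. snd c0 e + x s) t"
      using q by (rule holomorphic_extension_imp_real_analytic)
    moreover have "\<forall>\<^sub>F s in nhds t. snd c0 e + x s = (snd c0 \<circ> l) s"
    proof (rule eventually_mono)
      show "\<forall>\<^sub>F s in nhds t. s \<in> ball 0 \<rho>" using t by (intro eventually_nhds_in_open) auto
      fix s :: real assume "s \<in> ball 0 \<rho>"
      then have "coord (l s) = x s" unfolding l_def by (intro from_coord_in_chart(2) x_in) simp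
      then show "snd c0 e + x s = (snd c0 \<circ> l) s" by (simp add: coord_def algebra_simps)
    qed
    ultimately have "real_analytic_at (snd c0 \<circ> l) t" by (rule real_analytic_at_cong)
    moreover have "l t \<in> fst c0" unfolding l_def by (rule from_coord_in_chart(1)[OF x_in[OF t]])
    ultimately show "\<exists>c\<in>A. l t \<in> fst c \<and> real_analytic_at (snd c \<circ> l) t" using c0 by blast
  qed
  have ex_N: "\<exists>N. \<bar>t / 2 ^ N\<bar> < \<rho>" for t
  proof -
    have "\<forall>\<^sub>F n in sequentially. \<bar>t\<bar> / 2 ^ n < \<rho>"
      using LIMSEQ_divide_realpow_zero[of 2 "\<bar>t\<bar>"] \<rho> by (intro order_tendstoD(2)[of _ 0]) auto
    then show ?thesis unfolding eventually_sequentially by (auto simp: abs_divide)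
  qed
  let ?a = "\<lambda>t n. (sqr ^^ n) (h (t / 2 ^ n))"
  have lim_N: "?a t \<longlonglongrightarrow> (sqr ^^ N) (l (t / 2 ^ N))" if "\<bar>t / 2 ^ N\<bar> < \<rho>" for t N
  proof -
    have "(\<lambda>n. (sqr ^^ N) ((sqr ^^ n) (h (t / 2 ^ N / 2 ^ n)))) \<longlonglongrightarrow> (sqr ^^ N) (l (t / 2 ^ N))"
      unfolding l_def by (intro tendsto_sqr_pow lim that)
    then have "(\<lambda>n. ?a t (n + N)) \<longlonglongrightarrow> (sqr ^^ N) (l (t / 2 ^ N))"
      by (simp add: funpow_add add.commute[of _ N] power_add)
    then show ?thesis by (rule LIMSEQ_offset)
  qed
  have "\<forall>t. \<exists>L. ?a t \<longlonglongrightarrow> L" using lim_N ex_N by blast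
  then obtain c where c: "\<And>t. ?a t \<longlonglongrightarrow> c t" by metis
  have c_N: "c t = (sqr ^^ N) (l (t / 2 ^ N))" if "\<bar>t / 2 ^ N\<bar> < \<rho>" for t N
    using LIMSEQ_unique[OF c lim_N[OF that]] .
  have cl: "c t = l t" if "\<bar>t\<bar> < \<rho>" for t using c_N[of t 0] that by simp
  have c_sqr: "c t = sqr (c (t / 2))" for t
  proof (rule LIMSEQ_unique)
    show "(\<lambda>n. ?a t (Suc n)) \<longlonglongrightarrow> c t" by (rule LIMSEQ_Suc[OF c])
    show "(\<lambda>n. ?a t (Suc n)) \<longlonglongrightarrow> sqr (c (t / 2))"
      using tendsto_sqr_pow[OF c[of "t / 2"], of 1] by simp
  qed
  have an: "analytic_map_on std_atlas A UNIV c"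
  proof (rule analytic_curve_local)
    fix t :: real
    obtain N where N: "\<bar>t / 2 ^ N\<bar> < \<rho>" using ex_N by blast
    define J where "J = {s. \<bar>s / 2 ^ N\<bar> < \<rho>}"
    have "open J" unfolding J_def by (intro open_Collect_less continuous_intros) auto
    moreover have "t \<in> J" using N by (simp add: J_def)
    moreover have "analytic_map_on std_atlas A J (\<lambda>s. (sqr ^^ N) (l (1 / 2 ^ N * s + 0)))"
      by (intro analytic_curve_sqr_pow analytic_curve_affine[OF l_an] \<open>open J\<close>) (simp add: J_def)
    moreover have "\<forall>s\<in>J. (sqr ^^ N) (l (1 / 2 ^ N * s + 0)) = c s"
      using c_N by (simp add: J_def)
    ultimately show "\<exists>J \<beta>. open J \<and> t \<in> J \<and> analytic_map_on std_atlas A J \<beta> \<and> (\<forall>s\<in>J. \<beta> s = c s)"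
      by blast
  qed
  have "starts_with_velocity c w"
    unfolding starts_with_velocity_def
  proof (intro conjI)
    show "isCont c 0" by (rule analytic_curveD_cont[OF an]) auto
    show "c 0 = e" using cl[of 0] \<rho> by (simp add: l_def x0)
    show "((\<lambda>t. coord (c t)) has_vector_derivative w) (at 0)"
    proof (rule has_vector_derivative_transform_within_open[OF x'])
      show "x t = coord (c t)" if "t \<in> ball 0 \<rho>" for t
        using that cl[of t] from_coord_in_chart(2)[OF x_in[of t]] by (simp add: l_def)
    qed (use \<rho> in auto)
  qed
  with an c_sqr show ?thesis unfolding halving_curve_def by blast
qed

text \<open>The sequence in \<open>dyadic_limit\<close> is constant for a halving curve.\<close>

lemma halving_curve_unique:
  assumes "halving_curve f w" "halving_curve g w" shows "f = g"
proof
  fix t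
  have "(\<lambda>n. (sqr ^^ n) (g (t / 2 ^ n))) \<longlonglongrightarrow> f t"
    using dyadic_limit[OF assms(1)] assms(2) unfolding halving_curve_def by blast
  then have "(\<lambda>n::nat. g t) \<longlonglongrightarrow> f t" by (simp flip: halving_curve_pow[OF assms(2)])
  then show "f t = g t" using LIMSEQ_unique tendsto_const by blast
qed

end

context lie_group_chart
begin

lemma starts_with_velocity_mul:
  assumes f: "starts_with_velocity f v" and h: "starts_with_velocity h w"
  shows "starts_with_velocity (\<lambda>t. mul (f t) (h t)) (v + w)"
proof -
  let ?p = "snd c0 e"
  obtain D where D: "(mul_rep has_derivative D) (at (?p, ?p))"
    using real_analytic_at_imp_differentiable[OF mul_rep_analytic] unfolding differentiable_def by blast
  have f': "isCont f 0" "f 0 = e" "((\<lambda>t. coord (f t)) has_derivative (\<lambda>t. t *\<^sub>R v)) (at 0)"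
    and h': "isCont h 0" "h 0 = e" "((\<lambda>t. coord (h t)) has_derivative (\<lambda>t. t *\<^sub>R w)) (at 0)"
    using f h by (auto simp: starts_with_velocity_def has_vector_derivative_def)
  have chart: "((\<lambda>t. snd c0 (f t)) has_derivative (\<lambda>t. t *\<^sub>R v)) (at 0)" "((\<lambda>t. snd c0 (h t)) has_derivative (\<lambda>t. t *\<^sub>R w)) (at 0)"
    using has_derivative_add[OF f'(3) has_derivative_const[of ?p]] has_derivative_add[OF h'(3) has_derivative_const[of ?p]]
    by (simp_all add: coord_def)
  have "((\<lambda>t. mul_rep (snd c0 (f t), snd c0 (h t))) has_derivative (\<lambda>t. D (t *\<^sub>R v, t *\<^sub>R w))) (at 0)"
    by (rule has_derivative_compose[OF has_derivative_Pair[OF chart]]) (use D f' h' in simp)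
  then have "((\<lambda>t. mul_rep (snd c0 (f t), snd c0 (h t)) - ?p) has_derivative (\<lambda>t. t *\<^sub>R (v + w))) (at 0)"
    using has_derivative_diff[OF _ has_derivative_const] by (fastforce simp: mul_rep_derivative[OF D] scaleR_add_right)
  moreover have ev: "\<forall>\<^sub>F t in nhds 0. f t \<in> fst c0 \<and> h t \<in> fst c0"
    using isCont_eventually_in[OF f'(1) chart_open[OF c0]] isCont_eventually_in[OF h'(1) chart_open[OF c0]] f' h' e_in
    by (simp add: eventually_conj)
  have "\<forall>\<^sub>F t in nhds 0. mul_rep (snd c0 (f t), snd c0 (h t)) - ?p = coord (mul (f t) (h t))"
    using ev by eventually_elim (simp add: mul_rep_chart coord_def)
  ultimately have "((\<lambda>t. coord (mul (f t) (h t))) has_derivative (\<lambda>t. t *\<^sub>R (v + w))) (at 0)"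
    by (elim has_derivative_transform_eventually) (auto simp: eventually_at_filter f' h' mul_rep_chart[OF e_in e_in] coord_def elim: eventually_mono)
  moreover have "isCont (\<lambda>t. mul (f t) (h t)) 0"
    using f'(1) h'(1) unfolding isCont_def by (rule tendsto_mul)
  ultimately show ?thesis
    using f' h' by (simp add: starts_with_velocity_def has_vector_derivative_def)
qed

lemma starts_with_velocity_scale:
  assumes "starts_with_velocity f v" shows "starts_with_velocity (\<lambda>t. f (a * t)) (a *\<^sub>R v)"
proof -
  have f: "isCont f (a * 0)" "((\<lambda>t. coord (f t)) has_derivative (\<lambda>t. t *\<^sub>R v)) (at (a * 0))" "f 0 = e"
    using assms by (auto simp: starts_with_velocity_def has_vector_derivative_def)
  have "((\<lambda>t. coord (f (a * t))) has_derivative (\<lambda>t. (a * t) *\<^sub>R v)) (at 0)"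
    by (rule has_derivative_compose[of "\<lambda>t. a * t" "\<lambda>t. a * t", OF _ f(2)]) (auto intro!: derivative_eq_intros)
  moreover have "isCont (\<lambda>t. f (a * t)) 0"
    by (rule isCont_o2[where f = "\<lambda>t. a * t", OF _ f(1)]) (intro continuous_intros)
  ultimately show ?thesis
    using f by (simp add: starts_with_velocity_def has_vector_derivative_def mult.commute)
qed

text \<open>The inverse has some velocity since inversion is differentiable; which one follows from
  differentiating \<open>f(t) f(t)^(-1) = e\<close>.\<close>

lemma starts_with_velocity_inverse:
  assumes f: "starts_with_velocity f v" shows "starts_with_velocity (\<lambda>t. invg (f t)) (- v)"
proof -
  let ?p = "snd c0 e"
  have f': "isCont f 0" "f 0 = e" "((\<lambda>t. coord (f t)) has_derivative (\<lambda>t. t *\<^sub>R v)) (at 0)"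
    using f by (auto simp: starts_with_velocity_def has_vector_derivative_def)
  have cont: "isCont (\<lambda>t. invg (f t)) 0"
    using f'(1) unfolding isCont_def by (rule tendsto_invg)
  have "real_analytic_at (chart_rep c0 c0 invg) ?p"
    using inverse_analytic c0 e_in unfolding analytic_map_on_def by (metis UNIV_I inverse_neutral)
  then obtain D where D: "(chart_rep c0 c0 invg has_derivative D) (at ?p)"
    using real_analytic_at_imp_differentiable unfolding differentiable_def by blast
  have chart: "((\<lambda>t. snd c0 (f t)) has_derivative (\<lambda>t. t *\<^sub>R v)) (at 0)"
    using has_derivative_add[OF f'(3) has_derivative_const[of ?p]] by (simp add: coord_def)
  interpret D: bounded_linear D using D by (rule has_derivative_bounded_linear)
  have "((\<lambda>t. chart_rep c0 c0 invg (snd c0 (f t)) - ?p) has_derivative (\<lambda>t. D (t *\<^sub>R v) - 0)) (at 0)"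
    by (intro has_derivative_diff has_derivative_const has_derivative_compose[OF chart]) (use D f' in simp)
  then have "((\<lambda>t. chart_rep c0 c0 invg (snd c0 (f t)) - ?p) has_derivative (\<lambda>t. t *\<^sub>R D v)) (at 0)"
    by (simp add: D.scaleR)
  moreover have ev: "\<forall>\<^sub>F t in nhds 0. f t \<in> fst c0"
    using isCont_eventually_in[OF f'(1) chart_open[OF c0]] f' e_in by simp
  ultimately have "((\<lambda>t. coord (invg (f t))) has_derivative (\<lambda>t. t *\<^sub>R D v)) (at 0)"
    by (elim has_derivative_transform_eventually)
      (auto simp: eventually_at_filter f' e_in coord_def chart_rep_def chart_inverse[OF c0] elim: eventually_mono)
  then have i: "starts_with_velocity (\<lambda>t. invg (f t)) (D v)"
    using cont f' by (simp add: starts_with_velocity_def has_vector_derivative_def)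
  from starts_with_velocity_mul[OF f i]
  have "((\<lambda>t::real. 0::'e) has_vector_derivative (v + D v)) (at 0)"
    by (simp add: starts_with_velocity_def)
  then have "v + D v = 0" using vector_derivative_unique_at has_vector_derivative_const by blast
  with i show ?thesis by (simp add: add_eq_0_iff)
qed

end

section \<open>One-parameter subgroups and the product formula\<close>

context lie_group
begin

definition gpow :: "'g \<Rightarrow> nat \<Rightarrow> 'g" where "gpow g k = (mul g ^^ k) e"

lemma gpow_0 [simp]: "gpow g 0 = e" and gpow_Suc [simp]: "gpow g (Suc k) = mul g (gpow g k)"
  by (simp_all add: gpow_def)

lemma gpow_add: "gpow g (k + l) = mul (gpow g k) (gpow g l)"
  by (induction k) (simp_all add: assoc)

lemma gpow_sqr: "gpow (sqr g) k = sqr (gpow g k)"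
proof -
  have "gpow (sqr g) k = gpow g (k + k)"
    by (induction k) (simp_all add: sqr_def assoc)
  then show ?thesis by (simp add: gpow_add sqr_def)
qed

lemma lie_algebraI:
  assumes "\<And>c. \<not> (c \<in> A \<and> e \<in> fst c) \<Longrightarrow> v c = 0"
    and "\<And>c d. c \<in> A \<Longrightarrow> d \<in> A \<Longrightarrow> e \<in> fst c \<inter> fst d \<Longrightarrow>
      v d = frechet_derivative (chart_rep c d id) (at (snd c e)) (v c)"
  shows "v \<in> lie_algebra A e"
  using assms unfolding lie_algebra_def tangent_space_def by blast

lemma lie_algebraD:
  assumes "v \<in> lie_algebra A e"
  shows "\<not> (c \<in> A \<and> e \<in> fst c) \<Longrightarrow> v c = 0"
    and "c \<in> A \<Longrightarrow> d \<in> A \<Longrightarrow> e \<in> fst c \<inter> fst d \<Longrightarrow>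
      frechet_derivative (chart_rep c d id) (at (snd c e)) (v c) = v d"
proof -
  have *: "(\<forall>c. \<not> (c \<in> A \<and> e \<in> fst c) \<longrightarrow> v c = 0) \<and>
      (\<forall>c\<in>A. \<forall>d\<in>A. e \<in> fst c \<inter> fst d \<longrightarrow>
        v d = frechet_derivative (chart_rep c d id) (at (snd c e)) (v c))"
    using assms unfolding lie_algebra_def tangent_space_def by (rule CollectD)
  show "\<not> (c \<in> A \<and> e \<in> fst c) \<Longrightarrow> v c = 0" using * by blast
  show "frechet_derivative (chart_rep c d id) (at (snd c e)) (v c) = v d"
    if "c \<in> A" "d \<in> A" "e \<in> fst c \<inter> fst d"
    using that * by metis
qed

lemma tangent_scale_in: "v \<in> lie_algebra A e \<Longrightarrow> tangent_scale t v \<in> lie_algebra A e"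
proof -
  assume v: "v \<in> lie_algebra A e"
  have "frechet_derivative (chart_rep c d id) (at (snd c e)) (t *\<^sub>R x) = t *\<^sub>R frechet_derivative (chart_rep c d id) (at (snd c e)) x"
    if "c \<in> A" "d \<in> A" "e \<in> fst c \<inter> fst d" for c d x
    using linear_frechet_derivative[OF real_analytic_at_imp_differentiable[OF transition_analytic[OF that]]]
    by (rule linear_cmul)
  then show ?thesis
    by (intro lie_algebraI) (simp_all add: tangent_scale_def lie_algebraD[OF v])
qed

lemma tangent_add_in: "v \<in> lie_algebra A e \<Longrightarrow> w \<in> lie_algebra A e \<Longrightarrow> tangent_add v w \<in> lie_algebra A e"
proof -
  assume v: "v \<in> lie_algebra A e" and w: "w \<in> lie_algebra A e"
  have "frechet_derivative (chart_rep c d id) (at (snd c e)) (x + y)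
      = frechet_derivative (chart_rep c d id) (at (snd c e)) x + frechet_derivative (chart_rep c d id) (at (snd c e)) y"
    if "c \<in> A" "d \<in> A" "e \<in> fst c \<inter> fst d" for c d x y
    using linear_frechet_derivative[OF real_analytic_at_imp_differentiable[OF transition_analytic[OF that]]]
    by (rule linear_add)
  then show ?thesis
    by (intro lie_algebraI) (simp_all add: tangent_add_def lie_algebraD[OF v] lie_algebraD[OF w])
qed

end

context lie_group_chart
begin

lemma starts_with_velocity_const: "starts_with_velocity (\<lambda>t. e) 0"
  by (simp add: starts_with_velocity_def)

lemma starts_with_velocity_gpow:
  assumes "starts_with_velocity f v" shows "starts_with_velocity (\<lambda>t. gpow (f t) k) (real k *\<^sub>R v)"
proof (induction k)
  case (Suc k)
  then show ?case using starts_with_velocity_mul[OF assms Suc] by (simp add: algebra_simps)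
qed (simp add: starts_with_velocity_const)

lemma halving_curve_scale:
  assumes "halving_curve f v" shows "halving_curve (\<lambda>t. f (a * t)) (a *\<^sub>R v)"
proof -
  have "f (a * t) = sqr (f (a * t / 2))" for t using assms unfolding halving_curve_def by blast
  then have "f (a * t) = sqr (f (a * (t / 2)))" for t by simp
  then show ?thesis using assms starts_with_velocity_scale unfolding halving_curve_def by blast
qed

lemma halving_curve_gpow:
  assumes "halving_curve f v" shows "halving_curve (\<lambda>t. gpow (f t) k) (real k *\<^sub>R v)"
proof -
  have "gpow (f t) k = sqr (gpow (f (t / 2)) k)" for t
  proof -
    have "f t = sqr (f (t / 2))" using assms unfolding halving_curve_def by blast
    then have "gpow (f t) k = gpow (sqr (f (t / 2))) k" by (rule arg_cong)
    then show ?thesis by (simp only: gpow_sqr)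
  qed
  then show ?thesis using assms starts_with_velocity_gpow unfolding halving_curve_def by blast
qed

lemma halving_curve_inverse:
  assumes "halving_curve f v" shows "halving_curve (\<lambda>t. invg (f t)) (- v)"
proof -
  have "invg (sqr g) = sqr (invg g)" for g by (simp add: sqr_def inverse_distrib_swap)
  moreover have "f t = sqr (f (t / 2))" for t using assms unfolding halving_curve_def by blast
  ultimately have "invg (f t) = sqr (invg (f (t / 2)))" for t by metis
  then show ?thesis using assms starts_with_velocity_inverse unfolding halving_curve_def by blast
qed

end

context squaring_chart
begin

text \<open>Both sides are halving curves in \<open>t\<close> with the same velocity.\<close>

lemma halving_curve_nat_mult:
  assumes "halving_curve c w" shows "c (real k * t) = gpow (c t) k"
  using fun_cong[OF halving_curve_unique[OF halving_curve_scale[OF assms, of "real k"] halving_curve_gpow[OF assms, of k]]] .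

lemma halving_curve_minus:
  assumes "halving_curve c w" shows "c (- t) = invg (c t)"
proof -
  have "halving_curve (\<lambda>t. c (-1 * t)) (- w)" using halving_curve_scale[OF assms, of "-1"] by simp
  from fun_cong[OF halving_curve_unique[OF this halving_curve_inverse[OF assms]], of t] show ?thesis by simp
qed

lemma halving_curve_analytic:
  assumes "halving_curve c w" shows "analytic_map_on std_atlas A UNIV c"
  using halving_curve_exists[of w] halving_curve_unique[OF assms] by metis

text \<open>For \<open>s = k / n\<close> and \<open>t = l / n\<close> both sides are powers of \<open>c (1 / n)\<close>; the general case follows by
  continuity.\<close>

lemma halving_curve_add_nonneg:
  assumes c: "halving_curve c w" and st: "s \<ge> 0" "t \<ge> 0"
  shows "c (s + t) = mul (c s) (c t)"
proof -
  have cont: "isCont c t" for t by (rule analytic_curveD_cont[OF halving_curve_analytic[OF c]]) auto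
  \<comment> \<open>A rational approximation of \<open>a\<close> with denominator \<open>n + 1\<close>.\<close>
  define q where "q a n = real (nat \<lfloor>a * real (Suc n)\<rfloor>) * (1 / real (Suc n))" for a n
  have q: "(\<lambda>n. q a n) \<longlonglongrightarrow> a" if "a \<ge> 0" for a
  proof (rule tendsto_sandwich)
    have f: "real (nat \<lfloor>a * real (Suc n)\<rfloor>) = of_int \<lfloor>a * real (Suc n)\<rfloor>" for n
      using that by (intro of_nat_nat) simp
    show "\<forall>\<^sub>F n in sequentially. a - 1 / real (Suc n) \<le> q a n"
    proof (intro always_eventually allI)
      fix n
      have "a * real (Suc n) - 1 \<le> real (nat \<lfloor>a * real (Suc n)\<rfloor>)" unfolding f by linarith
      then have "(a * real (Suc n) - 1) / real (Suc n) \<le> real (nat \<lfloor>a * real (Suc n)\<rfloor>) / real (Suc n)"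
        by (rule divide_right_mono) simp
      then show "a - 1 / real (Suc n) \<le> q a n" by (simp add: q_def diff_divide_distrib del: of_nat_Suc)
    qed
    show "\<forall>\<^sub>F n in sequentially. q a n \<le> a"
    proof (intro always_eventually allI)
      fix n
      have "real (nat \<lfloor>a * real (Suc n)\<rfloor>) \<le> a * real (Suc n)" unfolding f by linarith
      then have "real (nat \<lfloor>a * real (Suc n)\<rfloor>) / real (Suc n) \<le> a * real (Suc n) / real (Suc n)"
        by (rule divide_right_mono) simp
      then show "q a n \<le> a" by (simp add: q_def del: of_nat_Suc)
    qed
    show "(\<lambda>n. a - 1 / real (Suc n)) \<longlonglongrightarrow> a"
      using tendsto_diff[OF tendsto_const LIMSEQ_Suc[OF lim_1_over_n], of a] by simp
  qed simp
  have eq: "c (q s n + q t n) = mul (c (q s n)) (c (q t n))" for n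
    unfolding q_def distrib_right[symmetric] of_nat_add[symmetric] halving_curve_nat_mult[OF c] by (rule gpow_add)
  have "(\<lambda>n. c (q s n + q t n)) \<longlonglongrightarrow> c (s + t)"
    by (intro isCont_tendsto_compose[OF cont] tendsto_add q st)
  moreover have "(\<lambda>n. mul (c (q s n)) (c (q t n))) \<longlonglongrightarrow> mul (c s) (c t)"
    by (intro tendsto_mul isCont_tendsto_compose[OF cont] q st)
  ultimately show ?thesis unfolding eq by (rule LIMSEQ_unique)
qed

text \<open>Times of different sign are reduced to nonnegative ones by writing one of \<open>s\<close>, \<open>t\<close>, \<open>s + t\<close> or its
  negative as a sum of two nonnegative numbers.\<close>

theorem halving_curve_add:
  assumes c: "halving_curve c w"
  shows "c (s + t) = mul (c s) (c t)"
proof -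
  note nn = halving_curve_add_nonneg[OF c] and m = halving_curve_minus[OF c]
  have 1: "c (s + t) = mul (c s) (c t)" if t: "t \<ge> 0" for s t
  proof -
    consider "s \<ge> 0" | "s < 0" "s + t \<ge> 0" | "s < 0" "s + t < 0" by linarith
    then show ?thesis
    proof cases
      case 2
      then have "c (- s + (s + t)) = mul (c (- s)) (c (s + t))" by (intro nn) auto
      then have "mul (c s) (c t) = mul (c s) (mul (invg (c s)) (c (s + t)))" by (simp add: m)
      then show ?thesis by (simp flip: assoc)
    next
      case 3
      then have "c (t + (- (s + t))) = mul (c t) (c (- (s + t)))" using t by (intro nn) auto
      moreover have "t + (- (s + t)) = - s" by simp
      ultimately have "invg (c s) = mul (c t) (invg (c (s + t)))" by (simp only: m)
      then have "c s = mul (c (s + t)) (invg (c t))"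
        by (metis inverse_distrib_swap inverse_inverse)
      then show ?thesis by (simp add: assoc)
    qed (use nn t in simp)
  qed
  show ?thesis
  proof (cases "t \<ge> 0")
    case False
    then have "c (s + t + (- t)) = mul (c (s + t)) (c (- t))" by (intro 1) simp
    then show ?thesis by (simp add: m assoc)
  qed (rule 1)
qed

text \<open>Together with the following lemma this identifies one-parameter subgroups of velocity \<open>v\<close> with halving
  curves, so that the description in the definition of \<open>lie_exp\<close> is satisfied by exactly one curve.\<close>

lemma one_param_subgroup_halving:
  assumes "one_param_subgroup A mul c" "has_velocity A c v 0"
  shows "halving_curve c (v c0)"
proof -
  have hom: "c (s + t) = mul (c s) (c t)" for s t using assms(1) by (simp add: one_param_subgroup_def)
  have "mul (c 0) (c 0) = mul (c 0) e" using hom[of 0 0] by simp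
  then have 0: "c 0 = e" by (simp only: left_cancel)
  have "\<forall>t. c t = sqr (c (t / 2))"
  proof
    fix t :: real
    have "t / 2 + t / 2 = t" by simp
    then show "c t = sqr (c (t / 2))" using hom[of "t / 2" "t / 2"] by (simp only: sqr_def)
  qed
  moreover have "isCont c 0"
    using assms(1) unfolding one_param_subgroup_def by (intro analytic_curveD_cont[of A UNIV]) auto
  moreover have "((\<lambda>t. snd c0 (c t) - snd c0 e) has_vector_derivative v c0 - 0) (at 0)"
    using assms(2) c0 e_in 0 unfolding has_velocity_def comp_def
    by (intro has_vector_derivative_diff has_vector_derivative_const) auto
  moreover from this have "((\<lambda>t. coord (c t)) has_vector_derivative v c0) (at 0)" by (simp add: coord_def)
  ultimately show ?thesis using 0 unfolding halving_curve_def starts_with_velocity_def by blast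
qed

lemma halving_one_param_subgroup:
  assumes c: "halving_curve c (v c0)" and v: "v \<in> lie_algebra A e"
  shows "one_param_subgroup A mul c" "has_velocity A c v 0"
proof -
  show "one_param_subgroup A mul c"
    using halving_curve_analytic[OF c] halving_curve_add[OF c] by (simp add: one_param_subgroup_def)
  have c': "isCont c 0" "c 0 = e" "((\<lambda>t. coord (c t)) has_vector_derivative v c0) (at 0)"
    using c unfolding halving_curve_def starts_with_velocity_def by blast+
  have "((\<lambda>t. coord (c t) + snd c0 e) has_vector_derivative v c0 + 0) (at 0)"
    using c'(3) by (intro has_vector_derivative_add has_vector_derivative_const)
  then have D0: "((\<lambda>t. snd c0 (c t)) has_derivative (\<lambda>t. t *\<^sub>R v c0)) (at 0)"
    by (simp add: coord_def has_vector_derivative_def)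
  have "((\<lambda>t. snd d (c t)) has_derivative (\<lambda>t. t *\<^sub>R v d)) (at 0)" if d: "d \<in> A" "e \<in> fst d" for d
  proof -
    let ?T = "frechet_derivative (chart_rep c0 d id) (at (snd c0 e))"
    have "chart_rep c0 d id differentiable (at (snd c0 e))"
      using real_analytic_at_imp_differentiable transition_analytic[OF c0 d(1), of e] d e_in by simp
    then have T: "(chart_rep c0 d id has_derivative ?T) (at (snd c0 e))" by (simp add: frechet_derivative_works)
    then interpret T: bounded_linear ?T by (rule has_derivative_bounded_linear)
    have "((\<lambda>t. chart_rep c0 d id (snd c0 (c t))) has_derivative (\<lambda>t. ?T (t *\<^sub>R v c0))) (at 0)"
      by (rule has_derivative_compose[OF D0]) (use T c' in \<open>simp only:\<close>)
    moreover have "?T (v c0) = v d"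
      using lie_algebraD(2)[OF v c0 d(1)] d(2) e_in by simp
    ultimately have "((\<lambda>t. chart_rep c0 d id (snd c0 (c t))) has_derivative (\<lambda>t. t *\<^sub>R v d)) (at 0)"
      by (simp add: T.scaleR)
    moreover have "\<forall>\<^sub>F t in nhds 0. c t \<in> fst c0"
      using isCont_eventually_in[OF c'(1) chart_open[OF c0]] c' e_in by simp
    ultimately show ?thesis
      by (elim has_derivative_transform_eventually)
        (auto simp: eventually_at_filter c' e_in chart_rep_def chart_inverse[OF c0] elim: eventually_mono)
  qed
  with v show "has_velocity A c v 0"
    by (simp add: has_velocity_def c' lie_algebra_def has_vector_derivative_def comp_def)
qed

lemma lie_exp_halving:
  assumes c: "halving_curve c (v c0)" and v: "v \<in> lie_algebra A e"
  shows "lie_exp A mul (tangent_scale t v) = c t"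
proof -
  have "halving_curve (\<lambda>s. c (t * s)) (tangent_scale t v c0)"
    using halving_curve_scale[OF c] by (simp add: tangent_scale_def)
  note h = this halving_one_param_subgroup[OF this tangent_scale_in[OF v]]
  have "(THE f. one_param_subgroup A mul f \<and> has_velocity A f (tangent_scale t v) 0) = (\<lambda>s. c (t * s))"
  proof (rule the_equality)
    show "f = (\<lambda>s. c (t * s))"
      if "one_param_subgroup A mul f \<and> has_velocity A f (tangent_scale t v) 0" for f
      using that by (intro halving_curve_unique[OF _ h(1)] one_param_subgroup_halving) auto
  qed (use h(2,3) in blast)
  then show ?thesis by (simp add: lie_exp_def)
qed

end

context lie_group
begin

lemma obtain_squaring_chart:
  obtains c0 S r C where "squaring_chart A mul e invg c0 S r C"
proof -
  obtain c0 where "c0 \<in> A" "e \<in> fst c0" using chart_at by blast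
  then interpret lie_group_chart A mul e invg c0 by unfold_locales
  show ?thesis using squaring_chart_exists that by blast
qed

abbreviation exp_curve :: "('g, 'e) tangent \<Rightarrow> real \<Rightarrow> 'g" where
  "exp_curve v t \<equiv> lie_exp A mul (tangent_scale t v)"

theorem exp_curve_one_param_subgroup:
  assumes v: "v \<in> lie_algebra A e" shows "one_param_subgroup A mul (exp_curve v)"
proof -
  obtain c0 S r C where "squaring_chart A mul e invg c0 S r C" by (rule obtain_squaring_chart)
  then interpret squaring_chart A mul e invg c0 S r C .
  obtain c where c: "halving_curve c (v c0)" using halving_curve_exists by blast
  have "exp_curve v = c" using lie_exp_halving[OF c v] by blast
  then show ?thesis using halving_one_param_subgroup(1)[OF c v] by simp
qed

text \<open>The product of two one-parameter subgroups starts with the sum of their velocities, so this is an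
  instance of \<open>dyadic_limit\<close>.\<close>

theorem exp_product_formula:
  assumes v: "v \<in> lie_algebra A e" and w: "w \<in> lie_algebra A e"
  shows "(\<lambda>n. (sqr ^^ n) (mul (exp_curve v (t / 2 ^ n)) (exp_curve w (t / 2 ^ n)))) \<longlonglongrightarrow> exp_curve (tangent_add v w) t"
proof -
  obtain c0 S r C where "squaring_chart A mul e invg c0 S r C" by (rule obtain_squaring_chart)
  then interpret squaring_chart A mul e invg c0 S r C .
  obtain c where c: "halving_curve c (v c0)" using halving_curve_exists by blast
  obtain d where d: "halving_curve d (w c0)" using halving_curve_exists by blast
  obtain f where f: "halving_curve f (v c0 + w c0)" using halving_curve_exists by blast
  have "exp_curve (tangent_add v w) t = f t"
    using lie_exp_halving[of f "tangent_add v w"] tangent_add_in[OF v w] f by (simp add: tangent_add_def)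
  moreover have "starts_with_velocity (\<lambda>t. mul (c t) (d t)) (v c0 + w c0)"
    using c d unfolding halving_curve_def by (intro starts_with_velocity_mul) blast+
  ultimately show ?thesis
    unfolding lie_exp_halving[OF c v] lie_exp_halving[OF d w] using dyadic_limit[OF f] by simp
qed

end

section \<open>Real functions with nonzero derivative\<close>

lemma inverse_function_on_interval:
  fixes f f' :: "real \<Rightarrow> real"
  assumes T: "open T" "connected T"
    and der: "\<And>t. t \<in> T \<Longrightarrow> (f has_field_derivative f' t) (at t)" and nz: "\<And>t. t \<in> T \<Longrightarrow> f' t \<noteq> 0"
  shows "inj_on f T" and "open (f ` T)" and "connected (f ` T)"
    and "\<And>t. t \<in> T \<Longrightarrow> (inv_into T f has_field_derivative inverse (f' t)) (at (f t))"
proof -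
  have less: "f s \<noteq> f t" if "s \<in> T" "t \<in> T" "s < t" for s t
  proof
    assume eq: "f s = f t"
    have sub: "{s..t} \<subseteq> T" using T(2) that by (intro connected_contains_Icc)
    have "\<exists>z. s < z \<and> z < t \<and> f t - f s = (t - s) * f' z"
      using sub \<open>s < t\<close> by (intro MVT2 der) auto
    then obtain z where "s < z" "z < t" "f' z = 0" using eq \<open>s < t\<close> by auto
    moreover from this have "z \<in> T" using sub by auto
    ultimately show False using nz by blast
  qed
  then show inj: "inj_on f T" by (metis inj_onI linorder_neqE_linordered_idom)
  have cont: "continuous_on T f"
    using der by (meson DERIV_isCont continuous_at_imp_continuous_on)
  show "open (f ` T)" using injective_into_1d_imp_open_map_UNIV[OF T(1) cont inj] by simp
  show "connected (f ` T)" using cont T(2) by (rule connected_continuous_image)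
  show "(inv_into T f has_field_derivative inverse (f' t)) (at (f t))" if "t \<in> T" for t
    by (rule has_field_derivative_inverse_strong[OF der[OF that] nz[OF that] T(1) that cont])
      (rule inv_into_f_f[OF inj])
qed

lemma real_analytic_nonconstant_derivative:
  fixes f :: "real \<Rightarrow> real"
  assumes T: "open T" "connected T" and an: "\<And>t. t \<in> T \<Longrightarrow> real_analytic_at f t"
    and nc: "\<not> f constant_on T"
  shows "\<exists>t r f'. r > 0 \<and> ball t r \<subseteq> T \<and> continuous_on (ball t r) f' \<and>
    (\<forall>s\<in>ball t r. (f has_field_derivative f' s) (at s) \<and> f' s \<noteq> 0)"
proof -
  have "\<exists>t\<in>T. \<not> (f has_field_derivative 0) (at t)"
  proof (rule ccontr)
    assume "\<not> ?thesis"
    then have "\<exists>c. \<forall>t\<in>T. f t = c"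
      using T(2) by (intro has_field_derivative_zero_constant)
        (auto simp: connected_convex_1 intro: has_field_derivative_at_within)
    with nc show False by (simp add: constant_on_def)
  qed
  then obtain t where t: "t \<in> T" "\<not> (f has_field_derivative 0) (at t)" by blast
  obtain r f' where r: "r > 0" and f': "\<And>s. s \<in> ball t r \<Longrightarrow> (f has_field_derivative f' s) (at s)"
    and cont: "continuous_on (ball t r) f'"
    using real_analytic_has_continuous_derivative[OF an[OF t(1)]] by blast
  have "f' t \<noteq> 0" using f'[of t] t(2) r by auto
  moreover have "isCont f' t" using cont r by (simp add: continuous_on_eq_continuous_at)
  ultimately have "\<forall>\<^sub>F s in nhds t. f' s \<noteq> 0"
    using isCont_eventually_in[of t f' "- {0}"] by (simp add: open_Compl)
  moreover have "\<forall>\<^sub>F s in nhds t. s \<in> T \<inter> ball t r"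
    using T(1) t(1) r by (intro eventually_nhds_in_open) auto
  ultimately have "\<forall>\<^sub>F s in nhds t. f' s \<noteq> 0 \<and> s \<in> T \<inter> ball t r" by (rule eventually_conj)
  then obtain d where d: "d > 0" "\<And>s. dist s t < d \<Longrightarrow> f' s \<noteq> 0 \<and> s \<in> T \<inter> ball t r"
    unfolding eventually_nhds_metric by blast
  have b: "f' s \<noteq> 0 \<and> s \<in> T \<inter> ball t r" if "s \<in> ball t d" for s
    using d(2)[of s] that by (simp add: dist_commute)
  show ?thesis
    by (intro exI[of _ t] exI[of _ d] exI[of _ f'] conjI ballI)
      (use b f' d(1) in \<open>auto intro: continuous_on_subset[OF cont]\<close>)
qed

lemma connected_real_islimpt:
  fixes S :: "real set"
  assumes "connected S" "a \<in> S" "b \<in> S" "a \<noteq> b" shows "a islimpt S"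
  using connected_imp_perfect[OF assms(1), of a] assms(2-4) by blast

section \<open>Orbits of one-parameter subgroups\<close>

locale analytic_action = lie_group G mul e invg
  for G :: "('g::t2_space, 'k::euclidean_space) atlas"
    and mul :: "'g \<Rightarrow> 'g \<Rightarrow> 'g" and e :: 'g and invg :: "'g \<Rightarrow> 'g" +
  fixes M :: "('m::t2_space, 'e::euclidean_space) atlas" and act :: "'g \<Rightarrow> 'm \<Rightarrow> 'm"
  assumes manifold: "analytic_manifold M"
    and action: "left_action mul e act"
    and separately: "separately_analytic G M act"
begin

sublocale M: analytic_manifold M by (rule manifold)

lemma act_e [simp]: "act e x = x" and act_mul: "act (mul g h) x = act g (act h x)"
  using action by (auto simp: left_action_def)

lemma tendsto_act: "(f \<longlongrightarrow> g) F \<Longrightarrow> ((\<lambda>n. act (f n) x) \<longlongrightarrow> act g x) F"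
proof -
  have "isCont (\<lambda>g. act g x) g"
    using separately by (simp add: separately_analytic_def analytic_map_on_def continuous_on_eq_continuous_at)
  then show "(f \<longlongrightarrow> g) F \<Longrightarrow> ?thesis" by (rule isCont_tendsto_compose)
qed

lemma exp_curve_add: "v \<in> lie_algebra G e \<Longrightarrow> exp_curve v (s + t) = mul (exp_curve v s) (exp_curve v t)"
  using exp_curve_one_param_subgroup unfolding one_param_subgroup_def by blast

lemma exp_curve_0: "v \<in> lie_algebra G e \<Longrightarrow> exp_curve v 0 = e"
  using exp_curve_add[of v 0 0] left_cancel[of "exp_curve v 0" "exp_curve v 0" e] by simp

lemma exp_curve_scale: "exp_curve (tangent_scale r v) t = exp_curve v (t * r)"
  by (simp add: tangent_scale_def)

definition orbit :: "('g, 'k) tangent \<Rightarrow> 'm \<Rightarrow> real \<Rightarrow> 'm" where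
  "orbit v x s = act (exp_curve v s) x"

lemma orbit_shift: "v \<in> lie_algebra G e \<Longrightarrow> act (exp_curve v h) (orbit v x s) = orbit v x (h + s)"
  by (simp add: orbit_def exp_curve_add act_mul)

lemma orbit_0: "v \<in> lie_algebra G e \<Longrightarrow> orbit v x 0 = x"
  by (simp add: orbit_def exp_curve_0)

lemma orbit_analytic:
  assumes "v \<in> lie_algebra G e" shows "analytic_map_on std_atlas M UNIV (orbit v x)"
proof -
  have "analytic_map_on G M UNIV (\<lambda>g. act g x)"
    using separately by (simp add: separately_analytic_def)
  moreover have "analytic_map_on std_atlas G UNIV (exp_curve v)"
    using exp_curve_one_param_subgroup[OF assms] by (simp add: one_param_subgroup_def)
  ultimately show ?thesis
    unfolding orbit_def using analytic_curve_compose[OF manifold open_UNIV] by blast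
qed

lemma translated_orbit_analytic:
  assumes "v \<in> lie_algebra G e" shows "analytic_map_on std_atlas M UNIV (\<lambda>s. act g (orbit v x s))"
proof -
  have "analytic_map_on M M UNIV (act g)"
    using separately by (simp add: separately_analytic_def)
  then show ?thesis using M.analytic_curve_compose[OF manifold open_UNIV orbit_analytic[OF assms]] by blast
qed

lemma isCont_orbit: "v \<in> lie_algebra G e \<Longrightarrow> isCont (orbit v x) s"
  by (rule analytic_curveD_cont[OF orbit_analytic]) auto

text \<open>This is the identity theorem for an orbit and a constant curve.\<close>

lemma orbit_constant:
  assumes v: "v \<in> lie_algebra G e" and t: "t islimpt {s. orbit v x s = p}"
  shows "orbit v x s = p"
proof -
  have "analytic_map_on std_atlas M UNIV (\<lambda>s::real. p)"
    using real_analytic_curve_const by (auto simp: analytic_map_on_curve_iff comp_def)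
  from M.analytic_curves_identity[OF orbit_analytic[OF v] this open_UNIV connected_UNIV UNIV_I t UNIV_I]
  show ?thesis .
qed

text \<open>A transfer principle along the product formula: \<open>\<psi>\<close> describes how the products of the two
  exponentials act on an invariant set \<open>P\<close>. It is used with the trivial \<open>\<psi>\<close>, and with the action of one
  of the two exponentials when the other one fixes \<open>P\<close> pointwise.\<close>

lemma exp_sum_acts:
  assumes v: "v \<in> lie_algebra G e" and w: "w \<in> lie_algebra G e"
    and inv: "\<And>u p. p \<in> P \<Longrightarrow> \<psi> u p \<in> P"
    and dbl: "\<And>u p. p \<in> P \<Longrightarrow> \<psi> u (\<psi> u p) = \<psi> (2 * u) p"
    and act: "\<And>u p. p \<in> P \<Longrightarrow> act (mul (exp_curve v u) (exp_curve w u)) p = \<psi> u p"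
    and p: "p \<in> P"
  shows "act (exp_curve (tangent_add v w) t) p = \<psi> t p"
proof -
  have "act ((sqr ^^ n) g) p = \<psi> (2 ^ n * u) p"
    if "g = mul (exp_curve v u) (exp_curve w u)" "p \<in> P" for n g u p
    using that(2)
  proof (induction n arbitrary: p)
    case (Suc n)
    have "act ((sqr ^^ Suc n) g) p = \<psi> (2 ^ n * u) (\<psi> (2 ^ n * u) p)"
      unfolding funpow.simps comp_def sqr_def[of "(sqr ^^ n) g"] act_mul using Suc inv by simp
    with Suc.prems show ?case by (simp add: dbl mult.assoc)
  qed (simp add: that(1) act)
  from this[OF refl p, of _ "t / 2 ^ n" for n]
  have "(\<lambda>n::nat. \<psi> t p) \<longlonglongrightarrow> act (exp_curve (tangent_add v w) t) p"
    using tendsto_act[OF exp_product_formula[OF v w, of t], of p] by simp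
  then show ?thesis using LIMSEQ_unique tendsto_const by blast
qed

text \<open>Satedness forbids that a group element contracts an arc of the orbit towards a point. This forces
  the modulus of \<open>\<tau>'\<close> to be constant, as explained at the beginning; \<open>\<tau>'\<close> has no zeros, so its sign is
  constant as well.\<close>

theorem sated_reparametrization_affine:
  assumes sated: "sated act" and v: "v \<in> lie_algebra G e" and q: "q \<in> lie_algebra G e"
    and J: "open J" "connected J"
    and \<tau>: "\<And>s. s \<in> J \<Longrightarrow> (\<tau> has_field_derivative \<tau>' s) (at s)"
    and nz: "\<And>s. s \<in> J \<Longrightarrow> \<tau>' s \<noteq> 0" and cont: "continuous_on J \<tau>'"
    and eq: "\<And>s. s \<in> J \<Longrightarrow> orbit v x s = orbit q y (\<tau> s)"
    and nc: "\<not> orbit v x constant_on UNIV"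
  shows "\<exists>a b. \<forall>s\<in>J. \<tau> s = a * s + b"
proof -
  have inverse: "inj_on \<tau> J" "open (\<tau> ` J)" "connected (\<tau> ` J)"
    "\<And>s. s \<in> J \<Longrightarrow> (inv_into J \<tau> has_field_derivative inverse (\<tau>' s)) (at (\<tau> s))"
    using inverse_function_on_interval[of J \<tau> \<tau>'] J \<tau> nz by blast+
  define \<kappa> where "\<kappa> = inv_into J \<tau>"
  have no_contraction: "\<not> \<bar>\<tau>' s0\<bar> < \<bar>\<tau>' s1\<bar>" if s0: "s0 \<in> J" and s1: "s1 \<in> J" for s0 s1
  proof
    assume less: "\<bar>\<tau>' s0\<bar> < \<bar>\<tau>' s1\<bar>"
    define m where "m a = \<tau> s1 + (\<tau> (s0 + a) - \<tau> s0)" for a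
    define P where "P a = \<kappa> (m a) - s1" for a
    define c where "c = \<tau>' s0 / \<tau>' s1"
    have c: "\<bar>c\<bar> < 1" using less by (simp add: c_def abs_divide divide_less_eq)
    have m0: "m 0 = \<tau> s1" by (simp add: m_def)
    have m': "(m has_field_derivative \<tau>' s0) (at 0)"
    proof -
      have "((\<lambda>a. \<tau> (s0 + a)) has_field_derivative \<tau>' s0) (at 0)"
        using \<tau>[OF s0] by (simp add: DERIV_shift[of \<tau> _ 0 s0, simplified] add.commute)
      then show ?thesis unfolding m_def by (auto intro!: derivative_eq_intros)
    qed
    have "(\<kappa> has_field_derivative inverse (\<tau>' s1)) (at (m 0))"
      unfolding m0 \<kappa>_def by (rule inverse(4)[OF s1])
    from DERIV_chain2[OF this m']
    have P': "(P has_field_derivative c) (at 0)"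
      unfolding P_def c_def by (auto intro!: derivative_eq_intros simp: field_simps)
    have P0: "P 0 = 0" using inv_into_f_f[OF inverse(1) s1] by (simp add: P_def m0 \<kappa>_def)
    \<comment> \<open>A contraction constant strictly between \<open>\<bar>c\<bar>\<close> and \<open>1\<close>.\<close>
    define k where "k = (\<bar>c\<bar> + 1) / 2"
    have k: "\<bar>c\<bar> < k" "k < 1" "0 \<le> k" using c by (auto simp: k_def)
    have "(\<lambda>a. P a / a) \<midarrow>0\<rightarrow> c" using P' P0 by (simp add: has_field_derivative_iff)
    then have "((\<lambda>a. \<bar>P a / a\<bar>) \<longlongrightarrow> \<bar>c\<bar>) (at 0)" by (rule tendsto_rabs)
    then have "\<forall>\<^sub>F a in at 0. \<bar>P a / a\<bar> < k" using k(1) by (rule order_tendstoD(2))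
    then have ev1: "\<forall>\<^sub>F a in nhds 0. \<bar>P a\<bar> \<le> k * \<bar>a\<bar>"
      unfolding eventually_at_filter
      by eventually_elim (use P0 in \<open>auto simp: abs_divide divide_less_eq split: if_splits\<close>)
    have "isCont m 0" using m' by (rule DERIV_isCont)
    then have ev2: "\<forall>\<^sub>F a in nhds 0. m a \<in> \<tau> ` J"
      by (rule isCont_eventually_in[OF _ inverse(2)]) (use s1 m0 in auto)
    have "isCont ((+) s0) (0::real)" by (intro continuous_intros)
    then have ev3: "\<forall>\<^sub>F a in nhds 0. s0 + a \<in> J"
      by (rule isCont_eventually_in[OF _ J(1)]) (use s0 in auto)
    from eventually_conj[OF ev1 eventually_conj[OF ev2 ev3]]
    obtain \<delta> where \<delta>: "\<delta> > 0"
      "\<And>a. \<bar>a\<bar> < \<delta> \<Longrightarrow> \<bar>P a\<bar> \<le> k * \<bar>a\<bar> \<and> m a \<in> \<tau> ` J \<and> s0 + a \<in> J"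
      unfolding eventually_nhds_metric by auto
    define g where "g = mul (exp_curve v (s0 - s1)) (exp_curve q (\<tau> s1 - \<tau> s0))"
    have g: "act g (orbit v x (s0 + a)) = orbit v x (s0 + P a)" if a: "\<bar>a\<bar> < \<delta>" for a
    proof -
      have \<kappa>: "\<kappa> (m a) \<in> J" "\<tau> (\<kappa> (m a)) = m a"
        using \<delta>(2)[OF a] unfolding \<kappa>_def by (auto intro: inv_into_into f_inv_into_f)
      have "act (exp_curve q (\<tau> s1 - \<tau> s0)) (orbit v x (s0 + a)) = orbit q y (m a)"
        using \<delta>(2)[OF a] by (simp add: eq orbit_shift[OF q] m_def algebra_simps)
      also have "\<dots> = orbit v x (\<kappa> (m a))" using eq[OF \<kappa>(1)] \<kappa>(2) by simp
      finally have "act g (orbit v x (s0 + a)) = orbit v x (s0 - s1 + \<kappa> (m a))"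
        by (simp add: g_def act_mul orbit_shift[OF v])
      then show ?thesis by (simp add: P_def algebra_simps)
    qed
    have small: "\<bar>(P ^^ n) a\<bar> \<le> k ^ n * \<bar>a\<bar>" "\<bar>(P ^^ n) a\<bar> < \<delta>" if a: "\<bar>a\<bar> < \<delta>" for a n
    proof (induction n)
      case (Suc n)
      {
        case 1
        have "\<bar>P ((P ^^ n) a)\<bar> \<le> k * \<bar>(P ^^ n) a\<bar>" using \<delta>(2)[OF Suc(2)] by simp
        also have "\<dots> \<le> k * (k ^ n * \<bar>a\<bar>)" using Suc(1) k by (intro mult_left_mono) auto
        finally show ?case by (simp add: mult.assoc)
      next
        case 2
        have "\<bar>P ((P ^^ n) a)\<bar> \<le> k * \<bar>(P ^^ n) a\<bar>" using \<delta>(2)[OF Suc(2)] by simp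
        also have "\<dots> \<le> 1 * \<bar>(P ^^ n) a\<bar>" using k by (intro mult_right_mono) auto
        finally show ?case using Suc(2) by simp
      }
    qed (use a in auto)
    have iter: "act (gpow g n) (orbit v x (s0 + a)) = orbit v x (s0 + (P ^^ n) a)" if a: "\<bar>a\<bar> < \<delta>" for a n
      by (induction n) (simp_all add: act_mul g small(2)[OF a])
    have lim: "(\<lambda>n. act (gpow g n) (orbit v x (s0 + a))) \<longlonglongrightarrow> orbit v x s0" if a: "\<bar>a\<bar> < \<delta>" for a
    proof -
      have "(\<lambda>n. k ^ n * \<bar>a\<bar>) \<longlonglongrightarrow> 0 * \<bar>a\<bar>"
        by (intro tendsto_mult LIMSEQ_realpow_zero k tendsto_const)
      then have "(\<lambda>n. (P ^^ n) a) \<longlonglongrightarrow> 0"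
        by (intro Lim_null_comparison[of "\<lambda>n. (P ^^ n) a" "\<lambda>n. k ^ n * \<bar>a\<bar>"])
          (use small(1)[OF a] in auto)
      then have "(\<lambda>n. s0 + (P ^^ n) a) \<longlonglongrightarrow> s0 + 0" by (intro tendsto_add tendsto_const)
      then have "(\<lambda>n. orbit v x (s0 + (P ^^ n) a)) \<longlonglongrightarrow> orbit v x s0"
        by (intro isCont_tendsto_compose[OF isCont_orbit[OF v]]) simp
      then show ?thesis by (simp add: iter[OF a])
    qed
    have ne: "\<exists>a. \<bar>a\<bar> < d \<and> a \<noteq> 0 \<and> orbit v x (s0 + a) \<noteq> orbit v x s0" if d: "d > 0" for d
    proof (rule ccontr)
      assume "\<not> ?thesis"
      then have const: "orbit v x (s0 + a) = orbit v x s0" if "\<bar>a\<bar> < d" for a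
        using that by (cases "a = 0") auto
      have "ball s0 d \<subseteq> {s. orbit v x s = orbit v x s0}"
      proof
        fix s assume "s \<in> ball s0 d"
        then show "s \<in> {s. orbit v x s = orbit v x s0}" using const[of "s - s0"] by (simp add: dist_real_def)
      qed
      moreover have "s0 islimpt ball s0 d" using d by (simp add: islimpt_ball)
      ultimately have "s0 islimpt {s. orbit v x s = orbit v x s0}" using islimpt_subset by blast
      then have "\<forall>s. orbit v x s = orbit v x s0" using orbit_constant[OF v] by blast
      with nc show False by (auto simp: constant_on_def)
    qed
    obtain a1 where a1: "\<bar>a1\<bar> < \<delta>" "orbit v x (s0 + a1) \<noteq> orbit v x s0" using ne[OF \<delta>(1)] by blast
    \<comment> \<open>A second parameter close to \<open>0\<close> gives a point different from the first one, by the Hausdorff property.\<close>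
    obtain U V where UV: "open U" "orbit v x (s0 + a1) \<in> V" "orbit v x s0 \<in> U" "U \<inter> V = {}"
      using hausdorff[OF a1(2)] by blast
    have "\<forall>\<^sub>F s in nhds s0. orbit v x s \<in> U"
      by (rule isCont_eventually_in[OF isCont_orbit[OF v] UV(1,3)])
    then obtain d where d: "d > 0" "\<And>s. dist s s0 < d \<Longrightarrow> orbit v x s \<in> U"
      unfolding eventually_nhds_metric by blast
    obtain a2 where a2: "\<bar>a2\<bar> < min d \<delta>" "orbit v x (s0 + a2) \<noteq> orbit v x s0"
      using ne[of "min d \<delta>"] d(1) \<delta>(1) by auto
    have "orbit v x (s0 + a2) \<in> U" using a2(1) by (intro d(2)) (simp add: dist_real_def)
    then have "orbit v x (s0 + a1) \<noteq> orbit v x (s0 + a2)" using UV by auto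
    moreover have "\<exists>g. (\<lambda>n. act (g n) (orbit v x (s0 + a1))) \<longlonglongrightarrow> orbit v x s0 \<and>
        (\<lambda>n. act (g n) (orbit v x (s0 + a2))) \<longlonglongrightarrow> orbit v x s0"
      using lim[OF a1(1)] lim[of a2] a2(1) by (intro exI[of _ "gpow g"]) simp
    ultimately show False
      using sated[unfolded sated_def, rule_format, OF a1(2)[symmetric], of "orbit v x (s0 + a2)"] a2(2)
      by simp
  qed
  have abs_eq: "\<bar>\<tau>' s0\<bar> = \<bar>\<tau>' s1\<bar>" if "s0 \<in> J" "s1 \<in> J" for s0 s1
    using no_contraction[OF that] no_contraction[OF that(2,1)] by linarith
  have no_sign: "\<not> (\<tau>' s0 < 0 \<and> 0 < \<tau>' s1)" if "s0 \<in> J" "s1 \<in> J" for s0 s1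
  proof
    assume "\<tau>' s0 < 0 \<and> 0 < \<tau>' s1"
    moreover have "{\<tau>' s0..\<tau>' s1} \<subseteq> \<tau>' ` J"
      using that by (intro connected_contains_Icc connected_continuous_image[OF cont J(2)]) auto
    ultimately have "0 \<in> \<tau>' ` J" by auto
    then show False using nz by auto
  qed
  show ?thesis
  proof (cases "J = {}")
    case False
    then obtain s0 where s0: "s0 \<in> J" by blast
    define a where "a = \<tau>' s0"
    have a: "\<tau>' s = a" if "s \<in> J" for s
      using abs_eq[OF that s0] no_sign[OF that s0] no_sign[OF s0 that] nz[OF that] nz[OF s0]
      unfolding a_def by linarith
    have "((\<lambda>s. \<tau> s - a * s) has_field_derivative 0) (at s within J)" if "s \<in> J" for s
    proof (rule has_field_derivative_at_within)
      have "((\<lambda>s. \<tau> s - a * s) has_field_derivative \<tau>' s - a * 1) (at s)"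
        by (intro DERIV_diff \<tau> that DERIV_cmult DERIV_ident)
      then show "((\<lambda>s. \<tau> s - a * s) has_field_derivative 0) (at s)" by (simp add: a[OF that])
    qed
    then have "\<exists>b. \<forall>s\<in>J. \<tau> s - a * s = b"
      using J(2) by (intro has_field_derivative_zero_constant) (auto simp: connected_convex_1)
    then obtain b where "\<forall>s\<in>J. \<tau> s - a * s = b" by blast
    then show ?thesis by (intro exI[of _ a] exI[of _ b]) (auto simp: algebra_simps)
  qed auto
qed

end

section \<open>Comparison of two exponential representations\<close>

lemma constant_on_interior_imp_constant_on:
  fixes f :: "real \<Rightarrow> 'a::t2_space"
  assumes D: "real_interval D" and cont: "\<And>t. t \<in> D \<Longrightarrow> isCont f t"
    and const: "f constant_on interior D"
  shows "f constant_on D"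
proof -
  obtain c where c: "\<And>t. t \<in> interior D \<Longrightarrow> f t = c" using const unfolding constant_on_def by blast
  have "f t = c" if t: "t \<in> D" for t
  proof -
    have "convex D" using D by (simp add: real_interval_def connected_convex_1)
    then have "closure (interior D) = closure D"
      using D by (intro convex_closure_interior) (auto simp: real_interval_def)
    then have "t \<in> closure (interior D)" using t closure_subset by blast
    then obtain u where u: "\<And>n. u n \<in> interior D" "u \<longlonglongrightarrow> t" unfolding closure_sequential by blast
    have "(\<lambda>n. f (u n)) \<longlonglongrightarrow> f t" by (rule isCont_tendsto_compose[OF cont[OF t] u(2)])
    then have "(\<lambda>n. c) \<longlonglongrightarrow> f t" using c u(1) by simp
    then show ?thesis using LIMSEQ_unique tendsto_const by blast
  qed
  then show ?thesis unfolding constant_on_def by blast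
qed

lemma analytic_real_function_iff:
  fixes \<rho> :: "real \<Rightarrow> real"
  shows "analytic_map_on std_atlas std_atlas I \<rho> \<longleftrightarrow> continuous_on I \<rho> \<and> (\<forall>t\<in>I. real_analytic_at \<rho> t)"
  unfolding analytic_map_on_curve_iff by (simp add: std_atlas_def)

lemma analytic_real_function_obtain:
  assumes "analytic_curve_on std_atlas D (\<rho> :: real \<Rightarrow> real)"
  obtains \<rho>' where "\<And>t. t \<in> D \<Longrightarrow> \<rho>' t = \<rho> t" "\<And>t. t \<in> D \<Longrightarrow> real_analytic_at \<rho>' t"
    "\<And>t. t \<in> D \<Longrightarrow> isCont \<rho>' t"
proof -
  obtain I \<rho>' where "open I" "D \<subseteq> I" "analytic_map_on std_atlas std_atlas I \<rho>'" "\<forall>t\<in>D. \<rho>' t = \<rho> t"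
    using assms unfolding analytic_curve_on_def by blast
  then show ?thesis
    using that[of \<rho>'] by (auto simp: analytic_real_function_iff continuous_on_eq_continuous_at)
qed

lemma analytic_real_function_affine:
  assumes "analytic_curve_on std_atlas D (\<rho> :: real \<Rightarrow> real)"
  shows "analytic_curve_on std_atlas D (\<lambda>t. a * \<rho> t + b)"
proof -
  obtain I \<rho>' where I: "open I" "real_interval I" "D \<subseteq> I" "\<forall>t\<in>D. \<rho>' t = \<rho> t"
    and an: "continuous_on I \<rho>'" "\<And>t. t \<in> I \<Longrightarrow> real_analytic_at \<rho>' t"
    using assms unfolding analytic_curve_on_def analytic_real_function_iff by blast
  have "continuous_on I (\<lambda>t. a * \<rho>' t + b)" by (intro continuous_intros an(1))
  moreover have "real_analytic_at (\<lambda>t. a * \<rho>' t + b) t" if "t \<in> I" for t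
    by (rule real_analytic_curve_compose[OF an(2)[OF that] real_analytic_at_affine])
  ultimately show ?thesis
    unfolding analytic_curve_on_def analytic_real_function_iff using I by (metis (no_types, lifting))
qed

context analytic_action
begin

lemma exponential_curve_orbit:
  "exponential_curve G mul M act D \<gamma> x v \<longleftrightarrow>
     analytic_curve_on M D \<gamma> \<and>
     (\<exists>\<rho>. analytic_curve_on std_atlas D \<rho> \<and> (\<forall>t\<in>D. \<gamma> t = orbit v x (\<rho> t)))"
  by (simp add: exponential_curve_def orbit_def)

lemma orbits_agree:
  assumes v: "v \<in> lie_algebra G e" and q: "q \<in> lie_algebra G e"
    and J: "open J" "J \<noteq> {}" and eq: "\<And>s. s \<in> J \<Longrightarrow> orbit v x s = orbit q y (a * s + b)"
  shows "orbit v x s = orbit q y (a * s + b)"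
proof -
  obtain s0 where s0: "s0 \<in> J" using J(2) by blast
  have "s0 islimpt J" using interior_limit_point[of s0 J] s0 J(1) by (simp add: interior_open)
  then have "s0 islimpt {s. orbit v x s = orbit q y (a * s + b)}"
    by (rule islimpt_subset) (use eq in auto)
  moreover have "analytic_map_on std_atlas M UNIV (\<lambda>s. orbit q y (a * s + b))"
    by (rule M.analytic_curve_affine[OF orbit_analytic[OF q]]) simp
  ultimately show ?thesis
    using M.analytic_curves_identity[OF orbit_analytic[OF v]] open_UNIV connected_UNIV by blast
qed

text \<open>The parameter values of a non-constant curve contain an interval, on which the translated orbit
  agrees with the orbit.\<close>

theorem stabilizer_fixes_orbit:
  assumes v: "v \<in> lie_algebra G e" and D: "connected D"
    and \<rho>: "continuous_on D \<rho>" "\<And>t. t \<in> D \<Longrightarrow> \<gamma> t = orbit v x (\<rho> t)"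
    and nc: "\<not> \<gamma> constant_on D" and g: "g \<in> curve_stabilizer act D \<gamma>"
  shows "act g (orbit v x s) = orbit v x s"
proof -
  obtain t1 t2 where t: "t1 \<in> D" "t2 \<in> D" "\<gamma> t1 \<noteq> \<gamma> t2"
    using nc unfolding constant_on_def by metis
  have "\<rho> t1 islimpt \<rho> ` D"
    by (rule connected_real_islimpt[of _ _ "\<rho> t2"]) (use t \<rho> D in \<open>auto intro: connected_continuous_image\<close>)
  then have "\<rho> t1 islimpt {s. act g (orbit v x s) = orbit v x s}"
  proof (rule islimpt_subset)
    show "\<rho> ` D \<subseteq> {s. act g (orbit v x s) = orbit v x s}"
    proof clarify
      fix t assume t: "t \<in> D"
      then have "act g (\<gamma> t) = \<gamma> t" using g by (simp add: curve_stabilizer_def)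
      then show "act g (orbit v x (\<rho> t)) = orbit v x (\<rho> t)" by (simp only: \<rho>(2)[OF t])
    qed
  qed
  then show ?thesis
    using M.analytic_curves_identity[OF translated_orbit_analytic[OF v] orbit_analytic[OF v]]
      open_UNIV connected_UNIV by blast
qed

text \<open>The function \<open>\<rho>\<close> is not constant on the interior of \<open>D\<close> because \<open>\<gamma>\<close> is not constant, hence it is
  regular on some ball. If \<open>\<sigma>\<close> were constant there, then so would be the orbit of \<open>x\<close> on an interval,
  hence everywhere; thus \<open>\<sigma>\<close> is also regular on a smaller ball. On its image, the composition of \<open>\<sigma>\<close>
  with the local inverse \<open>\<kappa>\<close> of \<open>\<rho>\<close> is a reparametrization as in
  \<open>sated_reparametrization_affine\<close>.\<close>

theorem exponential_affine_relation:
  assumes sated: "sated act" and v: "v \<in> lie_algebra G e" and q: "q \<in> lie_algebra G e"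
    and D: "real_interval D" and nc: "\<not> \<gamma> constant_on D"
    and \<rho>: "\<And>t. t \<in> D \<Longrightarrow> real_analytic_at \<rho> t" "\<And>t. t \<in> D \<Longrightarrow> isCont \<rho> t"
      "\<And>t. t \<in> D \<Longrightarrow> \<gamma> t = orbit v x (\<rho> t)"
    and \<sigma>: "\<And>t. t \<in> D \<Longrightarrow> real_analytic_at \<sigma> t" "\<And>t. t \<in> D \<Longrightarrow> \<gamma> t = orbit q y (\<sigma> t)"
  shows "\<exists>a b. a \<noteq> 0 \<and> (\<forall>s. orbit v x s = orbit q y (a * s + b))"
proof -
  have int: "open (interior D)" "connected (interior D)" "interior D \<subseteq> D"
    using D by (auto simp: real_interval_def connected_convex_1 convex_interior interior_subset)
  have nc_orbit: "\<not> orbit v x constant_on UNIV"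
    using nc \<rho>(3) unfolding constant_on_def by (metis UNIV_I)
  have "\<not> \<rho> constant_on interior D"
  proof
    assume "\<rho> constant_on interior D"
    then have "\<rho> constant_on D" using constant_on_interior_imp_constant_on[OF D \<rho>(2)] by blast
    with nc \<rho>(3) show False unfolding constant_on_def by metis
  qed
  then obtain t1 r1 \<rho>' where T1: "r1 > 0" "ball t1 r1 \<subseteq> interior D" "continuous_on (ball t1 r1) \<rho>'"
    and \<rho>': "\<And>s. s \<in> ball t1 r1 \<Longrightarrow> (\<rho> has_field_derivative \<rho>' s) (at s) \<and> \<rho>' s \<noteq> 0"
    using real_analytic_nonconstant_derivative[of "interior D" \<rho>] int \<rho>(1) by blast
  have ball_D: "s \<in> D" if "s \<in> ball t1 r1" for s using that T1(2) int(3) by blast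
  have ball: "open (ball t1 r1)" "connected (ball t1 r1)" by auto
  note inv1 = inverse_function_on_interval[OF ball conjunct1[OF \<rho>'] conjunct2[OF \<rho>']]
  have "\<not> \<sigma> constant_on ball t1 r1"
  proof
    assume "\<sigma> constant_on ball t1 r1"
    then obtain c where c: "\<And>s. s \<in> ball t1 r1 \<Longrightarrow> \<sigma> s = c" unfolding constant_on_def by blast
    have "\<rho> ` ball t1 r1 \<subseteq> {s. orbit v x s = orbit q y c}"
    proof clarify
      fix s assume s: "s \<in> ball t1 r1"
      show "orbit v x (\<rho> s) = orbit q y c"
        using \<rho>(3)[OF ball_D[OF s]] \<sigma>(2)[OF ball_D[OF s]] c[OF s] by simp
    qed
    moreover have "open (\<rho> ` ball t1 r1)" by (rule inv1(2))
    moreover have "\<rho> t1 \<in> \<rho> ` ball t1 r1" using T1(1) by simp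
    ultimately have "\<rho> t1 islimpt {s. orbit v x s = orbit q y c}"
      using interior_limit_point[of "\<rho> t1" "\<rho> ` ball t1 r1"] interior_open islimpt_subset by blast
    then have "\<forall>s. orbit v x s = orbit q y c" using orbit_constant[OF v] by blast
    with nc_orbit show False unfolding constant_on_def by blast
  qed
  then obtain t2 r2 \<sigma>' where T2: "r2 > 0" "ball t2 r2 \<subseteq> ball t1 r1" "continuous_on (ball t2 r2) \<sigma>'"
    and \<sigma>': "\<And>s. s \<in> ball t2 r2 \<Longrightarrow> (\<sigma> has_field_derivative \<sigma>' s) (at s) \<and> \<sigma>' s \<noteq> 0"
    using real_analytic_nonconstant_derivative[of "ball t1 r1" \<sigma>] ball \<sigma>(1) ball_D by blast
  define T where "T = ball t2 r2"
  define J where "J = \<rho> ` T"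
  define \<kappa> where "\<kappa> = inv_into T \<rho>"
  have T: "open T" "connected T" "T \<noteq> {}" using T2(1) by (auto simp: T_def)
  have T\<rho>: "(\<rho> has_field_derivative \<rho>' s) (at s)" "\<rho>' s \<noteq> 0" if "s \<in> T" for s
    using \<rho>'[of s] that T2(2) by (auto simp: T_def)
  have T\<sigma>: "(\<sigma> has_field_derivative \<sigma>' s) (at s)" "\<sigma>' s \<noteq> 0" if "s \<in> T" for s
    using \<sigma>'[of s] that by (auto simp: T_def)
  note inv2 = inverse_function_on_interval[OF T(1,2) T\<rho>]
  have \<kappa>: "\<kappa> s \<in> T" "\<rho> (\<kappa> s) = s" if "s \<in> J" for s
    using that unfolding J_def \<kappa>_def by (auto intro: inv_into_into f_inv_into_f)
  have \<kappa>': "(\<kappa> has_field_derivative inverse (\<rho>' (\<kappa> s))) (at s)" if "s \<in> J" for s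
    using inv2(4)[OF _ _ \<kappa>(1)[OF that]] \<kappa>(2)[OF that] by (simp add: \<kappa>_def)
  have \<kappa>_cont: "continuous_on J \<kappa>"
    using \<kappa>' by (meson DERIV_isCont continuous_at_imp_continuous_on)
  have "\<exists>a b. \<forall>s\<in>J. (\<sigma> \<circ> \<kappa>) s = a * s + b"
  proof (rule sated_reparametrization_affine[OF sated v q])
    show "open J" "connected J" unfolding J_def by (rule inv2(2), assumption+, rule inv2(3), assumption+)
    show "((\<sigma> \<circ> \<kappa>) has_field_derivative \<sigma>' (\<kappa> s) * inverse (\<rho>' (\<kappa> s))) (at s)" if "s \<in> J" for s
      by (rule DERIV_chain[OF T\<sigma>(1)[OF \<kappa>(1)[OF that]] \<kappa>'[OF that]])
    show "\<sigma>' (\<kappa> s) * inverse (\<rho>' (\<kappa> s)) \<noteq> 0" if "s \<in> J" for s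
      using T\<sigma>(2)[OF \<kappa>(1)[OF that]] T\<rho>(2)[OF \<kappa>(1)[OF that]] by simp
    have "continuous_on T \<sigma>'" "continuous_on T \<rho>'"
      using T2(3) continuous_on_subset[OF T1(3) T2(2)] by (simp_all add: T_def)
    then show "continuous_on J (\<lambda>s. \<sigma>' (\<kappa> s) * inverse (\<rho>' (\<kappa> s)))"
      using T\<rho>(2) \<kappa>(1)
      by (intro continuous_intros continuous_on_compose2[OF _ \<kappa>_cont]) auto
    show "orbit v x s = orbit q y ((\<sigma> \<circ> \<kappa>) s)" if "s \<in> J" for s
    proof -
      have "\<kappa> s \<in> D" using \<kappa>(1)[OF that] T2(2) ball_D by (auto simp: T_def)
      then show ?thesis using \<rho>(3) \<sigma>(2) \<kappa>(2)[OF that] by (metis comp_apply)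
    qed
  qed (rule nc_orbit)
  then obtain a b where ab: "\<And>s. s \<in> J \<Longrightarrow> \<sigma> (\<kappa> s) = a * s + b" by auto
  have agree: "orbit v x s = orbit q y (a * s + b)" for s
  proof (rule orbits_agree[OF v q])
    show "open J" unfolding J_def by (rule inv2(2))
    show "J \<noteq> {}" using T(3) by (simp add: J_def)
    show "orbit v x s = orbit q y (a * s + b)" if "s \<in> J" for s
    proof -
      have "\<kappa> s \<in> D" using \<kappa>(1)[OF that] T2(2) ball_D by (auto simp: T_def)
      then show ?thesis using \<rho>(3) \<sigma>(2) \<kappa>(2)[OF that] ab[OF that] by metis
    qed
  qed
  have "a \<noteq> 0"
  proof
    assume "a = 0"
    then have "\<forall>s. orbit v x s = orbit q y b" using agree by simp
    with nc_orbit show False unfolding constant_on_def by blast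
  qed
  with agree show ?thesis by blast
qed

text \<open>Going forward with \<open>exp(u q)\<close> and back with \<open>exp(- (u / a) v)\<close> is the identity on the orbit.\<close>

theorem stabilizer_difference:
  assumes v: "v \<in> lie_algebra G e" and q: "q \<in> lie_algebra G e" and a: "a \<noteq> 0"
    and agree: "\<And>s. orbit v x s = orbit q y (a * s + b)"
    and \<rho>: "\<And>t. t \<in> D \<Longrightarrow> \<gamma> t = orbit v x (\<rho> t)"
  shows "tangent_add q (tangent_scale (- (1 / a)) v)
    \<in> subgroup_lie_algebra G mul e (curve_stabilizer act D \<gamma>)"
proof -
  let ?v = "tangent_scale (- (1 / a)) v"
  have v': "?v \<in> lie_algebra G e" by (rule tangent_scale_in[OF v])
  have fixed: "act (exp_curve (tangent_add q ?v) t) p = p" if p: "p \<in> range (orbit v x)" for t p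
  proof (rule exp_sum_acts[OF q v', where P = "range (orbit v x)" and \<psi> = "\<lambda>u p. p"])
    fix u p assume "p \<in> range (orbit v x)"
    then obtain s where s: "p = orbit v x s" by blast
    have "act (exp_curve ?v u) p = orbit v x (u * - (1 / a) + s)"
      unfolding s exp_curve_scale by (rule orbit_shift[OF v])
    also have "\<dots> = orbit q y (a * s + b - u)"
    proof -
      have "a * (u * - (1 / a) + s) + b = a * s + b - u" using a by (simp add: algebra_simps)
      then show ?thesis by (simp only: agree)
    qed
    finally have "act (mul (exp_curve q u) (exp_curve ?v u)) p = orbit q y (u + (a * s + b - u))"
      unfolding act_mul by (simp only: orbit_shift[OF q])
    then show "act (mul (exp_curve q u) (exp_curve ?v u)) p = p" by (simp add: s agree)
  qed (use p in auto)
  have "exp_curve (tangent_add q ?v) t \<in> curve_stabilizer act D \<gamma>" for t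
    using fixed \<rho> by (simp add: curve_stabilizer_def)
  then show ?thesis using tangent_add_in[OF q v'] by (simp add: subgroup_lie_algebra_def)
qed

text \<open>The factor \<open>exp(u w)\<close> acts trivially on the orbit, hence drops out of the product formula.\<close>

theorem orbit_add_stabilizer:
  assumes v: "v \<in> lie_algebra G e" and w: "w \<in> subgroup_lie_algebra G mul e H"
    and H: "\<And>g s. g \<in> H \<Longrightarrow> act g (orbit v x s) = orbit v x s"
  shows "orbit (tangent_add (tangent_scale r v) w) (orbit v x s0) t = orbit v x (r * t + s0)"
proof -
  let ?v = "tangent_scale r v"
  have v': "?v \<in> lie_algebra G e" by (rule tangent_scale_in[OF v])
  have w': "w \<in> lie_algebra G e" and wH: "\<And>t. exp_curve w t \<in> H"
    using w by (auto simp: subgroup_lie_algebra_def)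
  have shift: "act (exp_curve ?v u) (orbit v x s) = orbit v x (u * r + s)" for u s
    unfolding exp_curve_scale by (rule orbit_shift[OF v])
  have "act (exp_curve (tangent_add ?v w) t) (orbit v x s0)
      = act (exp_curve ?v t) (orbit v x s0)"
  proof (rule exp_sum_acts[OF v' w', where P = "range (orbit v x)"
        and \<psi> = "\<lambda>u. act (exp_curve ?v u)"])
    fix u p assume "p \<in> range (orbit v x)"
    then obtain s where s: "p = orbit v x s" by blast
    show "act (exp_curve ?v u) p \<in> range (orbit v x)" unfolding s shift by simp
    show "act (exp_curve ?v u) (act (exp_curve ?v u) p)
        = act (exp_curve ?v (2 * u)) p"
      unfolding s shift by (simp add: algebra_simps)
    show "act (mul (exp_curve ?v u) (exp_curve w u)) p = act (exp_curve ?v u) p"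
      unfolding s act_mul H[OF wH] ..
  qed simp
  then show ?thesis unfolding shift by (simp add: orbit_def[of "tangent_add _ _"] mult.commute)
qed

end

theorem propositionB:
  fixes G :: "('g::t2_space, 'k::euclidean_space) atlas"
    and mul :: "'g \<Rightarrow> 'g \<Rightarrow> 'g" and e :: 'g and invg :: "'g \<Rightarrow> 'g"
    and M :: "('m::t2_space, 'e::euclidean_space) atlas"
    and act :: "'g \<Rightarrow> 'm \<Rightarrow> 'm"
    and D :: "real set" and \<gamma> :: "real \<Rightarrow> 'm"
    and x y :: 'm and v q :: "('g, 'k) tangent"
  assumes "lie_group G mul e invg"
    and "analytic_manifold M"
    and "left_action mul e act"
    and "\<And>z. continuous_on UNIV (\<lambda>g. act g z)"
    and "sated act"
    and "separately_analytic G M act"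
    and "real_interval D"
    and "analytic_curve_on M D \<gamma>"
    and "\<not> \<gamma> constant_on D"
    and "v \<in> lie_algebra G e"
    and "exponential_curve G mul M act D \<gamma> x v"
    and "q \<in> lie_algebra G e"
  shows "exponential_curve G mul M act D \<gamma> y q \<longleftrightarrow>
     y \<in> {act (lie_exp G mul (tangent_scale s v)) x | s. True} \<and>
     q \<in> {tangent_add (tangent_scale r v) w | r w.
            r \<noteq> 0 \<and> w \<in> subgroup_lie_algebra G mul e (curve_stabilizer act D \<gamma>)}"
    (is "?L \<longleftrightarrow> y \<in> ?Y \<and> q \<in> ?Q")
proof -
  interpret analytic_action G mul e invg M act
    by (rule analytic_action.intro[OF assms(1) analytic_action_axioms.intro[OF assms(2,3,6)]])
  note v = \<open>v \<in> lie_algebra G e\<close> and q = \<open>q \<in> lie_algebra G e\<close>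
  obtain \<rho>0 where \<rho>0: "analytic_curve_on std_atlas D \<rho>0" "\<And>t. t \<in> D \<Longrightarrow> \<gamma> t = orbit v x (\<rho>0 t)"
    using assms(11) unfolding exponential_curve_orbit by blast
  obtain \<rho> where \<rho>: "\<And>t. t \<in> D \<Longrightarrow> \<rho> t = \<rho>0 t" "\<And>t. t \<in> D \<Longrightarrow> real_analytic_at \<rho> t"
      "\<And>t. t \<in> D \<Longrightarrow> isCont \<rho> t"
    by (rule analytic_real_function_obtain[OF \<rho>0(1)]) blast
  have \<gamma>: "\<gamma> t = orbit v x (\<rho> t)" if "t \<in> D" for t using \<rho>0(2) \<rho>(1) that by simp
  show ?thesis
  proof
    assume ?L
    then obtain \<sigma>0 where \<sigma>0: "analytic_curve_on std_atlas D \<sigma>0" "\<And>t. t \<in> D \<Longrightarrow> \<gamma> t = orbit q y (\<sigma>0 t)"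
      unfolding exponential_curve_orbit by blast
    obtain \<sigma> where \<sigma>: "\<And>t. t \<in> D \<Longrightarrow> \<sigma> t = \<sigma>0 t" "\<And>t. t \<in> D \<Longrightarrow> real_analytic_at \<sigma> t"
      by (rule analytic_real_function_obtain[OF \<sigma>0(1)]) blast
    have \<gamma>': "\<gamma> t = orbit q y (\<sigma> t)" if "t \<in> D" for t using \<sigma>0(2) \<sigma>(1) that by simp
    obtain a b where a: "a \<noteq> 0" and agree: "\<And>s. orbit v x s = orbit q y (a * s + b)"
      using exponential_affine_relation[OF assms(5) v q assms(7,9) \<rho>(2,3) \<gamma> \<sigma>(2) \<gamma>'] by blast
    have "y = orbit v x (- b / a)" using agree[of "- b / a"] a orbit_0[OF q] by simp
    then have "y \<in> ?Y" unfolding orbit_def by blast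
    moreover have "q \<in> ?Q"
    proof -
      have "q = tangent_add (tangent_scale (1 / a) v) (tangent_add q (tangent_scale (- (1 / a)) v))"
        by (auto simp: tangent_add_def tangent_scale_def)
      moreover have "1 / a \<noteq> 0" using a by simp
      moreover have "tangent_add q (tangent_scale (- (1 / a)) v)
          \<in> subgroup_lie_algebra G mul e (curve_stabilizer act D \<gamma>)"
        by (rule stabilizer_difference[OF v q a agree]) (rule \<gamma>)
      ultimately show ?thesis by blast
    qed
    ultimately show "y \<in> ?Y \<and> q \<in> ?Q" ..
  next
    assume "y \<in> ?Y \<and> q \<in> ?Q"
    then obtain s0 r w where y: "y = orbit v x s0" and qrw: "q = tangent_add (tangent_scale r v) w" and r: "r \<noteq> 0"
      and w: "w \<in> subgroup_lie_algebra G mul e (curve_stabilizer act D \<gamma>)"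
      unfolding orbit_def by blast
    have D: "connected D" using assms(7) by (simp add: real_interval_def)
    have \<rho>_cont: "continuous_on D \<rho>" using \<rho>(3) by (rule continuous_at_imp_continuous_on[rule_format])
    have orb: "orbit q y t = orbit v x (r * t + s0)" for t
      unfolding y qrw
      by (rule orbit_add_stabilizer[OF v w]) (rule stabilizer_fixes_orbit[OF v D \<rho>_cont \<gamma> assms(9)])
    have "analytic_curve_on std_atlas D (\<lambda>t. (1 / r) * \<rho>0 t + (- s0 / r))"
      by (rule analytic_real_function_affine[OF \<rho>0(1)])
    moreover have "\<gamma> t = orbit q y ((1 / r) * \<rho>0 t + (- s0 / r))" if "t \<in> D" for t
      unfolding orb \<rho>0(2)[OF that] using r by (simp add: field_simps)
    ultimately show ?L unfolding exponential_curve_orbit using assms(8) by blast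
  qed
qed

end
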